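(* Let $k\geq 4$. Every $k$-oriented Spherical Diagram with alignment $(2,2,\dots,2,k-1)$ has at least six swirls and at least nine arcs; if it is moreover a Spherical Occlusion Diagram, it has at least $11$ arcs. These bounds are tight: for every $k\ge 4$ there exist $k$-oriented SDs with this alignment having exactly six swirls and nine arcs, and $k$-oriented SODs with this alignment having exactly six swirls and $11$ arcs.
   Context: A geodesic arc on the unit sphere in $\mathbb R^3$ is the unique shortest curve joining two non-antipodal points. An arc $a$ blocks an arc $b$ (equivalently, $b$ hits $a$) if an endpoint of $b$ lies in the relative interior of $a$. A Spherical Diagram (SD) is a finite non-empty collection $\mathcal D$ of pairwise interior-disjoint geodesic arcs on the unit sphere such that each arc of $\mathcal D$ is blocked by arcs of $\mathcal D$ at each of its endpoints. A Spherical Occlusion Diagram (SOD) is an SD such that all arcs of $\mathcal D$ that hit the same arc of $\mathcal D$ reach it from the same side. A swirl of an SD is a cycle of arcs, each of which hits the next (and the last hits the first), going either all clockwise or all counterclockwise. An SD $\mathcal D$ is $k$-oriented if there exist a set $P$ of $k$ points on the unit sphere (poles), no two antipodal, and a function $f\colon\mathcal D\to P$ such that each arc $a\in\mathcal D$ lies on a great circle through $f(a)$ but contains neither $f(a)$ nor its antipode $-f(a)$. A $k$-oriented SD with poles $p_1,\dots,p_k$ has alignment $(d_1,\dots,d_k)$ (listed in nondecreasing order) if, for each $i$, there are exactly $d_i$ distinct great circles containing $p_i$ and at least one other pole. Thus alignment $(2,\dots,2,k-1)$ means that all poles but one lie on a common great circle. *)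

theory Defs
  imports "HOL-Analysis.Analysis" "HOL-Library.Multiset"
begin

type_synonym point = "real^3"

text \<open>A geodesic arc is represented by the ordered pair of its endpoints; its point set
  is the shortest great-circle arc joining them (the endpoints must be distinct,
  non-antipodal unit vectors).\<close>
type_synonym arc = "point \<times> point"

definition on_sphere :: "point \<Rightarrow> bool" where
  "on_sphere p \<longleftrightarrow> norm p = 1"

definition valid_arc :: "arc \<Rightarrow> bool" where
  "valid_arc a \<longleftrightarrow> on_sphere (fst a) \<and> on_sphere (snd a) \<and> fst a \<noteq> snd a \<and> fst a \<noteq> - snd a"

text \<open>All points of the arc (central projection of the chord).\<close>
definition arc_points :: "arc \<Rightarrow> point set" where
  "arc_points a = {sgn ((1 - t) *\<^sub>R fst a + t *\<^sub>R snd a) | t. 0 \<le> t \<and> t \<le> 1}"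

definition arc_relint :: "arc \<Rightarrow> point set" where
  "arc_relint a = {sgn ((1 - t) *\<^sub>R fst a + t *\<^sub>R snd a) | t. 0 < t \<and> t < 1}"

definition blocks :: "arc \<Rightarrow> arc \<Rightarrow> bool" where
  "blocks a b \<longleftrightarrow> fst b \<in> arc_relint a \<or> snd b \<in> arc_relint a"

definition spherical_diagram :: "arc set \<Rightarrow> bool" where
  "spherical_diagram D \<longleftrightarrow>
     finite D \<and> D \<noteq> {} \<and> (\<forall>a\<in>D. valid_arc a) \<and>
     (\<forall>a\<in>D. \<forall>b\<in>D. a \<noteq> b \<longrightarrow> arc_relint a \<inter> arc_relint b = {}) \<and>
     (\<forall>a\<in>D. (\<exists>b\<in>D. fst a \<in> arc_relint b) \<and> (\<exists>b\<in>D. snd a \<in> arc_relint b))"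

definition hits_from_side :: "arc \<Rightarrow> arc \<Rightarrow> real \<Rightarrow> bool" where
  "hits_from_side b a s \<longleftrightarrow>
     (\<exists>p q. (b = (p, q) \<or> b = (q, p)) \<and> p \<in> arc_relint a \<and>
            sgn (q \<bullet> cross3 (fst a) (snd a)) = s)"

definition spherical_occlusion_diagram :: "arc set \<Rightarrow> bool" where
  "spherical_occlusion_diagram D \<longleftrightarrow> spherical_diagram D \<and>
     (\<forall>a\<in>D. \<forall>b\<in>D. \<forall>c\<in>D. \<forall>s t. hits_from_side b a s \<and> hits_from_side c a t \<longrightarrow> s = t)"

definition triple :: "point \<Rightarrow> point \<Rightarrow> point \<Rightarrow> real" where
  "triple x y z = x \<bullet> cross3 y z"

text \<open>A swirl: a cyclic sequence of distinct arcs a_0,...,a_(m-1) of D such that a_i hits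
  a_(i+1 mod m) with its endpoint p_i (its other endpoint being q_i), and all the turns
  q_i -> p_i -> p_(i+1) (arriving along a_i at p_i, then continuing along a_(i+1) towards
  its endpoint p_(i+1)) have the same orientation (all clockwise or all counterclockwise).\<close>
definition is_swirl :: "arc set \<Rightarrow> arc list \<Rightarrow> bool" where
  "is_swirl D xs \<longleftrightarrow> xs \<noteq> [] \<and> distinct xs \<and> set xs \<subseteq> D \<and>
     (\<exists>p q :: nat \<Rightarrow> point.
        (\<forall>i<length xs. (xs ! i = (q i, p i) \<or> xs ! i = (p i, q i)) \<and>
                        p i \<in> arc_relint (xs ! ((i + 1) mod length xs))) \<and>
        ((\<forall>i<length xs. triple (q i) (p i) (p ((i + 1) mod length xs)) > 0) \<or>
         (\<forall>i<length xs. triple (q i) (p i) (p ((i + 1) mod length xs)) < 0)))"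

definition num_swirls :: "arc set \<Rightarrow> nat" where
  "num_swirls D = card ((\<lambda>xs. {rotate n xs | n. True}) ` {xs. is_swirl D xs})"

definition oriented_by :: "arc set \<Rightarrow> point set \<Rightarrow> (arc \<Rightarrow> point) \<Rightarrow> bool" where
  "oriented_by D P f \<longleftrightarrow>
     (\<forall>p\<in>P. on_sphere p) \<and> (\<forall>p\<in>P. \<forall>q\<in>P. p \<noteq> - q) \<and>
     (\<forall>a\<in>D. f a \<in> P \<and> f a \<bullet> cross3 (fst a) (snd a) = 0 \<and>
              f a \<notin> arc_points a \<and> - f a \<notin> arc_points a)"

definition k_oriented :: "nat \<Rightarrow> arc set \<Rightarrow> bool" where
  "k_oriented k D \<longleftrightarrow> (\<exists>P f. finite P \<and> card P = k \<and> oriented_by D P f)"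

text \<open>Number of distinct great circles (= planes through the origin) containing pole p and
  at least one other pole.\<close>
definition circles_through :: "point set \<Rightarrow> point \<Rightarrow> nat" where
  "circles_through P p = card ((\<lambda>q. span {p, q}) ` (P - {p}))"

definition has_alignment :: "point set \<Rightarrow> nat list \<Rightarrow> bool" where
  "has_alignment P ds \<longleftrightarrow> sorted ds \<and> mset ds = image_mset (circles_through P) (mset_set P)"

definition k_oriented_with_alignment :: "nat \<Rightarrow> nat list \<Rightarrow> arc set \<Rightarrow> bool" where
  "k_oriented_with_alignment k ds D \<longleftrightarrow>
     (\<exists>P f. finite P \<and> card P = k \<and> oriented_by D P f \<and> has_alignment P ds)"

end

(*
  Let N be the pole off the common great circle (the equator) of the other poles. An arc directed by
  an equatorial pole does not cross the equator, so all arcs crossing it are meridian arcs.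
  Extremality shows that there are at least three crossing arcs, and each direction around N is
  covered by a non-meridian arc of either hemisphere, which yields three arcs in each of them; three
  arcs only would have to be hit from both sides, so one-sidedness forces four. This gives 9 and 11.

  For the swirls, project an open quarter of the sphere (half of a hemisphere bounded by a meridian)
  centrally to a half-plane in which meridians are vertical. Walking along arcs and always turning
  right (or always left), one is either trapped in shrinking rooms and ends in a cycle, or escapes
  downwards along a meridian arc; if all walks escaped, two of them would have to cross. So every such
  quarter contains a whole swirl. Two swirls can be avoided by turning the quarter around N, hence
  each hemisphere has three swirls.

  The bounds are attained by two diagrams with integer direction vectors that use only four poles; the
  other poles are added on the equator.
*)
theory Submission
  imports Defs
begin

text \<open>Why a walk is trapped: a rightward walk that bends right leaves each arc only at its end
  and passes to one that comes from above, so an arc from below can end on the walk but not cross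
  it. The walk is a one-way ceiling. When it must turn back, ceiling and floor exchange roles under
  a half-turn, which keeps right turns right; unless the walk closes up, the room loses an abscissa
  at which something ends. The obstacle is that arcs leave the open quarter. Their outer ends are
  put on the border of a strip, and all that is remembered of the outside is that such segments rise
  towards the border. As slopes decrease along a rightward walk, a vertical cannot have both its
  walks running off; this is what makes escaping walks cross. For the counts, longitude around
  \<open>N\<close> matters: a non-radial arc spans less than a half-turn, so it covers neither its
  own ends nor the opposite directions, and other arcs are needed there. In an occlusion diagram an
  arc that carries the top of a crossing arc is hit from outside only; with three arcs, two of them
  would pass outside each other.\<close>

section \<open>Planar arrangements\<close>

text \<open>\<open>seg\<close> are non-vertical segments (abscissas from \<open>lf\<close> to \<open>rt\<close>, height \<open>ht\<close>, slope \<open>sl\<close>), \<open>ver\<close> are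
  vertical ones (abscissa \<open>xv\<close>, from \<open>bt\<close> up to \<open>tp\<close>). The sets \<open>lbl\<close>, \<open>rbl\<close>, \<open>bbl\<close>, \<open>tbl\<close> tell which left,
  right, bottom and top ends are blocked; the other left and right ends lie on the boundary of the
  strip of half-width \<open>wd\<close>.\<close>
record 'a chart =
  seg :: "'a set"
  ver :: "'a set"
  lf :: "'a \<Rightarrow> real"
  rt :: "'a \<Rightarrow> real"
  ht :: "'a \<Rightarrow> real \<Rightarrow> real"
  sl :: "'a \<Rightarrow> real"
  xv :: "'a \<Rightarrow> real"
  bt :: "'a \<Rightarrow> real"
  tp :: "'a \<Rightarrow> real"
  lbl :: "'a set"
  rbl :: "'a set"
  bbl :: "'a set"
  tbl :: "'a set"
  wd :: real

text \<open>Open at both ends, because disjointness concerns relative interiors only.\<close>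

definition over :: "'a chart \<Rightarrow> 'a \<Rightarrow> real \<Rightarrow> bool" where
  "over A a X \<longleftrightarrow> lf A a < X \<and> X < rt A a"

text \<open>\<open>lin\<close> makes every \<open>ht A a\<close> affine on the whole line, so
  segments can be compared beyond their ends. By \<open>ntb\<close> and \<open>nbb\<close> a free
  end of a vertical counts as lying beyond all segments over that abscissa.\<close>

locale arrangement =
  fixes A :: "'a chart"
  assumes fin: "finite (seg A)"
    and finv: "finite (ver A)"
    and disj: "seg A \<inter> ver A = {}"
    and len: "a \<in> seg A \<Longrightarrow> lf A a < rt A a"
    and lin: "a \<in> seg A \<Longrightarrow> ht A a X = ht A a Y + sl A a * (X - Y)"
    and UU: "\<lbrakk>a \<in> seg A; b \<in> seg A; over A a X; over A b X; ht A a X = ht A b X\<rbrakk> \<Longrightarrow> a = b"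
    and UV: "\<lbrakk>a \<in> seg A; v \<in> ver A; over A a (xv A v); bt A v < ht A a (xv A v);
              ht A a (xv A v) < tp A v\<rbrakk> \<Longrightarrow> False"
    and rb: "\<lbrakk>a \<in> seg A; a \<in> rbl A\<rbrakk> \<Longrightarrow>
              (\<exists>b\<in>seg A. over A b (rt A a) \<and> ht A b (rt A a) = ht A a (rt A a)) \<or>
              (\<exists>v\<in>ver A. xv A v = rt A a \<and> bt A v < ht A a (rt A a) \<and> ht A a (rt A a) < tp A v)"
    and lb: "\<lbrakk>a \<in> seg A; a \<in> lbl A\<rbrakk> \<Longrightarrow>
              (\<exists>b\<in>seg A. over A b (lf A a) \<and> ht A b (lf A a) = ht A a (lf A a)) \<or>
              (\<exists>v\<in>ver A. xv A v = lf A a \<and> bt A v < ht A a (lf A a) \<and> ht A a (lf A a) < tp A v)"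
    and tb: "\<lbrakk>v \<in> ver A; v \<in> tbl A\<rbrakk> \<Longrightarrow> \<exists>a\<in>seg A. over A a (xv A v) \<and> ht A a (xv A v) = tp A v"
    and bb: "\<lbrakk>v \<in> ver A; v \<in> bbl A\<rbrakk> \<Longrightarrow> \<exists>a\<in>seg A. over A a (xv A v) \<and> ht A a (xv A v) = bt A v"
    and nrb: "\<lbrakk>a \<in> seg A; a \<notin> rbl A\<rbrakk> \<Longrightarrow> rt A a = wd A"
    and nlb: "\<lbrakk>a \<in> seg A; a \<notin> lbl A\<rbrakk> \<Longrightarrow> lf A a = - wd A"
    and rbw: "\<lbrakk>a \<in> seg A; a \<in> rbl A\<rbrakk> \<Longrightarrow> rt A a < wd A"
    and lbw: "\<lbrakk>a \<in> seg A; a \<in> lbl A\<rbrakk> \<Longrightarrow> - wd A < lf A a"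
    and vw: "v \<in> ver A \<Longrightarrow> - wd A < xv A v \<and> xv A v < wd A"
    and ntb: "\<lbrakk>v \<in> ver A; v \<notin> tbl A; a \<in> seg A; over A a (xv A v)\<rbrakk> \<Longrightarrow> ht A a (xv A v) < tp A v"
    and nbb: "\<lbrakk>v \<in> ver A; v \<notin> bbl A; a \<in> seg A; over A a (xv A v)\<rbrakk> \<Longrightarrow> bt A v < ht A a (xv A v)"

text \<open>A half-turn preserves orientation, so right-turning walks remain right-turning and each
  argument is needed for one direction of travel only. The reflection \<open>mir\<close> reverses
  orientation and serves left-turning walks.\<close>

definition rot :: "'a chart \<Rightarrow> 'a chart" where
  "rot A = \<lparr>seg = seg A, ver = ver A, lf = (\<lambda>a. - rt A a), rt = (\<lambda>a. - lf A a),
     ht = (\<lambda>a X. - ht A a (- X)), sl = sl A, xv = (\<lambda>v. - xv A v),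
     bt = (\<lambda>v. - tp A v), tp = (\<lambda>v. - bt A v),
     lbl = rbl A, rbl = lbl A, bbl = tbl A, tbl = bbl A, wd = wd A\<rparr>"

definition mir :: "'a chart \<Rightarrow> 'a chart" where
  "mir A = \<lparr>seg = seg A, ver = ver A, lf = (\<lambda>a. - rt A a), rt = (\<lambda>a. - lf A a),
     ht = (\<lambda>a X. ht A a (- X)), sl = (\<lambda>a. - sl A a), xv = (\<lambda>v. - xv A v),
     bt = bt A, tp = tp A,
     lbl = rbl A, rbl = lbl A, bbl = bbl A, tbl = tbl A, wd = wd A\<rparr>"

lemma rot_sel [simp]:
  "seg (rot A) = seg A" "ver (rot A) = ver A" "lf (rot A) a = - rt A a" "rt (rot A) a = - lf A a"
  "ht (rot A) a X = - ht A a (- X)" "sl (rot A) = sl A" "xv (rot A) v = - xv A v"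
  "bt (rot A) v = - tp A v" "tp (rot A) v = - bt A v" "lbl (rot A) = rbl A" "rbl (rot A) = lbl A"
  "bbl (rot A) = tbl A" "tbl (rot A) = bbl A" "wd (rot A) = wd A"
  by (simp_all add: rot_def)

lemma mir_sel [simp]:
  "seg (mir A) = seg A" "ver (mir A) = ver A" "lf (mir A) a = - rt A a" "rt (mir A) a = - lf A a"
  "ht (mir A) a X = ht A a (- X)" "sl (mir A) a = - sl A a" "xv (mir A) v = - xv A v"
  "bt (mir A) = bt A" "tp (mir A) = tp A" "lbl (mir A) = rbl A" "rbl (mir A) = lbl A"
  "bbl (mir A) = bbl A" "tbl (mir A) = tbl A" "wd (mir A) = wd A"
  by (simp_all add: mir_def)

lemma over_rot [simp]: "over (rot A) a X = over A a (- X)"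
  and over_mir [simp]: "over (mir A) a X = over A a (- X)"
  by (auto simp: over_def)

lemma rot_rot [simp]: "rot (rot A) = A" and mir_mir [simp]: "mir (mir A) = A"
  by (simp_all add: rot_def mir_def)

lemma (in arrangement) arrangement_rot: "arrangement (rot A)"
proof (unfold_locales, goal_cases)
  case (5 a X Y)
  then show ?case using lin[of a "-X" "-Y"] by (simp add: algebra_simps)
next
  case (6 a b X)
  then show ?case using UU[of a b "-X"] by simp
next
  case (7 a v)
  then show ?case using UV[of a v] by simp
next
  case (8 a)
  then show ?case using lb[of a] by fastforce
next
  case (9 a)
  then show ?case using rb[of a] by fastforce
next
  case (10 v)
  then show ?case using bb[of v] by auto
next
  case (11 v)
  then show ?case using tb[of v] by auto
next
  case (16 v)
  then show ?case using vw[of v] by auto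
next
  case (17 v a)
  then show ?case using nbb[of v a] by auto
next
  case (18 v a)
  then show ?case using ntb[of v a] by auto
next
  case (4 a)
  then show ?case using len[of a] by simp
next
  case (12 a)
  then show ?case using nlb[of a] by simp
next
  case (13 a)
  then show ?case using nrb[of a] by simp
next
  case (14 a)
  then show ?case using lbw[of a] by simp
next
  case (15 a)
  then show ?case using rbw[of a] by simp
qed (use fin finv disj in simp_all)

lemma (in arrangement) arrangement_mir: "arrangement (mir A)"
proof (unfold_locales, goal_cases)
  case (5 a X Y)
  then show ?case using lin[of a "-X" "-Y"] by (simp add: algebra_simps)
next
  case (6 a b X)
  then show ?case using UU[of a b "-X"] by simp
next
  case (7 a v)
  then show ?case using UV[of a v] by simp
next
  case (8 a)
  then show ?case using lb[of a] by fastforce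
next
  case (9 a)
  then show ?case using rb[of a] by fastforce
next
  case (10 v)
  then show ?case using tb[of v] by auto
next
  case (11 v)
  then show ?case using bb[of v] by auto
next
  case (16 v)
  then show ?case using vw[of v] by auto
next
  case (17 v a)
  then show ?case using ntb[of v a] by auto
next
  case (18 v a)
  then show ?case using nbb[of v a] by auto
next
  case (4 a)
  then show ?case using len[of a] by simp
next
  case (12 a)
  then show ?case using nlb[of a] by simp
next
  case (13 a)
  then show ?case using nrb[of a] by simp
next
  case (14 a)
  then show ?case using lbw[of a] by simp
next
  case (15 a)
  then show ?case using rbw[of a] by simp
qed (use fin finv disj in simp_all)

section \<open>Right-turning walks\<close>

datatype dir = Lt | Rt | Up | Dn

primrec opp :: "dir \<Rightarrow> dir" where
  "opp Lt = Rt" | "opp Rt = Lt" | "opp Up = Dn" | "opp Dn = Up"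

text \<open>A walker on \<open>a\<close>, heading for the end named by the direction, turns right at that end
  into the blocking segment.\<close>
inductive rstep :: "'a chart \<Rightarrow> 'a \<times> dir \<Rightarrow> 'a \<times> dir \<Rightarrow> bool" for A where
  RR: "\<lbrakk>a \<in> seg A; a \<in> rbl A; b \<in> seg A; over A b (rt A a); ht A b (rt A a) = ht A a (rt A a);
        sl A b < sl A a\<rbrakk> \<Longrightarrow> rstep A (a, Rt) (b, Rt)"
| RL: "\<lbrakk>a \<in> seg A; a \<in> rbl A; b \<in> seg A; over A b (rt A a); ht A b (rt A a) = ht A a (rt A a);
        sl A a < sl A b\<rbrakk> \<Longrightarrow> rstep A (a, Rt) (b, Lt)"
| RD: "\<lbrakk>a \<in> seg A; a \<in> rbl A; v \<in> ver A; xv A v = rt A a; bt A v < ht A a (rt A a);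
        ht A a (rt A a) < tp A v\<rbrakk> \<Longrightarrow> rstep A (a, Rt) (v, Dn)"
| LL: "\<lbrakk>a \<in> seg A; a \<in> lbl A; b \<in> seg A; over A b (lf A a); ht A b (lf A a) = ht A a (lf A a);
        sl A b < sl A a\<rbrakk> \<Longrightarrow> rstep A (a, Lt) (b, Lt)"
| LR: "\<lbrakk>a \<in> seg A; a \<in> lbl A; b \<in> seg A; over A b (lf A a); ht A b (lf A a) = ht A a (lf A a);
        sl A a < sl A b\<rbrakk> \<Longrightarrow> rstep A (a, Lt) (b, Rt)"
| LU: "\<lbrakk>a \<in> seg A; a \<in> lbl A; v \<in> ver A; xv A v = lf A a; bt A v < ht A a (lf A a);
        ht A a (lf A a) < tp A v\<rbrakk> \<Longrightarrow> rstep A (a, Lt) (v, Up)"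
| UR: "\<lbrakk>v \<in> ver A; v \<in> tbl A; b \<in> seg A; over A b (xv A v); ht A b (xv A v) = tp A v\<rbrakk>
        \<Longrightarrow> rstep A (v, Up) (b, Rt)"
| DL: "\<lbrakk>v \<in> ver A; v \<in> bbl A; b \<in> seg A; over A b (xv A v); ht A b (xv A v) = bt A v\<rbrakk>
        \<Longrightarrow> rstep A (v, Dn) (b, Lt)"

text \<open>A set closed under successors is easier to exhibit than a cycle; a periodic orbit is
  extracted later. Injectivity on arcs makes that orbit a list of distinct arcs, as
  \<open>is_swirl\<close> demands.\<close>

definition closed_walk :: "'a chart \<Rightarrow> ('a \<times> dir) set \<Rightarrow> bool" where
  "closed_walk A S \<longleftrightarrow> S \<noteq> {} \<and> inj_on fst S \<and> (\<forall>s\<in>S. \<exists>t\<in>S. rstep A s t)"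

lemma rstep_rot: "rstep (rot A) s t \<Longrightarrow> rstep A (apsnd opp s) (apsnd opp t)"
  by (induction rule: rstep.induct) (auto intro: rstep.intros)

lemma closed_walk_rot:
  assumes "closed_walk (rot A) S" shows "closed_walk A (apsnd opp ` S)"
proof -
  note cw = assms[unfolded closed_walk_def]
  note S = cw[THEN conjunct1] cw[THEN conjunct2, THEN conjunct1]
    cw[THEN conjunct2, THEN conjunct2, THEN bspec]
  have "inj_on (fst \<circ> apsnd opp) S" using S(2) by (simp add: comp_def)
  then have "inj_on fst (apsnd opp ` S)" by (rule inj_on_imageI)
  moreover have "\<exists>t\<in>apsnd opp ` S. rstep A s t" if "s \<in> apsnd opp ` S" for s
  proof -
    from that obtain s' where s': "s' \<in> S" "s = apsnd opp s'" by (rule imageE)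
    from S(3)[OF s'(1)] obtain t where "t \<in> S" "rstep (rot A) s' t" by (rule bexE)
    then show ?thesis unfolding s'(2) by (intro bexI[of _ "apsnd opp t"] rstep_rot imageI)
  qed
  moreover have "apsnd opp ` S \<noteq> {}" using S(1) by simp
  ultimately show ?thesis unfolding closed_walk_def by (intro conjI ballI)
qed

section \<open>Ceilings and floors as barriers\<close>

text \<open>A ceiling \<open>g\<close> is made of right parts of segments and no segment passes from above to below
  it; a floor is a ceiling rotated by a half-turn. Both dichotomies below say that a segment cannot
  cross such a barrier.\<close>
definition wit :: "'a chart \<Rightarrow> (real \<Rightarrow> real) \<Rightarrow> real \<Rightarrow> real \<Rightarrow> 'a \<Rightarrow> real \<Rightarrow> bool" where
  "wit A g x0 x1 d X \<longleftrightarrow> d \<in> seg A \<and> over A d X \<and> rt A d \<le> x1 \<and>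
     (\<forall>Y\<in>{X..rt A d}. g Y = ht A d Y) \<and>
     (\<forall>Y\<in>{x0..x1}. over A d Y \<longrightarrow> g Y \<le> ht A d Y)"

text \<open>The interval is half-open since the last piece ends at \<open>x1\<close>, where no
  segment of the ceiling passes on.\<close>

definition rceil :: "'a chart \<Rightarrow> (real \<Rightarrow> real) \<Rightarrow> real \<Rightarrow> real \<Rightarrow> bool" where
  "rceil A g x0 x1 \<longleftrightarrow> x0 < x1 \<and> continuous_on {x0..x1} g \<and>
     (\<forall>X\<in>{x0..<x1}. \<exists>d. wit A g x0 x1 d X)"

definition lwit :: "'a chart \<Rightarrow> (real \<Rightarrow> real) \<Rightarrow> real \<Rightarrow> real \<Rightarrow> 'a \<Rightarrow> real \<Rightarrow> bool" where
  "lwit A h x0 x1 d X \<longleftrightarrow> d \<in> seg A \<and> over A d X \<and> x0 \<le> lf A d \<and>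
     (\<forall>Y\<in>{lf A d..X}. h Y = ht A d Y) \<and>
     (\<forall>Y\<in>{x0..x1}. over A d Y \<longrightarrow> ht A d Y \<le> h Y)"

definition lfloor :: "'a chart \<Rightarrow> (real \<Rightarrow> real) \<Rightarrow> real \<Rightarrow> real \<Rightarrow> bool" where
  "lfloor A h x0 x1 \<longleftrightarrow> x0 < x1 \<and> continuous_on {x0..x1} h \<and>
     (\<forall>X\<in>{x0<..x1}. \<exists>d. lwit A h x0 x1 d X)"

lemma continuous_on_uminus_arg:
  fixes g :: "real \<Rightarrow> real"
  assumes "continuous_on {a..b} g" shows "continuous_on {-b..-a} (\<lambda>X. g (- X))"
  by (rule continuous_on_compose2[OF assms]) (auto intro: continuous_intros)

lemma wit_rot: "wit (rot A) g x0 x1 d X \<longleftrightarrow> lwit A (\<lambda>X. - g (- X)) (- x1) (- x0) d (- X)"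
proof -
  have 1: "(\<forall>Y\<in>{X..- lf A d}. g Y = - ht A d (- Y)) \<longleftrightarrow> (\<forall>Y\<in>{lf A d..- X}. - g (- Y) = ht A d Y)"
    by (auto; drule_tac x="-Y" in bspec; force)
  have 2: "(\<forall>Y\<in>{x0..x1}. over A d (-Y) \<longrightarrow> g Y \<le> - ht A d (-Y)) \<longleftrightarrow>
           (\<forall>Y\<in>{-x1..-x0}. over A d Y \<longrightarrow> ht A d Y \<le> - g (-Y))"
    by (auto; drule_tac x="-Y" in bspec; force)
  show ?thesis unfolding wit_def lwit_def by (simp add: 1 2) auto
qed

lemma rceil_rot: "rceil (rot A) g x0 x1 \<Longrightarrow> lfloor A (\<lambda>X. - g (- X)) (- x1) (- x0)"
  unfolding rceil_def lfloor_def
  by (auto simp: wit_rot intro!: continuous_intros continuous_on_uminus_arg)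
     (drule_tac x="-X" in bspec; force)

lemma lfloor_rot: "rceil A g x0 x1 \<Longrightarrow> lfloor (rot A) (\<lambda>X. - g (- X)) (- x1) (- x0)"
  using rceil_rot[of "rot A" g x0 x1] by simp

lemma zero_between:
  fixes f :: "real \<Rightarrow> real"
  assumes "continuous_on {min a b..max a b} f" "f a < 0" "0 \<le> f b"
  shows "\<exists>z. min a b \<le> z \<and> z \<le> max a b \<and> f z = 0"
proof (cases "a \<le> b")
  case True then show ?thesis using IVT'[of f a 0 b] assms by auto
next
  case False then show ?thesis using IVT2'[of f a 0 b] assms by auto
qed

context arrangement begin

lemma cont_ht: "a \<in> seg A \<Longrightarrow> continuous_on T (ht A a)"
proof -
  assume a: "a \<in> seg A"
  have "ht A a X = (ht A a 0 - sl A a * 0) + sl A a * X" for X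
    using lin[OF a, of X 0] by (simp add: algebra_simps)
  then obtain K m where "ht A a = (\<lambda>X. K + m * X)" by blast
  then show ?thesis by (simp add: continuous_intros)
qed

lemma parallel_eq:
  assumes "a \<in> seg A" "b \<in> seg A" "sl A a = sl A b" "ht A a X = ht A b X"
  shows "ht A a Y = ht A b Y"
  using lin[OF assms(1), of Y X] lin[OF assms(2), of Y X] assms by simp

text \<open>Where \<open>d\<close> met the ceiling, disjointness would identify it with the witness
  at that place, and a witness is nowhere below the ceiling.\<close>

lemma below_dichotomy:
  assumes g: "rceil A g x0 x1" and d: "d \<in> seg A" "over A d Y" "over A d Z"
    and "Y \<in> {x0..<x1}" "Z \<in> {x0..<x1}" "ht A d Y < g Y"
  shows "ht A d Z < g Z"
proof (rule ccontr)
  assume neg: "\<not> ?thesis"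
  have "continuous_on {min Y Z..max Y Z} (\<lambda>X. ht A d X - g X)"
    using g assms by (intro continuous_intros cont_ht) (auto simp: rceil_def elim!: continuous_on_subset)
  then obtain W where W: "min Y Z \<le> W" "W \<le> max Y Z" "ht A d W = g W"
    using zero_between[of Y Z "\<lambda>X. ht A d X - g X"] assms neg by fastforce
  moreover have "W \<in> {x0..<x1}" using W assms by auto
  ultimately obtain e where e: "wit A g x0 x1 e W" using g unfolding rceil_def by blast
  have "over A d W" using d W unfolding over_def by auto
  moreover have "ht A e W = g W" using e W unfolding wit_def over_def by auto
  ultimately have "e = d" using UU[of e d W] e W d unfolding wit_def by auto
  then show False using e assms unfolding wit_def by fastforce
qed

lemma above_dichotomy:
  assumes h: "lfloor A h x0 x1" and d: "d \<in> seg A" "over A d Y" "over A d Z"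
    and "Y \<in> {x0<..x1}" "Z \<in> {x0<..x1}" "h Y < ht A d Y"
  shows "h Z < ht A d Z"
proof -
  interpret R: arrangement "rot A" by (rule arrangement_rot)
  have "rceil (rot A) (\<lambda>X. - h (- X)) (- x1) (- x0)"
    unfolding rceil_def
  proof (intro conjI ballI)
    show "- x1 < - x0" using h by (simp add: lfloor_def)
    show "continuous_on {- x1..- x0} (\<lambda>X. - h (- X))"
      using h by (auto simp: lfloor_def intro!: continuous_intros continuous_on_uminus_arg)
    fix X assume "X \<in> {- x1..<- x0}"
    then have "-X \<in> {x0<..x1}" by auto
    then show "\<exists>d. wit (rot A) (\<lambda>X. - h (- X)) (- x1) (- x0) d X"
      using h by (auto simp: lfloor_def wit_rot)
  qed
  from R.below_dichotomy[OF this, of d "-Y" "-Z"] show ?thesis using assms by auto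
qed

text \<open>The walk that starts on \<open>c\<close> at abscissa \<open>x0\<close>, moves right and always passes to the arc
  that bends to the right; it is followed until it can no longer move right.\<close>
lemma right_chain:
  assumes c: "c \<in> seg A" "over A c x0" "I c x0"
    and step: "\<And>d b X. \<lbrakk>d \<in> seg A; I d X; over A d X; x0 \<le> X; b \<in> seg A; over A b (rt A d);
       ht A b (rt A d) = ht A d (rt A d); sl A b < sl A d\<rbrakk> \<Longrightarrow> I b (rt A d)"
  obtains g x1 a X where "rceil A g x0 x1" "g x0 = ht A c x0"
    "\<And>Y. Y \<in> {x0..<x1} \<Longrightarrow> \<exists>d Z. wit A g x0 x1 d Y \<and> I d Z \<and> over A d Z \<and> x0 \<le> Z \<and> Z \<le> Y"
    "wit A g x0 x1 a X" "x0 \<le> X" "I a X" "rt A a = x1" "sl A a \<le> sl A c"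
    "\<And>b. \<lbrakk>b \<in> seg A; over A b x1; ht A b x1 = ht A a x1\<rbrakk> \<Longrightarrow> sl A a \<le> sl A b"
proof -
  define P where "P x1 \<longleftrightarrow> (\<exists>g a X. rceil A g x0 x1 \<and> g x0 = ht A c x0 \<and>
    (\<forall>Y\<in>{x0..<x1}. \<exists>d Z. wit A g x0 x1 d Y \<and> I d Z \<and> over A d Z \<and> x0 \<le> Z \<and> Z \<le> Y) \<and>
    wit A g x0 x1 a X \<and> x0 \<le> X \<and> I a X \<and> rt A a = x1 \<and> sl A a \<le> sl A c)" for x1
  have "wit A (ht A c) x0 (rt A c) c Y" if "Y \<in> {x0..<rt A c}" for Y
    using c that unfolding wit_def over_def by auto
  then have w: "\<exists>d Z. wit A (ht A c) x0 (rt A c) d Y \<and> I d Z \<and> over A d Z \<and> x0 \<le> Z \<and> Z \<le> Y"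
    if "Y \<in> {x0..<rt A c}" for Y
    using c that by (intro exI[of _ c] exI[of _ x0]) auto
  have "rceil A (ht A c) x0 (rt A c)"
    unfolding rceil_def using w c by (auto simp: over_def intro!: cont_ht) blast
  then have "P (rt A c)"
    unfolding P_def using c w \<open>\<And>Y. Y \<in> {x0..<rt A c} \<Longrightarrow> wit A (ht A c) x0 (rt A c) c Y\<close>[of x0]
    by (intro exI[of _ "ht A c"] exI[of _ c] exI[of _ x0]) (auto simp: over_def)
  \<comment> \<open>A ceiling of this kind stops at the right end of a segment, so only finitely
    many extents occur and a longest one exists. There the walk cannot be continued to the
    right.\<close>
  moreover have "{x. P x} \<subseteq> rt A ` seg A" by (auto simp: P_def wit_def)
  then have finP: "finite {x. P x}" using fin finite_subset by blast
  ultimately have "P (Max {x. P x})" using Max_in[OF finP] by auto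
  define x1 where "x1 = Max {x. P x}"
  have "P x1" using \<open>P (Max _)\<close> x1_def by simp
  then obtain g a X where g: "rceil A g x0 x1" "g x0 = ht A c x0" and
    gI: "\<forall>Y\<in>{x0..<x1}. \<exists>d Z. wit A g x0 x1 d Y \<and> I d Z \<and> over A d Z \<and> x0 \<le> Z \<and> Z \<le> Y" and
    a: "wit A g x0 x1 a X" "x0 \<le> X" "I a X" "rt A a = x1" "sl A a \<le> sl A c"
    unfolding P_def by blast
  have a': "a \<in> seg A" "over A a X" "\<And>Y. Y \<in> {X..x1} \<Longrightarrow> g Y = ht A a Y"
    using a unfolding wit_def by auto
  have Xx1: "X < x1" using a' a over_def by metis
  have x01: "x0 < x1" using Xx1 a by simp
  have max: "sl A a \<le> sl A b" if b: "b \<in> seg A" "over A b x1" "ht A b x1 = ht A a x1" for b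
  proof (rule ccontr)
    assume "\<not> sl A a \<le> sl A b"
    then have slb: "sl A b < sl A a" by simp
    \<comment> \<open>Just left of the junction, \<open>b\<close> has smaller slope and is therefore
      above \<open>a\<close>, hence above the ceiling; \<open>below_dichotomy\<close> spreads this
      to all of \<open>b\<close>.\<close>
    define Z where "Z = (max X (lf A b) + x1) / 2"
    have Z: "X \<le> Z" "lf A b < Z" "Z < x1" "over A b Z"
      using b Xx1 unfolding Z_def over_def by (auto simp: max_def)
    have "ht A b Z > ht A a Z"
      using lin[OF b(1), of Z x1] lin[OF a'(1), of Z x1] b slb Z
      by (smt (verit) mult_strict_right_mono_neg)
    then have Zg: "g Z < ht A b Z" using a' Z by auto
    have bg: "g Y \<le> ht A b Y" if "Y \<in> {x0..<x1}" "over A b Y" for Y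
      using below_dichotomy[OF g(1) b(1) that(2) Z(4) that(1)] Zg Z a by fastforce
    define g' where "g' Y = (if Y \<le> x1 then g Y else ht A b Y)" for Y
    have x1b: "x1 < rt A b" using b by (simp add: over_def)
    have gx1: "g x1 = ht A b x1" using a'(3)[of x1] Xx1 b by simp
    have w_old: "wit A g' x0 (rt A b) d Y" if w: "wit A g x0 x1 d Y" for d Y
      using w x1b unfolding wit_def g'_def over_def by auto
    have w_new: "wit A g' x0 (rt A b) b Y" if "Y \<in> {x1..<rt A b}" for Y
      unfolding wit_def
    proof (intro conjI ballI impI)
      show "b \<in> seg A" "over A b Y" using b that by (auto simp: over_def)
      show "rt A b \<le> rt A b" by simp
      fix Y'
      { assume "Y' \<in> {Y..rt A b}" then show "g' Y' = ht A b Y'"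
          using that gx1 unfolding g'_def by (cases "Y' = x1") auto }
      { assume "Y' \<in> {x0..rt A b}" "over A b Y'" then show "g' Y' \<le> ht A b Y'"
          using bg[of Y'] gx1 unfolding g'_def by (cases "Y' = x1") auto }
    qed
    have "continuous_on ({x0..x1} \<union> {x1..rt A b}) g'"
      unfolding g'_def using g gx1 x1b
      by (intro continuous_on_If) (auto simp: rceil_def intro!: cont_ht b elim!: continuous_on_subset)
    moreover have "{x0..x1} \<union> {x1..rt A b} = {x0..rt A b}" using x01 x1b by auto
    ultimately have cont: "continuous_on {x0..rt A b} g'" by simp
    have Ib: "I b x1" using step[OF a'(1) a(3) a'(2) a(2) b(1)] a(4) b slb by simp
    have all: "\<exists>d Z. wit A g' x0 (rt A b) d Y \<and> I d Z \<and> over A d Z \<and> x0 \<le> Z \<and> Z \<le> Y"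
      if "Y \<in> {x0..<rt A b}" for Y
    proof (cases "Y < x1")
      case True then show ?thesis using gI w_old that by fastforce
    next
      case False then show ?thesis using w_new[of Y] Ib b x01 that by (intro exI[of _ b] exI[of _ x1]) auto
    qed
    then have "rceil A g' x0 (rt A b)" using cont x01 x1b unfolding rceil_def by fastforce
    then have "P (rt A b)" unfolding P_def
      using all w_new[of x1] x1b Ib x01 g slb a by (intro exI[of _ g'] exI[of _ b] exI[of _ x1]) (auto simp: g'_def)
    then have "rt A b \<le> x1" using Max_ge[OF finP] x1_def by auto
    then show False using x1b by simp
  qed
  show thesis using that[OF g _ a max] gI by blast
qed

end

section \<open>Rooms\<close>

definition knots :: "'a chart \<Rightarrow> real set" where
  "knots A = lf A ` seg A \<union> rt A ` seg A \<union> xv A ` ver A"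

text \<open>A room is a region between a floor \<open>h\<close> and an upper bound \<open>p\<close> that cannot be left to the right;
  \<open>c\<close> is the segment on which a walk enters it at its left corner. Following the walk yields a
  ceiling, and after a half-turn either a room on fewer knots or a closed walk.\<close>
definition room :: "'a chart \<Rightarrow> (real \<Rightarrow> real) \<Rightarrow> (real \<Rightarrow> real) \<Rightarrow> real \<Rightarrow> real \<Rightarrow> 'a \<Rightarrow> bool" where
  "room A p h x0 x1 c \<longleftrightarrow>
     lfloor A h x0 x1 \<and> - wd A < x0 \<and> x1 < wd A \<and> x0 \<in> knots A \<and> x1 \<in> knots A \<and>
     (\<forall>d\<in>seg A. \<forall>X\<in>{x0..<x1}. over A d X \<and> ht A d X \<le> p X \<longrightarrow>
        (\<forall>Y\<in>{X..x1}. Y \<le> rt A d \<longrightarrow> ht A d Y \<le> p Y)) \<and>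
     (h x1 = p x1 \<or> (\<exists>v\<in>ver A. v \<in> bbl A \<and> xv A v = x1 \<and> bt A v = h x1 \<and> h x1 < p x1 \<and> p x1 < tp A v)) \<and>
     c \<in> seg A \<and> over A c x0 \<and> ht A c x0 \<le> p x0 \<and>
     (\<exists>e>x0. \<forall>X\<in>{x0<..<e}. h X < ht A c X) \<and>
     (h x0 = ht A c x0 \<or>
      (\<exists>v\<in>ver A. v \<in> tbl A \<and> xv A v = x0 \<and> bt A v < h x0 \<and> h x0 < tp A v \<and> tp A v = ht A c x0))"

context arrangement begin

lemma steeper:
  assumes "a \<in> seg A" "b \<in> seg A" "ht A a X = ht A b X"
  shows "Y < X \<Longrightarrow> ht A a Y < ht A b Y \<longleftrightarrow> sl A b < sl A a"
    "X < Y \<Longrightarrow> ht A a Y < ht A b Y \<longleftrightarrow> sl A a < sl A b"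
proof -
  have *: "ht A b Y - ht A a Y = (sl A b - sl A a) * (Y - X)" for Y
    using lin[OF assms(1), of Y X] lin[OF assms(2), of Y X] assms(3) by (simp add: algebra_simps)
  { assume "Y < X" with *[of Y] show "ht A a Y < ht A b Y \<longleftrightarrow> sl A b < sl A a"
      by (smt (verit) mult_neg_neg mult_nonneg_nonpos) }
  { assume "X < Y" with *[of Y] show "ht A a Y < ht A b Y \<longleftrightarrow> sl A a < sl A b"
      by (smt (verit) mult_pos_pos mult_nonpos_nonneg) }
qed

lemma eq_slope_overlap:
  assumes "a \<in> seg A" "b \<in> seg A" "ht A a X = ht A b X" "sl A a = sl A b" "over A a Y" "over A b Y"
  shows "a = b"
  using parallel_eq[OF assms(1,2,4,3), of Y] UU[of a b Y] assms by simp

text \<open>Describes the walk across a room, with \<open>a\<close> as its last segment; by the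
  final conjunct every blocker at \<open>x2\<close> would send it back to the left.\<close>

definition room_chain where
  "room_chain h x0 x1 g x2 a X \<longleftrightarrow> rceil A g x0 x2 \<and> x2 \<le> x1 \<and>
     (\<forall>Y\<in>{x0<..<x2}. h Y < g Y) \<and> wit A g x0 x2 a X \<and> x0 \<le> X \<and> X < x2 \<and> rt A a = x2 \<and>
     (\<forall>b\<in>seg A. over A b x2 \<longrightarrow> ht A b x2 = ht A a x2 \<longrightarrow> sl A a \<le> sl A b)"

text \<open>The walk is confined by an invariant: strictly above the floor (by
  \<open>above_dichotomy\<close>) and at most \<open>p\<close> (by the definition of a room). The
  wall at \<open>x1\<close> stops everything that satisfies it.\<close>

lemma room_new_chain:
  assumes R: "room A p h x0 x1 c"
  obtains g x2 a X where "room_chain h x0 x1 g x2 a X" "g x0 = ht A c x0" "g x2 \<le> p x2"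
proof -
  have h: "lfloor A h x0 x1" and x01: "x0 < x1" and w: "- wd A < x0" "x1 < wd A"
    and p: "\<And>d X Y. \<lbrakk>d \<in> seg A; X \<in> {x0..<x1}; over A d X; ht A d X \<le> p X; Y \<in> {X..x1}; Y \<le> rt A d\<rbrakk>
             \<Longrightarrow> ht A d Y \<le> p Y"
    and c: "c \<in> seg A" "over A c x0" "ht A c x0 \<le> p x0" "\<exists>e>x0. \<forall>X\<in>{x0<..<e}. h X < ht A c X"
    and wall: "h x1 = p x1 \<or> (\<exists>v\<in>ver A. v \<in> bbl A \<and> xv A v = x1 \<and> bt A v = h x1 \<and> h x1 < p x1 \<and> p x1 < tp A v)"
    using R unfolding room_def by (auto simp: lfloor_def)
  \<comment> \<open>At \<open>x1\<close> such a height lies in an empty interval or in the interior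
    of the vertical wall.\<close>
  have noblock: False if "d \<in> seg A" "over A d x1" "h x1 < ht A d x1" "ht A d x1 \<le> p x1" for d
    using wall that UV[of d] by force
  define I where "I d X \<longleftrightarrow> X \<in> {x0..<x1} \<and> over A d X \<and> ht A d X \<le> p X \<and>
    (\<forall>Y\<in>{x0<..x1}. over A d Y \<longrightarrow> h Y < ht A d Y)" for d X
  have all_above: "\<forall>Y\<in>{x0<..x1}. over A d Y \<longrightarrow> h Y < ht A d Y"
    if "d \<in> seg A" "over A d X" "X \<in> {x0<..x1}" "h X < ht A d X" for d X
    using that above_dichotomy[OF h that(1)] by blast
  obtain e where e: "e > x0" "\<forall>X\<in>{x0<..<e}. h X < ht A c X" using c by blast
  \<comment> \<open>An abscissa where \<open>c\<close> is already strictly above the floor; at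
    \<open>x0\<close> itself the two may meet.\<close>
  define m where "m = (x0 + min e (min x1 (rt A c))) / 2"
  have m: "m \<in> {x0<..x1}" "m < e" "over A c m"
    using e x01 c unfolding m_def over_def by (auto simp: min_def)
  have Ic: "I c x0" using c all_above[OF c(1) m(3) m(1)] e m x01 unfolding I_def by auto
  have seal: "rt A d \<le> x1" if d: "d \<in> seg A" "I d X" for d X
  proof (rule ccontr)
    assume neg: "\<not> ?thesis"
    then have "over A d x1" using d by (auto simp: I_def over_def)
    moreover have "h x1 < ht A d x1" using d calculation x01 unfolding I_def by auto
    moreover have "ht A d x1 \<le> p x1" using p[OF d(1), of X x1] d neg unfolding I_def by auto
    ultimately show False using noblock d by blast
  qed
  have step: "I b (rt A d)"
    if d: "d \<in> seg A" "I d X" and b: "b \<in> seg A" "over A b (rt A d)" "ht A b (rt A d) = ht A d (rt A d)"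
      "sl A b < sl A d" for d b X
  proof -
    have X: "X \<in> {x0..<x1}" "over A d X" using d by (auto simp: I_def)
    define Z where "Z = (max X (lf A b) + rt A d) / 2"
    have Z: "X < Z" "lf A b < Z" "Z < rt A d" "over A b Z" "over A d Z" "Z \<in> {x0<..x1}"
      using b X seal[OF d] unfolding Z_def over_def by (auto simp: max_def)
    have "h Z < ht A d Z" using d Z unfolding I_def by auto
    also have "ht A d Z < ht A b Z"
      using steeper(1)[OF d(1) b(1) b(3)[symmetric] Z(3)] b(4) by simp
    finally have ab: "\<forall>Y\<in>{x0<..x1}. over A b Y \<longrightarrow> h Y < ht A b Y"
      using all_above[OF b(1) Z(4,6)] by blast
    have le: "ht A b (rt A d) \<le> p (rt A d)"
      using p[OF d(1), of X "rt A d"] d X seal[OF d] b unfolding I_def over_def by auto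
    have "rt A d \<noteq> x1" using ab noblock[OF b(1)] b le x01 by fastforce
    then show ?thesis using ab le b X seal[OF d] unfolding I_def over_def by auto
  qed
  obtain g x2 a X where g: "rceil A g x0 x2" "g x0 = ht A c x0"
    "\<And>Y. Y \<in> {x0..<x2} \<Longrightarrow> \<exists>d Z. wit A g x0 x2 d Y \<and> I d Z \<and> over A d Z \<and> x0 \<le> Z \<and> Z \<le> Y"
    "wit A g x0 x2 a X" "x0 \<le> X" "I a X" "rt A a = x2"
    "\<And>b. \<lbrakk>b \<in> seg A; over A b x2; ht A b x2 = ht A a x2\<rbrakk> \<Longrightarrow> sl A a \<le> sl A b"
    by (rule right_chain[of c x0 I, OF c(1,2) Ic step]) blast+
  have a: "a \<in> seg A" "over A a X" using g by (auto simp: wit_def)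
  have x2: "x2 \<le> x1" using seal[OF a(1) g(6)] g by simp
  have "h Y < g Y" if Y: "Y \<in> {x0<..<x2}" for Y
  proof -
    obtain d Z where d: "wit A g x0 x2 d Y" "I d Z" using g(3)[of Y] Y by auto
    then have "g Y = ht A d Y" "over A d Y" unfolding wit_def over_def by auto
    then show ?thesis using d Y x2 unfolding I_def by auto
  qed
  moreover have "X < x2" using a g by (auto simp: over_def)
  moreover have "g x2 \<le> p x2"
  proof -
    have "g x2 = ht A a x2" using g a by (auto simp: wit_def over_def)
    then show ?thesis using p[OF a(1), of X x2] g x2 a unfolding I_def over_def by auto
  qed
  ultimately show thesis using that[of g x2 a X] g x2 unfolding room_chain_def by blast
qed


lemma pos_near:
  fixes f :: "real \<Rightarrow> real"
  assumes "continuous_on UNIV f" "0 < f x"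
  shows "\<exists>e>0. \<forall>y. \<bar>y - x\<bar> < e \<longrightarrow> 0 < f y"
proof -
  obtain e where e: "e > 0" "\<forall>y. dist y x < e \<longrightarrow> dist (f y) (f x) < f x"
    using assms unfolding continuous_on_iff by (metis UNIV_I)
  then show ?thesis by (intro exI[of _ e]) (fastforce simp: dist_real_def)
qed

text \<open>The strict inequality before \<open>x2\<close> passes to the limit by
  continuity.\<close>

lemma room_chain_end:
  assumes h: "lfloor A h x0 x1" and C: "room_chain h x0 x1 g x2 a X"
  shows "h x2 \<le> g x2" "g x2 = ht A a x2" "a \<in> seg A"
proof -
  have a: "a \<in> seg A" "g x2 = ht A a x2" "rceil A g x0 x2" "x2 \<le> x1" "\<And>Y. x0 < Y \<Longrightarrow> Y < x2 \<Longrightarrow> h Y < g Y"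
    and x02: "x0 < x2"
    using C unfolding room_chain_def wit_def over_def rceil_def by auto
  then show "g x2 = ht A a x2" "a \<in> seg A" by auto
  show "h x2 \<le> g x2"
  proof (rule ccontr)
    assume neg: "\<not> ?thesis"
    define m where "m = (x0 + x2) / 2"
    have m: "x0 < m" "m < x2" using x02 by (auto simp: m_def)
    have "continuous_on {min x2 m..max x2 m} (\<lambda>Y. g Y - h Y)"
      using h a m by (intro continuous_intros) (auto simp: lfloor_def rceil_def elim!: continuous_on_subset)
    then obtain W where W: "m \<le> W" "W \<le> x2" "g W = h W"
      using zero_between[of x2 m "\<lambda>Y. g Y - h Y"] neg a(5)[OF m] m by auto
    then show False using a(5)[of W] m neg by (cases "W = x2") auto
  qed
qed

text \<open>When no continuation to the right is left, the blocker is a segment of larger slope,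
  which runs back below the ceiling, or a vertical. The vertical is followed down to the segment
  blocking it, unless its lower end is free.\<close>

lemma turn:
  assumes g: "rceil A g x0 x2" and a: "wit A g x0 x2 a X" "rt A a = x2" "a \<in> rbl A"
    and amax: "\<forall>b\<in>seg A. over A b x2 \<longrightarrow> ht A b x2 = ht A a x2 \<longrightarrow> sl A a \<le> sl A b"
  shows "(\<exists>v\<in>ver A. v \<notin> bbl A \<and> xv A v = x2 \<and> bt A v < g x2 \<and> g x2 < tp A v) \<or>
    (\<exists>c'\<in>seg A. over A c' x2 \<and> (\<exists>e<x2. \<forall>Y\<in>{e<..<x2}. ht A c' Y < g Y) \<and>
     (g x2 = ht A c' x2 \<or> (\<exists>v\<in>ver A. v \<in> bbl A \<and> xv A v = x2 \<and> g x2 < tp A v \<and> bt A v < g x2 \<and> bt A v = ht A c' x2)))"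
proof -
  have X: "X < x2" "a \<in> seg A" "over A a X"
    and ga: "\<And>Y. X \<le> Y \<Longrightarrow> Y \<le> x2 \<Longrightarrow> g Y = ht A a Y"
    using a unfolding wit_def over_def by auto
  have gx2: "g x2 = ht A a x2" using ga X by simp
  show ?thesis
    using rb[OF X(2) a(3)]
  proof
    assume "\<exists>b\<in>seg A. over A b (rt A a) \<and> ht A b (rt A a) = ht A a (rt A a)"
    then obtain b where b: "b \<in> seg A" "over A b x2" "ht A b x2 = ht A a x2" using a by auto
    define Z where "Z = (max X (lf A b) + x2) / 2"
    have Z: "over A a Z" "over A b Z"
      using a b X unfolding Z_def over_def by (auto simp: max_def)
    have "sl A a \<noteq> sl A b" using eq_slope_overlap[OF X(2) b(1) b(3)[symmetric] _ Z] a b X by (auto simp: over_def)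
    then have "sl A a < sl A b" using amax[rule_format, OF b] by simp
    then have "ht A b Y < g Y" if "Y \<in> {X<..<x2}" for Y
      using that steeper(1)[OF b(1) X(2) b(3), of Y] ga[of Y] by auto
    then have "over A b x2 \<and> (\<exists>e<x2. \<forall>Y\<in>{e<..<x2}. ht A b Y < g Y) \<and> g x2 = ht A b x2"
      using b gx2 X by auto
    then show ?thesis using b(1) by blast
  next
    assume "\<exists>v\<in>ver A. xv A v = rt A a \<and> bt A v < ht A a (rt A a) \<and> ht A a (rt A a) < tp A v"
    then obtain v where v: "v \<in> ver A" "xv A v = x2" "bt A v < g x2" "g x2 < tp A v" using a gx2 by auto
    show ?thesis
    proof (cases "v \<in> bbl A")
      case True
      then obtain c' where c': "c' \<in> seg A" "over A c' x2" "ht A c' x2 = bt A v" using bb[of v] v by auto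
      obtain d where d: "d > 0" "\<forall>Y. \<bar>Y - x2\<bar> < d \<longrightarrow> 0 < ht A a Y - ht A c' Y"
        using pos_near[of "\<lambda>Y. ht A a Y - ht A c' Y" x2] c' v gx2 X
        by (auto intro!: continuous_intros cont_ht)
      have "ht A c' Y < g Y" if "Y \<in> {max X (x2 - d)<..<x2}" for Y
        using that d(2)[rule_format, of Y] ga[of Y] by auto
      then have "\<exists>e<x2. \<forall>Y\<in>{e<..<x2}. ht A c' Y < g Y" using X d by (intro exI[of _ "max X (x2 - d)"]) auto
      moreover have "\<exists>v\<in>ver A. v \<in> bbl A \<and> xv A v = x2 \<and> g x2 < tp A v \<and> bt A v < g x2 \<and> bt A v = ht A c' x2"
        using c' v True by auto
      ultimately show ?thesis using c'(1,2) by blast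
    next
      case False then show ?thesis using v by blast
    qed
  qed
qed

text \<open>After a half-turn the ceiling is the new floor and the old floor the new bound. A
  vertical met at \<open>x2\<close> cannot cross the old floor, so its lower end is blocked and the
  walk continues inside the room.\<close>

lemma room_next:
  assumes R: "room A p h x0 x1 c" and C: "room_chain h x0 x1 g x2 a X" and gx0: "g x0 = ht A c x0"
    and x2: "x2 < x1"
  shows "\<exists>c'. room (rot A) (\<lambda>X. - h (- X)) (\<lambda>X. - g (- X)) (- x2) (- x0) c'"
proof -
  have h: "lfloor A h x0 x1" and w: "- wd A < x0" "x1 < wd A" and K: "x0 \<in> knots A"
    and left: "h x0 = ht A c x0 \<or>
      (\<exists>v\<in>ver A. v \<in> tbl A \<and> xv A v = x0 \<and> bt A v < h x0 \<and> h x0 < tp A v \<and> tp A v = ht A c x0)"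
    using R unfolding room_def by auto
  have g: "rceil A g x0 x2" and X: "x0 \<le> X" "X < x2" "rt A a = x2" "a \<in> seg A" "over A a X"
    and ga: "\<And>Y. X \<le> Y \<Longrightarrow> Y \<le> x2 \<Longrightarrow> g Y = ht A a Y"
    and amax: "\<forall>b\<in>seg A. over A b x2 \<longrightarrow> ht A b x2 = ht A a x2 \<longrightarrow> sl A a \<le> sl A b"
    using C unfolding room_chain_def wit_def by auto
  note e = room_chain_end[OF h C]
  obtain u where u: "lwit A h x0 x1 u x2" using h X x2 unfolding lfloor_def by fastforce
  then have u': "u \<in> seg A" "over A u x2" "h x2 = ht A u x2" unfolding lwit_def over_def by auto
  have arb: "a \<in> rbl A" using nrb[of a] X x2 w by auto
  have W: "wit A g x0 x2 a X" using C by (simp add: room_chain_def)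
  have vh: "h x2 \<le> bt A v" if v: "v \<in> ver A" "xv A v = x2" "bt A v < g x2" "g x2 < tp A v" for v
    using UV[of u v] u' v e by force
  have "\<not> (\<exists>v\<in>ver A. v \<notin> bbl A \<and> xv A v = x2 \<and> bt A v < g x2 \<and> g x2 < tp A v)"
  proof
    assume "\<exists>v\<in>ver A. v \<notin> bbl A \<and> xv A v = x2 \<and> bt A v < g x2 \<and> g x2 < tp A v"
    then obtain v where v: "v \<in> ver A" "v \<notin> bbl A" "xv A v = x2" "bt A v < g x2" "g x2 < tp A v" by blast
    then show False using vh[of v] nbb[of v u] u' by simp
  qed
  with turn[OF g W X(3) arb amax] obtain c' where c': "c' \<in> seg A" "over A c' x2" "\<exists>e<x2. \<forall>Y\<in>{e<..<x2}. ht A c' Y < g Y"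
     "g x2 = ht A c' x2 \<or> (\<exists>v\<in>ver A. v \<in> bbl A \<and> xv A v = x2 \<and> g x2 < tp A v \<and> bt A v < g x2 \<and> bt A v = ht A c' x2)"
    by blast
  have "h x2 \<le> ht A c' x2"
    using c'(4)
  proof (elim disjE bexE conjE)
    fix v assume "v \<in> ver A" "xv A v = x2" "g x2 < tp A v" "bt A v < g x2" "bt A v = ht A c' x2"
    then show ?thesis using vh[of v] by simp
  qed (use e(1) in simp)
  with c' have "\<exists>c'\<in>seg A. over A c' x2 \<and> h x2 \<le> ht A c' x2 \<and> (\<exists>e<x2. \<forall>Y\<in>{e<..<x2}. ht A c' Y < g Y) \<and>
     (g x2 = ht A c' x2 \<or> (\<exists>v\<in>ver A. v \<in> bbl A \<and> xv A v = x2 \<and> g x2 < tp A v \<and> bt A v < g x2 \<and> bt A v = ht A c' x2))"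
    by blast
  then obtain c' e' where c': "c' \<in> seg A" "over A c' x2" "h x2 \<le> ht A c' x2" "e' < x2" "\<forall>Y\<in>{e'<..<x2}. ht A c' Y < g Y"
     "g x2 = ht A c' x2 \<or> (\<exists>v\<in>ver A. v \<in> bbl A \<and> xv A v = x2 \<and> g x2 < tp A v \<and> bt A v < g x2 \<and> bt A v = ht A c' x2)"
    by blast
  \<comment> \<open>Rotated, this says that the new room cannot be left to the right. A segment
    touching the floor is a floor piece itself; one strictly above cannot come down to it.\<close>
  have stay: "h Y \<le> ht A d Y"
    if d: "d \<in> seg A" "Z \<in> {x0<..x2}" "over A d Z" "h Z \<le> ht A d Z" "Y \<in> {x0..Z}" "lf A d \<le> Y" for d Y Z
  proof (cases "h Z = ht A d Z")
    case True
    obtain u where u: "lwit A h x0 x1 u Z" using h d x2 unfolding lfloor_def by fastforce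
    then have "u = d" using UU[of u d Z] d True unfolding lwit_def over_def by auto
    then show ?thesis using u d unfolding lwit_def by auto
  next
    case False
    then have lt: "h Z < ht A d Z" using d by simp
    show ?thesis
    proof (rule ccontr)
      assume neg: "\<not> ?thesis"
      have "continuous_on {min Y Z..max Y Z} (\<lambda>Y. ht A d Y - h Y)"
        using h d x2 by (intro continuous_intros cont_ht) (auto simp: lfloor_def elim!: continuous_on_subset)
      then obtain W where W: "Y \<le> W" "W \<le> Z" "ht A d W = h W"
        using zero_between[of Y Z "\<lambda>Y. ht A d Y - h Y"] neg d by fastforce
      then have "Y < W" using neg by (cases "Y = W") auto
      then have "h W < ht A d W"
        using above_dichotomy[OF h d(1) d(3), of W] W d lt x2 unfolding over_def by auto
      then show False using W by simp
    qed
  qed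
  show ?thesis
    unfolding room_def
  proof (intro exI[of _ c'] conjI ballI impI)
    show "lfloor (rot A) (\<lambda>X. - g (- X)) (- x2) (- x0)" by (rule lfloor_rot[OF g])
    show "- wd (rot A) < - x2" "- x0 < wd (rot A)" using w x2 by auto
    show "- x2 \<in> knots (rot A)" "- x0 \<in> knots (rot A)" using K X unfolding knots_def by auto
    show "c' \<in> seg (rot A)" "over (rot A) c' (- x2)" "ht (rot A) c' (- x2) \<le> - h (- (- x2))" using c' by auto
    show "\<exists>e>- x2. \<forall>X\<in>{- x2<..<e}. - g (- X) < ht (rot A) c' X"
      using c' by (intro exI[of _ "- e'"]) auto
    show "- g (- (- x0)) = - h (- (- x0)) \<or> (\<exists>v\<in>ver (rot A). v \<in> bbl (rot A) \<and> xv (rot A) v = - x0 \<and>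
      bt (rot A) v = - g (- (- x0)) \<and> - g (- (- x0)) < - h (- (- x0)) \<and> - h (- (- x0)) < tp (rot A) v)"
      using left gx0 by auto
    show "- g (- (- x2)) = ht (rot A) c' (- x2) \<or> (\<exists>v\<in>ver (rot A). v \<in> tbl (rot A) \<and> xv (rot A) v = - x2 \<and>
      bt (rot A) v < - g (- (- x2)) \<and> - g (- (- x2)) < tp (rot A) v \<and> tp (rot A) v = ht (rot A) c' (- x2))"
      using c' by auto
    fix d Z Y
    assume "d \<in> seg (rot A)" "Z \<in> {- x2..<- x0}" "over (rot A) d Z \<and> ht (rot A) d Z \<le> - h (- Z)"
      "Y \<in> {Z..- x0}" "Y \<le> rt (rot A) d"
    then show "ht (rot A) d Y \<le> - h (- Y)" using stay[of d "-Z" "-Y"] by auto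
  qed
qed

text \<open>The ceiling walked to the right, the floor walked to the left and the vertical walls at
  the two corners, if any, are closed under right turns. No segment serves in both directions
  because the ceiling is strictly above the floor in between.\<close>

lemma room_close:
  assumes R: "room A p h x0 x1 c" and C: "room_chain h x0 x1 g x1 a X" and gx0: "g x0 = ht A c x0"
    and gp: "g x1 \<le> p x1"
  shows "\<exists>S. closed_walk A S"
proof -
  have h: "lfloor A h x0 x1" and w: "- wd A < x0" "x1 < wd A" and x01: "x0 < x1"
    and left: "h x0 = ht A c x0 \<or>
      (\<exists>v\<in>ver A. v \<in> tbl A \<and> xv A v = x0 \<and> bt A v < h x0 \<and> h x0 < tp A v \<and> tp A v = ht A c x0)"
    and right: "h x1 = p x1 \<or> (\<exists>v\<in>ver A. v \<in> bbl A \<and> xv A v = x1 \<and> bt A v = h x1 \<and> h x1 < p x1 \<and> p x1 < tp A v)"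
    using R unfolding room_def by (auto simp: lfloor_def)
  have g: "rceil A g x0 x1" and hg: "\<And>Y. x0 < Y \<Longrightarrow> Y < x1 \<Longrightarrow> h Y < g Y"
    using C unfolding room_chain_def by auto
  have hg1: "h x1 \<le> g x1" using room_chain_end[OF h C] by simp
  define S where "S = {(d, Rt) |d. \<exists>X\<in>{x0..<x1}. wit A g x0 x1 d X} \<union>
    {(d, Lt) |d. \<exists>X\<in>{x0<..x1}. lwit A h x0 x1 d X} \<union>
    {(v, Up) |v. v \<in> ver A \<and> v \<in> tbl A \<and> xv A v = x0 \<and> bt A v < h x0 \<and> h x0 < tp A v \<and> tp A v = g x0} \<union>
    {(v, Dn) |v. v \<in> ver A \<and> v \<in> bbl A \<and> xv A v = x1 \<and> bt A v = h x1 \<and> h x1 < p x1 \<and> p x1 < tp A v}"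
  have W: "\<exists>e. wit A g x0 x1 e Y \<and> e \<in> seg A \<and> over A e Y \<and> ht A e Y = g Y \<and> (e, Rt) \<in> S"
    if "x0 \<le> Y" "Y < x1" for Y
    using g that unfolding rceil_def S_def wit_def over_def by fastforce
  have L: "\<exists>e. lwit A h x0 x1 e Y \<and> e \<in> seg A \<and> over A e Y \<and> ht A e Y = h Y \<and> (e, Lt) \<in> S"
    if "x0 < Y" "Y \<le> x1" for Y
    using h that unfolding lfloor_def S_def lwit_def over_def by fastforce
  have 1: "\<exists>t\<in>S. rstep A (d, Rt) t" if X: "X \<in> {x0..<x1}" and d: "wit A g x0 x1 d X" for d X
  proof -
    have d': "d \<in> seg A" "over A d X" "rt A d \<le> x1" "X < rt A d" "\<And>Y. X \<le> Y \<Longrightarrow> Y \<le> rt A d \<Longrightarrow> g Y = ht A d Y"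
      using d unfolding wit_def over_def by auto
    have rbl: "d \<in> rbl A" using nrb[of d] d' w by auto
    show ?thesis
    proof (cases "rt A d < x1")
      case True
      then obtain e where e: "wit A g x0 x1 e (rt A d)" "e \<in> seg A" "over A e (rt A d)" "ht A e (rt A d) = g (rt A d)" "(e, Rt) \<in> S"
        using W[of "rt A d"] d' X by auto
      \<comment> \<open>A place left of the junction where both segments exist. The witness
        \<open>e\<close> is not below the ceiling there, which orders the slopes.\<close>
      define Z where "Z = (max X (lf A e) + rt A d) / 2"
      have Z: "over A d Z" "over A e Z" "X < Z" "Z < rt A d"
        using e d' unfolding Z_def over_def by (auto simp: max_def)
      have "g Z \<le> ht A e Z" using e(1) Z X d' unfolding wit_def by auto
      then have "ht A d Z \<le> ht A e Z" using d' Z by auto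
      moreover have "ht A d Z \<noteq> ht A e Z" using UU[of d e Z] d' e Z by (auto simp: over_def)
      ultimately have "sl A e < sl A d"
        using steeper(1)[of d e "rt A d" Z] d' e Z by auto
      then have "rstep A (d, Rt) (e, Rt)" using RR[of d A e] d' e rbl by auto
      then show ?thesis using e by blast
    next
      case False
      then have rt: "rt A d = x1" using d' by simp
      show ?thesis
      proof (cases "g x1 = h x1")
        case True
        obtain e where e: "lwit A h x0 x1 e x1" "e \<in> seg A" "over A e x1" "ht A e x1 = h x1" "(e, Lt) \<in> S"
          using L[of x1] x01 by auto
        define Z where "Z = (max X (max x0 (lf A e)) + x1) / 2"
        have Z: "X < Z" "Z < x1" "x0 < Z" "lf A e < Z" using e d' rt x01 X unfolding Z_def over_def by (auto simp: max_def)
        have "ht A e Z < ht A d Z" using hg[of Z] e(1) Z d' rt unfolding lwit_def by auto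
        moreover have "ht A e x1 = ht A d x1" using e True d' rt by auto
        ultimately have "sl A d < sl A e" using steeper(1)[of e d x1 Z] e d' Z by auto
        then have "rstep A (d, Rt) (e, Lt)" using RL[of d A e] d' e rbl rt True by auto
        then show ?thesis using e by blast
      next
        case False
        then have "h x1 < g x1" using hg1 by simp
        then obtain v where v: "v \<in> ver A" "v \<in> bbl A" "xv A v = x1" "bt A v = h x1" "h x1 < p x1" "p x1 < tp A v"
          using right gp by auto
        then have "rstep A (d, Rt) (v, Dn)" using RD[of d A v] d' rbl rt \<open>h x1 < g x1\<close> gp by auto
        moreover have "(v, Dn) \<in> S" using v unfolding S_def by auto
        ultimately show ?thesis by blast
      qed
    qed
  qed
  have 2: "\<exists>t\<in>S. rstep A (d, Lt) t" if X: "X \<in> {x0<..x1}" and d: "lwit A h x0 x1 d X" for d X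
  proof -
    have d': "d \<in> seg A" "over A d X" "x0 \<le> lf A d" "lf A d < X" "\<And>Y. lf A d \<le> Y \<Longrightarrow> Y \<le> X \<Longrightarrow> h Y = ht A d Y"
      using d unfolding lwit_def over_def by auto
    have lbl: "d \<in> lbl A" using nlb[of d] d' w by auto
    show ?thesis
    proof (cases "x0 < lf A d")
      case True
      then obtain e where e: "lwit A h x0 x1 e (lf A d)" "e \<in> seg A" "over A e (lf A d)" "ht A e (lf A d) = h (lf A d)" "(e, Lt) \<in> S"
        using L[of "lf A d"] d' X by auto
      define Z where "Z = (min X (rt A e) + lf A d) / 2"
      have Z: "over A d Z" "over A e Z" "Z < X" "lf A d < Z"
        using e d' unfolding Z_def over_def by (auto simp: min_def)
      have "ht A e Z \<le> h Z" using e(1) Z X d' unfolding lwit_def by auto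
      then have "ht A e Z \<le> ht A d Z" using d' Z by auto
      moreover have "ht A e Z \<noteq> ht A d Z" using UU[of d e Z] d' e Z by (auto simp: over_def)
      ultimately have "sl A e < sl A d"
        using steeper(2)[of e d "lf A d" Z] d' e Z by auto
      then have "rstep A (d, Lt) (e, Lt)" using LL[of d A e] d' e lbl by auto
      then show ?thesis using e by blast
    next
      case False
      then have lf: "lf A d = x0" using d' by simp
      obtain e where e: "wit A g x0 x1 e x0" "e \<in> seg A" "over A e x0" "ht A e x0 = g x0" "(e, Rt) \<in> S"
        using W[of x0] x01 by auto
      show ?thesis
      proof (cases "h x0 = ht A c x0")
        case True
        define Z where "Z = (min X (min x1 (rt A e)) + x0) / 2"
        have Z: "Z < X" "Z < x1" "x0 < Z" "Z < rt A e" using e d' lf x01 X unfolding Z_def over_def by (auto simp: min_def)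
        have "ht A d Z < ht A e Z" using hg[of Z] e(1) Z d' lf unfolding wit_def by auto
        moreover have "ht A e x0 = ht A d x0" using e True d'(5)[of x0] d' lf gx0 by auto
        ultimately have "sl A d < sl A e" using steeper(2)[of d e x0 Z] e d' Z by auto
        then have "rstep A (d, Lt) (e, Rt)" using LR[of d A e] d' e lbl lf \<open>ht A e x0 = ht A d x0\<close> by auto
        then show ?thesis using e by blast
      next
        case False
        then obtain v where v: "v \<in> ver A" "v \<in> tbl A" "xv A v = x0" "bt A v < h x0" "h x0 < tp A v" "tp A v = ht A c x0"
          using left by auto
        have "h x0 = ht A d x0" using d'(5)[of x0] d' lf by auto
        then have "rstep A (d, Lt) (v, Up)" using LU[of d A v] d' lbl lf v by auto
        moreover have "(v, Up) \<in> S" using v gx0 unfolding S_def by auto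
        ultimately show ?thesis by blast
      qed
    qed
  qed
  have 3: "\<exists>t\<in>S. rstep A (v, Up) t" if "v \<in> ver A" "v \<in> tbl A" "xv A v = x0" "tp A v = g x0" for v
  proof -
    obtain e where "e \<in> seg A" "over A e x0" "ht A e x0 = g x0" "(e, Rt) \<in> S" using W[of x0] x01 by auto
    then show ?thesis using UR[of v A e] that by auto
  qed
  have 4: "\<exists>t\<in>S. rstep A (v, Dn) t" if "v \<in> ver A" "v \<in> bbl A" "xv A v = x1" "bt A v = h x1" for v
  proof -
    obtain e where "e \<in> seg A" "over A e x1" "ht A e x1 = h x1" "(e, Lt) \<in> S" using L[of x1] x01 by auto
    then show ?thesis using DL[of v A e] that by auto
  qed
  have memR: "(d, Rt) \<in> S \<Longrightarrow> \<exists>X\<in>{x0..<x1}. wit A g x0 x1 d X"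
    and memL: "(d, Lt) \<in> S \<Longrightarrow> \<exists>X\<in>{x0<..x1}. lwit A h x0 x1 d X"
    and memU: "(d, Up) \<in> S \<Longrightarrow> d \<in> ver A \<and> d \<in> tbl A \<and> xv A d = x0 \<and> tp A d = g x0"
    and memD: "(d, Dn) \<in> S \<Longrightarrow> d \<in> ver A \<and> d \<in> bbl A \<and> xv A d = x1 \<and> bt A d = h x1" for d
    unfolding S_def by simp_all
  have step: "\<exists>t\<in>S. rstep A s t" if s: "s \<in> S" for s
  proof -
    obtain d k where dk: "s = (d, k)" by (cases s)
    show ?thesis
    proof (cases k)
      case Rt then show ?thesis using memR[of d] 1[of _ d] s dk by blast
    next
      case Lt then show ?thesis using memL[of d] 2[of _ d] s dk by blast
    next
      case Up then show ?thesis using memU[of d] 3[of d] s dk by blast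
    next
      case Dn then show ?thesis using memD[of d] 4[of d] s dk by blast
    qed
  qed
  have ne: "S \<noteq> {}" using W[of x0] x01 by auto
  have RL: False if "X \<in> {x0..<x1}" "wit A g x0 x1 d X" "lwit A h x0 x1 d X'" for d X X'
  proof -
    have d: "X < rt A d" "rt A d \<le> x1" "lf A d < X" using that by (auto simp: wit_def over_def)
    define Y where "Y = (X + rt A d) / 2"
    have Y: "X < Y" "Y < rt A d" "over A d Y" using d by (auto simp: Y_def over_def)
    have "g Y = ht A d Y" using that(2) Y unfolding wit_def by auto
    moreover have "ht A d Y \<le> h Y" using that(1,3) Y d unfolding lwit_def by auto
    ultimately show False using hg[of Y] that(1) Y d by auto
  qed
  have sv: "d \<in> seg A \<Longrightarrow> d \<notin> ver A" for d using disj by auto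
  have inR: "d \<in> seg A" if "(d, Rt) \<in> S" for d using memR[OF that] by (auto simp: wit_def)
  have inL: "d \<in> seg A" if "(d, Lt) \<in> S" for d using memL[OF that] by (auto simp: lwit_def)
  have noRL: "\<not> ((d, Rt) \<in> S \<and> (d, Lt) \<in> S)" for d using memR[of d] memL[of d] RL[of _ d] by blast
  have one: "k = k'" if "(d, k) \<in> S" "(d, k') \<in> S" for d k k'
    using that noRL[of d] inR[of d] inL[of d] memU[of d] memD[of d] sv[of d] x01
    by (cases k; cases k') simp_all
  have inj: "inj_on fst S"
  proof (rule inj_onI)
    fix s t assume st: "s \<in> S" "t \<in> S" "fst s = fst t"
    then show "s = t" using one[of "fst s" "snd s" "snd t"] by (metis prod.collapse)
  qed
  show ?thesis using ne inj step unfolding closed_walk_def by (intro exI[of _ S] conjI ballI)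
qed

end

text \<open>Induction on the number of knots: a room that does not close up gives a rotated one over
  \<open>x0\<close> to \<open>x2\<close>, which has lost the knot \<open>x1\<close>.\<close>

theorem room_closed_walk:
  "\<lbrakk>arrangement A; room A p h x0 x1 c; card (knots A \<inter> {x0..x1}) = n\<rbrakk> \<Longrightarrow> \<exists>S. closed_walk A S"
proof (induction n arbitrary: A p h x0 x1 c rule: less_induct)
  case (less n)
  interpret arrangement A by fact
  obtain g x2 a X where C: "room_chain h x0 x1 g x2 a X" "g x0 = ht A c x0" "g x2 \<le> p x2"
    using room_new_chain[OF less.prems(2)] by blast
  have x2: "x2 \<le> x1" using C by (simp add: room_chain_def)
  show ?case
  proof (cases "x2 = x1")
    case True then show ?thesis using room_close[OF less.prems(2)] C by simp
  next
    case False
    then have lt: "x2 < x1" using x2 by simp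
    obtain c' where c': "room (rot A) (\<lambda>X. - h (- X)) (\<lambda>X. - g (- X)) (- x2) (- x0) c'"
      using room_next[OF less.prems(2) C(1,2) lt] by blast
    have "knots (rot A) \<inter> {- x2..- x0} = uminus ` (knots A \<inter> {x0..x2})"
      unfolding knots_def by force
    then have "card (knots (rot A) \<inter> {- x2..- x0}) = card (knots A \<inter> {x0..x2})"
      by (simp add: card_image)
    also have "\<dots> < card (knots A \<inter> {x0..x1})"
    proof (rule psubset_card_mono)
      show "finite (knots A \<inter> {x0..x1})" using fin finv by (auto simp: knots_def)
      have "x1 \<in> knots A" "x0 < x1" using less.prems by (auto simp: room_def lfloor_def)
      then have "x1 \<in> knots A \<inter> {x0..x1}" "x1 \<notin> knots A \<inter> {x0..x2}" using lt by auto
      moreover have "knots A \<inter> {x0..x2} \<subseteq> knots A \<inter> {x0..x1}" using lt by auto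
      ultimately show "knots A \<inter> {x0..x2} \<subset> knots A \<inter> {x0..x1}" by blast
    qed
    finally have "\<exists>S. closed_walk (rot A) S"
      using less.IH[OF _ arrangement_rot c' refl] less.prems(3) by simp
    then show ?thesis using closed_walk_rot by blast
  qed
qed

section \<open>Closed walks in a half-plane\<close>

text \<open>The least point of the compact set on which \<open>f\<close> is non-negative.\<close>

lemma first_zero:
  fixes f :: "real \<Rightarrow> real"
  assumes "continuous_on {a..b} f" "a \<le> b" "f a < 0" "0 \<le> f b"
  obtains z where "a < z" "z \<le> b" "f z = 0" "\<And>y. a \<le> y \<Longrightarrow> y < z \<Longrightarrow> f y < 0"
proof -
  define T where "T = {y \<in> {a..b}. f y \<in> {0..}}"
  have "closed T" unfolding T_def using assms by (intro continuous_closed_preimage[unfolded Int_def vimage_def, simplified]) auto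
  then have T: "compact T" "T \<noteq> {}" using assms unfolding T_def
    by (auto simp: compact_eq_bounded_closed intro: bounded_subset[OF bounded_closed_interval])
  obtain z where z: "z \<in> T" "\<And>y. y \<in> T \<Longrightarrow> z \<le> y" using compact_attains_inf[OF T] by auto
  have neg: "f y < 0" if "a \<le> y" "y < z" for y using z that by (force simp: T_def)
  have "a < z" using z assms by (cases "z = a") (auto simp: T_def)
  moreover have "f z = 0"
  proof (rule ccontr)
    assume "f z \<noteq> 0"
    then have "0 < f z" using z by (auto simp: T_def)
    have az: "a \<le> z" "z \<le> b" using z by (auto simp: T_def)
    have "continuous_on {min a z..max a z} f" by (rule continuous_on_subset[OF assms(1)]) (use az in auto)
    from zero_between[OF this assms(3)] obtain w where "a \<le> w" "w \<le> z" "f w = 0"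
      using az \<open>0 < f z\<close> by auto
    then show False using neg[of w] \<open>0 < f z\<close> by (cases "w = z") auto
  qed
  ultimately show thesis using that neg z by (auto simp: T_def)
qed

text \<open>Only verticals that dip below height 0 may have a free lower end; segments run off
  to infinity only upwards.\<close>
locale half_arrangement = arrangement +
  assumes pos: "\<lbrakk>a \<in> seg A; lf A a \<le> X; X \<le> rt A a\<rbrakk> \<Longrightarrow> 0 < ht A a X"
    and esc: "\<lbrakk>v \<in> ver A; v \<notin> bbl A\<rbrakk> \<Longrightarrow> v \<in> tbl A \<and> bt A v < 0"
    and esc_unique: "\<lbrakk>v \<in> ver A; v \<notin> bbl A; w \<in> ver A; w \<notin> bbl A; xv A v = xv A w\<rbrakk> \<Longrightarrow> v = w"
    and right_up: "\<lbrakk>a \<in> seg A; a \<notin> rbl A\<rbrakk> \<Longrightarrow> 0 < sl A a"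
    and left_up: "\<lbrakk>a \<in> seg A; a \<notin> lbl A\<rbrakk> \<Longrightarrow> sl A a < 0"
begin

lemma half_arrangement_mir: "half_arrangement (mir A)"
proof -
  interpret M: arrangement "mir A" by (rule arrangement_mir)
  show ?thesis
  proof
    fix a X assume "a \<in> seg (mir A)" "lf (mir A) a \<le> X" "X \<le> rt (mir A) a"
    then show "0 < ht (mir A) a X" using pos[of a "-X"] by simp
  next
    fix v w assume "v \<in> ver (mir A)" "v \<notin> bbl (mir A)" "w \<in> ver (mir A)" "w \<notin> bbl (mir A)" "xv (mir A) v = xv (mir A) w"
    then show "v = w" using esc_unique[of v w] by simp
  qed (use esc left_up right_up in auto)
qed

text \<open>A walk that neither runs off nor meets a free vertical turns back. Then its ceiling, the
  line of height 0 and \<open>W\<close> itself enclose a room, and a closed walk would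
  exist.\<close>

lemma escape:
  assumes no: "\<nexists>S. closed_walk A S" and W: "W \<in> ver A" "W \<notin> bbl A"
    and c: "c \<in> seg A" "over A c (xv A W)" "ht A c (xv A W) = tp A W"
  obtains (away) g where "rceil A g (xv A W) (wd A)" "g (xv A W) = tp A W" "0 < sl A c"
  | (down) g W' where "rceil A g (xv A W) (xv A W')" "g (xv A W) = tp A W"
      "W' \<in> ver A" "W' \<notin> bbl A" "g (xv A W') < tp A W'"
proof -
  let ?x = "xv A W"
  obtain g x1 a X where g: "rceil A g ?x x1" "g ?x = ht A c ?x" "wit A g ?x x1 a X" "rt A a = x1"
    "sl A a \<le> sl A c" "\<And>b. \<lbrakk>b \<in> seg A; over A b x1; ht A b x1 = ht A a x1\<rbrakk> \<Longrightarrow> sl A a \<le> sl A b"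
    by (rule right_chain[of c ?x "\<lambda>_ _. True", OF c(1,2)]) auto
  have a: "a \<in> seg A" using g by (auto simp: wit_def)
  show thesis
  proof (cases "a \<in> rbl A")
    case False
    \<comment> \<open>The last slope is positive and no slope of the walk exceeds that of
      \<open>c\<close>.\<close>
    then have "x1 = wd A" "0 < sl A c" using nrb[OF a] right_up[OF a] g by auto
    then show thesis using away[of g] g c by auto
  next
    case True
    have g6: "\<forall>b\<in>seg A. over A b x1 \<longrightarrow> ht A b x1 = ht A a x1 \<longrightarrow> sl A a \<le> sl A b" using g(6) by blast
    from turn[OF g(1,3,4) True g6] show thesis
    proof (elim disjE)
      assume "\<exists>v\<in>ver A. v \<notin> bbl A \<and> xv A v = x1 \<and> bt A v < g x1 \<and> g x1 < tp A v"
      then obtain v where v: "v \<in> ver A" "v \<notin> bbl A" "xv A v = x1" "g x1 < tp A v" by blast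
      show thesis by (rule down[of g v]) (use v g c in simp_all)
    next
      assume "\<exists>c'\<in>seg A. over A c' x1 \<and> (\<exists>e<x1. \<forall>Y\<in>{e<..<x1}. ht A c' Y < g Y) \<and>
         (g x1 = ht A c' x1 \<or> (\<exists>v\<in>ver A. v \<in> bbl A \<and> xv A v = x1 \<and> g x1 < tp A v \<and> bt A v < g x1 \<and> bt A v = ht A c' x1))"
      then obtain c' e where c': "c' \<in> seg A" "over A c' x1" "e < x1" "\<forall>Y\<in>{e<..<x1}. ht A c' Y < g Y"
        "g x1 = ht A c' x1 \<or> (\<exists>v\<in>ver A. v \<in> bbl A \<and> xv A v = x1 \<and> g x1 < tp A v \<and> bt A v < g x1 \<and> bt A v = ht A c' x1)"
        by blast
      have "room (rot A) (\<lambda>X. 0) (\<lambda>X. - g (- X)) (- x1) (- ?x) c'"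
        unfolding room_def
      proof (intro conjI ballI impI)
        show "lfloor (rot A) (\<lambda>X. - g (- X)) (- x1) (- ?x)" by (rule lfloor_rot[OF g(1)])
        show "- wd (rot A) < - x1" "- ?x < wd (rot A)" using rbw[OF a True] g vw[of W] W by auto
        show "- x1 \<in> knots (rot A)" "- ?x \<in> knots (rot A)" using a g W unfolding knots_def by auto
        show "c' \<in> seg (rot A)" "over (rot A) c' (- x1)" using c' by auto
        show "ht (rot A) c' (- x1) \<le> 0" using c' pos[of c' x1] by (auto simp: over_def)
        show "\<exists>ea>- x1. \<forall>X\<in>{- x1<..<ea}. - g (- X) < ht (rot A) c' X"
          using c' by (intro exI[of _ "- e"]) auto
        \<comment> \<open>After the half-turn \<open>W\<close> is the right wall: it starts on the
          floor and reaches beyond height 0.\<close>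
        have "0 < tp A W" using pos[of c ?x] c by (auto simp: over_def)
        then show "- g (- (- ?x)) = 0 \<or> (\<exists>v\<in>ver (rot A). v \<in> bbl (rot A) \<and> xv (rot A) v = - ?x \<and>
          bt (rot A) v = - g (- (- ?x)) \<and> - g (- (- ?x)) < 0 \<and> 0 < tp (rot A) v)"
          using W esc[of W] g c by auto
        show "- g (- (- x1)) = ht (rot A) c' (- x1) \<or> (\<exists>v\<in>ver (rot A). v \<in> tbl (rot A) \<and> xv (rot A) v = - x1 \<and>
          bt (rot A) v < - g (- (- x1)) \<and> - g (- (- x1)) < tp (rot A) v \<and> tp (rot A) v = ht (rot A) c' (- x1))"
          using c' by auto
        fix d Z Y
        assume "d \<in> seg (rot A)" "Z \<in> {- x1..<- ?x}" "over (rot A) d Z \<and> ht (rot A) d Z \<le> 0"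
          "Y \<in> {Z..- ?x}" "Y \<le> rt (rot A) d"
        then show "ht (rot A) d Y \<le> 0" using pos[of d "-Y"] by (auto simp: over_def)
      qed
      then have "\<exists>S. closed_walk (rot A) S" using room_closed_walk[OF arrangement_rot] by blast
      then show thesis using closed_walk_rot no by blast
    qed
  qed
qed

text \<open>The mirror image of \<open>rceil\<close>: the trace of a walk to the left that always
  bends left.\<close>

definition lceil where
  "lceil l x0 x1 \<longleftrightarrow> x0 < x1 \<and> continuous_on {x0..x1} l \<and>
     (\<forall>X\<in>{x0<..x1}. \<exists>d\<in>seg A. over A d X \<and> x0 \<le> lf A d \<and> (\<forall>Y\<in>{lf A d..X}. l Y = ht A d Y) \<and>
        (\<forall>Y\<in>{x0..x1}. over A d Y \<longrightarrow> l Y \<le> ht A d Y))"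

lemma rceilD:
  assumes "rceil A g x0 x1" "x0 \<le> X" "X < x1"
  obtains d where "wit A g x0 x1 d X" "d \<in> seg A" "over A d X" "g X = ht A d X"
proof -
  have "\<forall>X\<in>{x0..<x1}. \<exists>d. wit A g x0 x1 d X" using assms(1) unfolding rceil_def by (elim conjE)
  from bspec[OF this, of X] assms obtain d where d: "wit A g x0 x1 d X" by auto
  then have "d \<in> seg A" "over A d X" "g X = ht A d X" unfolding wit_def over_def by auto
  then show thesis using that d by blast
qed

lemma lceilD:
  assumes "lceil l x0 x1" "x0 < X" "X \<le> x1"
  obtains d where "d \<in> seg A" "over A d X" "x0 \<le> lf A d" "\<And>Y. lf A d \<le> Y \<Longrightarrow> Y \<le> X \<Longrightarrow> l Y = ht A d Y"
    "l X = ht A d X" "\<And>Y. x0 \<le> Y \<Longrightarrow> Y \<le> x1 \<Longrightarrow> over A d Y \<Longrightarrow> l Y \<le> ht A d Y"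
proof -
  have "\<forall>X\<in>{x0<..x1}. \<exists>d\<in>seg A. over A d X \<and> x0 \<le> lf A d \<and> (\<forall>Y\<in>{lf A d..X}. l Y = ht A d Y) \<and>
        (\<forall>Y\<in>{x0..x1}. over A d Y \<longrightarrow> l Y \<le> ht A d Y)"
    using assms(1) unfolding lceil_def by (elim conjE)
  from bspec[OF this, of X] assms obtain d where d: "d \<in> seg A" "over A d X" "x0 \<le> lf A d"
    "\<forall>Y\<in>{lf A d..X}. l Y = ht A d Y" "\<forall>Y\<in>{x0..x1}. over A d Y \<longrightarrow> l Y \<le> ht A d Y" by auto
  moreover have "l X = ht A d X" using d by (auto simp: over_def)
  ultimately show thesis using that by (metis atLeastAtMost_iff)
qed

lemma lceil_mir:
  assumes "rceil (mir A) g x0 x1" shows "lceil (\<lambda>X. g (- X)) (- x1) (- x0)"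
  unfolding lceil_def
proof (intro conjI ballI)
  show "- x1 < - x0" "continuous_on {- x1..- x0} (\<lambda>X. g (- X))"
    using assms by (auto simp: rceil_def intro: continuous_on_uminus_arg)
  fix X assume "X \<in> {- x1<..- x0}"
  then have "- X \<in> {x0..<x1}" by auto
  then obtain d where d: "wit (mir A) g x0 x1 d (- X)" using assms unfolding rceil_def by blast
  have 1: "g (- Y) = ht A d Y" if "Y \<in> {lf A d..X}" for Y
  proof -
    have "\<forall>Y\<in>{- X..rt (mir A) d}. g Y = ht (mir A) d Y" using d unfolding wit_def by blast
    from this[rule_format, of "- Y"] show ?thesis using that by simp
  qed
  have 2: "g (- Y) \<le> ht A d Y" if "Y \<in> {- x1..- x0}" "over A d Y" for Y
  proof -
    have "\<forall>Y\<in>{x0..x1}. over (mir A) d Y \<longrightarrow> g Y \<le> ht (mir A) d Y" using d unfolding wit_def by blast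
    from this[rule_format, of "- Y"] show ?thesis using that by simp
  qed
  show "\<exists>d\<in>seg A. over A d X \<and> - x1 \<le> lf A d \<and> (\<forall>Y\<in>{lf A d..X}. g (- Y) = ht A d Y) \<and>
        (\<forall>Y\<in>{- x1..- x0}. over A d Y \<longrightarrow> g (- Y) \<le> ht A d Y)"
    using d 1 2 by (intro bexI[of _ d]) (auto simp: wit_def)
qed

lemma escape_left:
  assumes no: "\<nexists>S. closed_walk (mir A) S" and W: "W \<in> ver A" "W \<notin> bbl A"
    and c: "c \<in> seg A" "over A c (xv A W)" "ht A c (xv A W) = tp A W"
  obtains (away) l where "lceil l (- wd A) (xv A W)" "l (xv A W) = tp A W" "sl A c < 0"
  | (down) l W' where "lceil l (xv A W') (xv A W)" "l (xv A W) = tp A W"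
      "W' \<in> ver A" "W' \<notin> bbl A" "l (xv A W') < tp A W'"
proof -
  interpret M: half_arrangement "mir A" by (rule half_arrangement_mir)
  show thesis
  proof (rule M.escape[of W c])
    show "\<nexists>S. closed_walk (mir A) S" by (rule no)
  next
    fix g assume "rceil (mir A) g (xv (mir A) W) (wd (mir A))" "g (xv (mir A) W) = tp (mir A) W" "0 < sl (mir A) c"
    then show thesis using away[of "\<lambda>X. g (- X)"] lceil_mir[of g] by fastforce
  next
    fix g W' assume "rceil (mir A) g (xv (mir A) W) (xv (mir A) W')" "g (xv (mir A) W) = tp (mir A) W"
      "W' \<in> ver (mir A)" "W' \<notin> bbl (mir A)" "g (xv (mir A) W') < tp (mir A) W'"
    then show thesis using down[of "\<lambda>X. g (- X)" W'] lceil_mir[of g] by fastforce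
  qed (use W c in auto)
qed

text \<open>A segment below the top of \<open>W\<close> would cross \<open>W\<close>, since nothing
  gets below a free lower end.\<close>

lemma escaping_below:
  assumes "W \<in> ver A" "W \<notin> bbl A" "d \<in> seg A" "over A d (xv A W)"
  shows "tp A W \<le> ht A d (xv A W)"
  using UV[of d W] nbb[of W d] assms by force

text \<open>If every walk escaped, consider the rightmost escaping vertical \<open>W\<close> whose left walk runs off
  to infinity. Its right walk runs down some \<open>W'\<close>, whose left walk runs down some \<open>W''\<close>;
  but this last walk would have to cross the right or the left walk of \<open>W\<close>.\<close>
theorem closed_walk_exists:
  assumes ex: "W0 \<in> ver A" "W0 \<notin> bbl A"
  shows "(\<exists>S. closed_walk A S) \<or> (\<exists>S. closed_walk (mir A) S)"
proof (rule ccontr)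
  assume "\<not> ?thesis"
  then have no: "\<nexists>S. closed_walk A S" and nol: "\<nexists>S. closed_walk (mir A) S" by auto
  define E where "E = {v \<in> ver A. v \<notin> bbl A}"
  have E: "finite E" "W0 \<in> E" using finv ex by (auto simp: E_def)
  have top: "\<exists>c\<in>seg A. over A c (xv A v) \<and> ht A c (xv A v) = tp A v" if "v \<in> E" for v
    using that tb[of v] esc[of v] by (auto simp: E_def)
  \<comment> \<open>The escaping verticals whose left walk runs off. The negative slope is recorded
    because it keeps the right walk from running off as well.\<close>
  define J where "J = {v \<in> E. \<exists>l. lceil l (- wd A) (xv A v) \<and> l (xv A v) = tp A v \<and>
     (\<exists>c\<in>seg A. over A c (xv A v) \<and> ht A c (xv A v) = tp A v \<and> sl A c < 0)}"
  have left: "v \<in> J \<or> (\<exists>l. \<exists>w\<in>E. lceil l (xv A w) (xv A v) \<and> l (xv A v) = tp A v \<and> l (xv A w) < tp A w)"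
    if v: "v \<in> E" for v
  proof -
    obtain c where c: "c \<in> seg A" "over A c (xv A v)" "ht A c (xv A v) = tp A v" using top[OF v] by auto
    show ?thesis
      by (rule escape_left[OF nol _ _ c]) (use v c in \<open>auto simp: E_def J_def\<close>)
  qed
  \<comment> \<open>The leftmost escaping vertical is in \<open>J\<close>, as its left walk has no
    vertical to go down.\<close>
  obtain m where m: "m \<in> E" "\<And>v. v \<in> E \<Longrightarrow> xv A m \<le> xv A v"
    using ex_is_arg_min_if_finite[OF E(1), of "xv A"] E(2) by (force simp: is_arg_min_def)
  have "m \<in> J" using left[OF m(1)] m(2) by (force simp: lceil_def)
  moreover have "finite J" using E by (auto simp: J_def)
  ultimately obtain W where W: "W \<in> J" "\<And>v. v \<in> J \<Longrightarrow> xv A v \<le> xv A W"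
    using ex_is_arg_min_if_finite[of J "\<lambda>v. - xv A v"] by (force simp: is_arg_min_def)
  let ?x = "xv A W"
  have WE: "W \<in> ver A" "W \<notin> bbl A" using W by (auto simp: J_def E_def)
  obtain l' c where l': "lceil l' (- wd A) ?x" "l' ?x = tp A W"
    and c: "c \<in> seg A" "over A c ?x" "ht A c ?x = tp A W" "sl A c < 0"
    using W by (auto simp: J_def)
  \<comment> \<open>Running off to the right would require a positive slope of
    \<open>c\<close>.\<close>
  obtain r W' where r: "rceil A r ?x (xv A W')" "r ?x = tp A W" "W' \<in> E" "r (xv A W') < tp A W'"
    by (rule escape[OF no WE c(1-3)]) (use c in \<open>auto simp: E_def\<close>)
  let ?x' = "xv A W'"
  have xx': "?x < ?x'" using r by (simp add: rceil_def)
  then have "W' \<notin> J" using W(2)[of W'] by auto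
  then obtain l W'' where l: "lceil l (xv A W'') ?x'" "l ?x' = tp A W'" "l (xv A W'') < tp A W''" and W'': "W'' \<in> E"
    using left[OF r(3)] by auto
  let ?y = "xv A W''"
  have yx': "?y < ?x'" using l by (simp add: lceil_def)
  have W''E: "W'' \<in> ver A" "W'' \<notin> bbl A" using W'' by (auto simp: E_def)
  show False
  proof (cases "?x \<le> ?y")
    case True
    have ry: "tp A W'' \<le> r ?y"
    proof (cases "?y = ?x")
      case True
      then have "W'' = W" by (rule esc_unique[OF W''E WE])
      then show ?thesis using r(2) by simp
    next
      case False
      obtain d where "d \<in> seg A" "over A d ?y" "r ?y = ht A d ?y"
        using rceilD[OF r(1) True yx'] by blast
      then show ?thesis using escaping_below[OF W''E, of d] by simp
    qed
    \<comment> \<open>Reflected, so that the first zero is the meeting point nearest to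
      \<open>W'\<close>.\<close>
    define f where "f X = r (- X) - l (- X)" for X
    have "continuous_on {?y..?x'} (\<lambda>X. r X - l X)"
      using r l True by (intro continuous_intros) (auto simp: rceil_def lceil_def elim!: continuous_on_subset)
    then have cf: "continuous_on {-?x'..-?y} f" unfolding f_def by (rule continuous_on_uminus_arg)
    obtain z where z: "- ?x' < z" "z \<le> - ?y" "f z = 0" "\<And>u. - ?x' \<le> u \<Longrightarrow> u < z \<Longrightarrow> f u < 0"
      using first_zero[OF cf] yx' r l ry by (auto simp: f_def)
    have zy: "- z \<noteq> ?y" using z(3) l ry by (auto simp: f_def)
    obtain d where d: "wit A r ?x ?x' d (- z)" and d': "d \<in> seg A" "over A d (- z)" "r (- z) = ht A d (- z)"
      by (rule rceilD[OF r(1), of "- z"]) (use z True in auto)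
    obtain e where e: "e \<in> seg A" "over A e (- z)" "l (- z) = ht A e (- z)"
      "\<And>Y. ?y \<le> Y \<Longrightarrow> Y \<le> ?x' \<Longrightarrow> over A e Y \<Longrightarrow> l Y \<le> ht A e Y"
      by (rule lceilD[OF l(1), of "- z"]) (use z zy in auto)
    have "ht A e (- z) = ht A d (- z)" using e(3) d'(3) z(3) by (simp add: f_def)
    then have ed: "e = d" by (rule UU[OF e(1) d'(1) e(2) d'(2)])
    \<comment> \<open>Right of the meeting point the common segment still carries \<open>r\<close>,
      and \<open>l\<close> is not above it; this contradicts the sign of \<open>f\<close>
      there.\<close>
    define u where "u = (- z + rt A d) / 2"
    have u: "- z < u" "u < rt A d" "rt A d \<le> ?x'" "over A d u"
      using d' d unfolding u_def over_def wit_def by auto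
    have "\<forall>Y\<in>{- z..rt A d}. r Y = ht A d Y" using d unfolding wit_def by blast
    then have "r u = ht A d u" using u by simp
    moreover have "l u \<le> ht A d u" using e(4)[of u] u z True xx' unfolding ed by linarith
    ultimately show False using z(4)[of "- u"] u by (simp add: f_def)
  next
    case False
    \<comment> \<open>Now \<open>W''\<close> is left of \<open>W\<close>: the left walk of
      \<open>W'\<close> passes over \<open>W\<close> but arrives at \<open>W''\<close> below the
      left walk of \<open>W\<close>.\<close>
    obtain d where d: "d \<in> seg A" "over A d ?x" "l ?x = ht A d ?x"
      by (rule lceilD[OF l(1), of ?x]) (use False xx' in auto)
    have lx: "l' ?x \<le> l ?x" using escaping_below[OF WE d(1,2)] d l' by simp
    obtain d where d: "d \<in> seg A" "over A d ?y" "l' ?y = ht A d ?y"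
      by (rule lceilD[OF l'(1), of ?y]) (use False vw[OF W''E(1)] in auto)
    have ly: "l ?y < l' ?y" using escaping_below[OF W''E d(1,2)] d l by simp
    have cf: "continuous_on {?y..?x} (\<lambda>X. l X - l' X)"
      using l l' False xx' vw[OF W''E(1)] by (intro continuous_intros) (auto simp: lceil_def elim!: continuous_on_subset)
    obtain z where z: "?y < z" "z \<le> ?x" "l z = l' z" "\<And>u. ?y \<le> u \<Longrightarrow> u < z \<Longrightarrow> l u < l' u"
      using first_zero[OF cf] ly lx False by auto
    obtain d where d: "d \<in> seg A" "over A d z" "?y \<le> lf A d" "\<And>Y. lf A d \<le> Y \<Longrightarrow> Y \<le> z \<Longrightarrow> l Y = ht A d Y"
      by (rule lceilD[OF l(1), of z]) (use z xx' in auto)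
    obtain e where e: "e \<in> seg A" "over A e z" "\<And>Y. lf A e \<le> Y \<Longrightarrow> Y \<le> z \<Longrightarrow> l' Y = ht A e Y"
      by (rule lceilD[OF l'(1), of z]) (use z vw[OF W''E(1)] in auto)
    have "ht A d z = ht A e z" using d(4)[of z] e(3)[of z] z(3) d(2) e(2) by (simp add: over_def)
    then have de: "d = e" by (rule UU[OF d(1) e(1) d(2) e(2)])
    define u where "u = (lf A d + z) / 2"
    have u: "lf A d \<le> u" "u < z" "?y \<le> u" using d unfolding u_def over_def by auto
    then have "l u = l' u" using d(4)[of u] e(3)[of u] unfolding de by simp
    then show False using z(4)[of u] u by auto
  qed
qed

end

section \<open>Arcs as planar cones\<close>

lemma triple_expand:
  "triple x y z = x$1 * (y$2 * z$3 - y$3 * z$2) + x$2 * (y$3 * z$1 - y$1 * z$3) + x$3 * (y$1 * z$2 - y$2 * z$1)"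
  by (simp add: triple_def cross3_def inner_vec_def sum_3)

lemma inner_expand: "(x::real^3) \<bullet> y = x$1 * y$1 + x$2 * y$2 + x$3 * y$3"
  by (simp add: inner_vec_def sum_3)

text \<open>The product of two determinants is the determinant of the matrix of inner
  products.\<close>

lemma triple_gram:
  "triple x y z * triple u w e =
   (x \<bullet> u) * ((y \<bullet> w) * (z \<bullet> e) - (y \<bullet> e) * (z \<bullet> w)) + (x \<bullet> w) * ((y \<bullet> e) * (z \<bullet> u) - (y \<bullet> u) * (z \<bullet> e))
   + (x \<bullet> e) * ((y \<bullet> u) * (z \<bullet> w) - (y \<bullet> w) * (z \<bullet> u))"
  unfolding triple_expand inner_expand by algebra

text \<open>Cramer's rule, free of division.\<close>

lemma cramer3:
  "triple N p q *\<^sub>R x = triple x p q *\<^sub>R N + triple N x q *\<^sub>R p + triple N p x *\<^sub>R q"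
  unfolding vec_eq_iff forall_3 triple_expand by (simp add: algebra_simps)

lemma triple_cong: "triple x y z = - triple y x z" "triple x y z = - triple x z y" "triple x y z = triple y z x"
  unfolding triple_expand by algebra+

lemma triple_linear [simp]:
  "triple (x + x') y z = triple x y z + triple x' y z" "triple x (y + y') z = triple x y z + triple x y' z"
  "triple x y (z + z') = triple x y z + triple x y z'"
  "triple (c *\<^sub>R x) y z = c * triple x y z" "triple x (c *\<^sub>R y) z = c * triple x y z"
  "triple x y (c *\<^sub>R z) = c * triple x y z"
  "triple x x z = 0" "triple x y y = 0" "triple x y x = 0"
  by (simp_all add: triple_expand algebra_simps)

text \<open>Cramer's rule in the basis \<open>p\<close>, \<open>q\<close>,
  \<open>cross3 p q\<close>; the third coordinate vanishes.\<close>

lemma plane_comb: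
  assumes "triple N p q = 0" "cross3 p q \<noteq> 0"
  obtains \<alpha> \<beta> where "N = \<alpha> *\<^sub>R p + \<beta> *\<^sub>R q"
proof -
  let ?c = "cross3 p q"
  have "(?c \<bullet> ?c) *\<^sub>R N = triple N q ?c *\<^sub>R p + triple N ?c p *\<^sub>R q + triple N p q *\<^sub>R ?c"
    unfolding vec_eq_iff forall_3 triple_expand inner_expand cross3_def by (simp add: algebra_simps)
  then have "(?c \<bullet> ?c) *\<^sub>R N = triple N q ?c *\<^sub>R p + triple N ?c p *\<^sub>R q" using assms by simp
  then have "inverse (?c \<bullet> ?c) *\<^sub>R ((?c \<bullet> ?c) *\<^sub>R N) =
     inverse (?c \<bullet> ?c) *\<^sub>R (triple N q ?c *\<^sub>R p + triple N ?c p *\<^sub>R q)" by simp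
  then have "N = (inverse (?c \<bullet> ?c) * triple N q ?c) *\<^sub>R p + (inverse (?c \<bullet> ?c) * triple N ?c p) *\<^sub>R q"
    using assms by (simp add: scaleR_add_right)
  then show thesis by (rule that)
qed

text \<open>Lets a statement name the two ends in either order, although arcs are ordered
  pairs.\<close>

definition ends :: "arc \<Rightarrow> point \<Rightarrow> point \<Rightarrow> bool" where
  "ends a p q \<longleftrightarrow> a = (p, q) \<or> a = (q, p)"

lemma ends_sym: "ends a p q \<Longrightarrow> ends a q p" by (auto simp: ends_def)

lemma ends_self: "ends a (fst a) (snd a)" by (simp add: ends_def)

lemma sgn_pos_comb:
  assumes "norm x = 1" "x = c *\<^sub>R v" "0 < c" shows "sgn v = x"
proof -
  have "norm v = 1 / c" using assms by (simp add: field_simps)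
  then show ?thesis using assms by (simp add: sgn_div_norm)
qed

text \<open>Unit vectors in a linear relation have coefficients of equal modulus, which would make
  them equal or opposite.\<close>

lemma valid_indep:
  assumes "valid_arc a" "ends a p q" "\<alpha> *\<^sub>R p + \<beta> *\<^sub>R q = 0"
  shows "\<alpha> = 0" "\<beta> = 0"
proof -
  have n: "norm p = 1" "norm q = 1" and pq: "p \<noteq> q" "p \<noteq> - q"
    using assms by (auto simp: valid_arc_def ends_def on_sphere_def)
  have eq: "\<alpha> *\<^sub>R p = - (\<beta> *\<^sub>R q)" using assms(3) by (simp add: eq_neg_iff_add_eq_0)
  then have "norm (\<alpha> *\<^sub>R p) = norm (\<beta> *\<^sub>R q)" by simp
  then have "\<bar>\<alpha>\<bar> = \<bar>\<beta>\<bar>" using n by simp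
  then have "\<alpha> = \<beta> \<or> \<alpha> = - \<beta>" by (auto simp: abs_if split: if_splits)
  moreover have "\<alpha> = 0" if "\<alpha> = \<beta>"
  proof (rule ccontr)
    assume "\<alpha> \<noteq> 0"
    moreover have "\<alpha> *\<^sub>R p = \<alpha> *\<^sub>R (- q)" using eq that by simp
    ultimately show False using pq by (simp only: scaleR_cancel_left) auto
  qed
  moreover have "\<alpha> = 0" if "\<alpha> = - \<beta>"
  proof (rule ccontr)
    assume "\<alpha> \<noteq> 0"
    moreover have "\<alpha> *\<^sub>R p = \<alpha> *\<^sub>R q" using eq that by simp
    ultimately show False using pq by (simp only: scaleR_cancel_left) auto
  qed
  ultimately show "\<alpha> = 0" by blast
  with \<open>\<bar>\<alpha>\<bar> = \<bar>\<beta>\<bar>\<close> show "\<beta> = 0" by simp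
qed

lemma comb_unique:
  assumes "valid_arc a" "ends a p q" "\<alpha> *\<^sub>R p + \<beta> *\<^sub>R q = \<gamma> *\<^sub>R p + \<delta> *\<^sub>R q"
  shows "\<alpha> = \<gamma>" "\<beta> = \<delta>"
proof -
  have "(\<alpha> - \<gamma>) *\<^sub>R p + (\<beta> - \<delta>) *\<^sub>R q = 0" using assms(3) by (simp add: algebra_simps)
  from valid_indep[OF assms(1,2) this] show "\<alpha> = \<gamma>" "\<beta> = \<delta>" by auto
qed

lemma valid_cross:
  assumes "valid_arc a" "ends a p q" shows "cross3 p q \<noteq> 0"
proof
  assume "cross3 p q = 0"
  then have "collinear {0, p, q}" by (simp add: cross_eq_0)
  then obtain c where "p = 0 \<or> q = 0 \<or> q = c *\<^sub>R p" by (auto simp: collinear_lemma)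
  moreover have "p \<noteq> 0" "q \<noteq> 0" using assms by (auto simp: valid_arc_def ends_def on_sphere_def)
  ultimately have "c *\<^sub>R p + (- 1) *\<^sub>R q = 0" by auto
  from valid_indep[OF assms this] show False by simp
qed

lemma chord_nonzero:
  assumes "valid_arc a" "ends a p q" "0 \<le> \<alpha>" "0 \<le> \<beta>" "0 < \<alpha> + \<beta>"
  shows "\<alpha> *\<^sub>R p + \<beta> *\<^sub>R q \<noteq> 0"
  using valid_indep[OF assms(1,2), of \<alpha> \<beta>] assms by auto

text \<open>Arcs become open planar cones, so that linear algebra replaces the parametrization by
  \<open>sgn\<close>.\<close>

lemma relint_iff:
  assumes "valid_arc a" "ends a p q"
  shows "x \<in> arc_relint a \<longleftrightarrow> norm x = 1 \<and> (\<exists>\<alpha>>0. \<exists>\<beta>>0. x = \<alpha> *\<^sub>R p + \<beta> *\<^sub>R q)"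
proof -
  have main: "x \<in> arc_relint (r, s) \<longleftrightarrow> norm x = 1 \<and> (\<exists>\<alpha>>0. \<exists>\<beta>>0. x = \<alpha> *\<^sub>R r + \<beta> *\<^sub>R s)"
    if v: "valid_arc (r, s)" for r s
  proof
    assume "x \<in> arc_relint (r, s)"
    then obtain t where t: "0 < t" "t < 1" "x = sgn ((1 - t) *\<^sub>R r + t *\<^sub>R s)" by (auto simp: arc_relint_def)
    let ?v = "(1 - t) *\<^sub>R r + t *\<^sub>R s"
    have "?v \<noteq> 0" using chord_nonzero[OF v, of r s "1 - t" t] t by (simp add: ends_def)
    then have "norm x = 1" "0 < inverse (norm ?v)" using t(3) by (simp_all add: norm_sgn)
    moreover have "x = (inverse (norm ?v) * (1 - t)) *\<^sub>R r + (inverse (norm ?v) * t) *\<^sub>R s"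
      unfolding t(3) sgn_div_norm by (simp add: scaleR_add_right)
    ultimately show "norm x = 1 \<and> (\<exists>\<alpha>>0. \<exists>\<beta>>0. x = \<alpha> *\<^sub>R r + \<beta> *\<^sub>R s)"
      using t by (metis diff_gt_0_iff_gt mult_pos_pos)
  next
    assume "norm x = 1 \<and> (\<exists>\<alpha>>0. \<exists>\<beta>>0. x = \<alpha> *\<^sub>R r + \<beta> *\<^sub>R s)"
    then obtain \<alpha> \<beta> where x: "norm x = 1" "\<alpha> > 0" "\<beta> > 0" "x = \<alpha> *\<^sub>R r + \<beta> *\<^sub>R s" by auto
    define t where "t = \<beta> / (\<alpha> + \<beta>)"
    have t: "0 < t" "t < 1" "(\<alpha> + \<beta>) * (1 - t) = \<alpha>" "(\<alpha> + \<beta>) * t = \<beta>"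
      using x by (auto simp: t_def field_simps)
    have E: "x = (\<alpha> + \<beta>) *\<^sub>R ((1 - t) *\<^sub>R r + t *\<^sub>R s)" unfolding x(4) by (simp add: scaleR_add_right t)
    have "sgn ((1 - t) *\<^sub>R r + t *\<^sub>R s) = x" by (rule sgn_pos_comb[OF x(1) E]) (use x in simp)
    then show "x \<in> arc_relint (r, s)" using t by (auto simp: arc_relint_def)
  qed
  have swap: "(\<exists>\<alpha>>0. \<exists>\<beta>>0. x = \<alpha> *\<^sub>R q + \<beta> *\<^sub>R p) = (\<exists>\<alpha>>0. \<exists>\<beta>>0. x = \<alpha> *\<^sub>R p + \<beta> *\<^sub>R q)"
    by (metis add.commute)
  from assms(2) show ?thesis
    unfolding ends_def using assms(1) main[of p q] main[of q p] swap by (elim disjE) simp_all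
qed

lemma arc_points_comb:
  assumes "valid_arc a" "ends a p q" "norm x = 1" "x = \<alpha> *\<^sub>R p + \<beta> *\<^sub>R q" "0 \<le> \<alpha>" "0 \<le> \<beta>"
  shows "x \<in> arc_points a"
proof -
  have main: "x \<in> arc_points (r, s)" if x: "x = \<alpha> *\<^sub>R r + \<beta> *\<^sub>R s" "0 \<le> \<alpha>" "0 \<le> \<beta>" for r s \<alpha> \<beta>
  proof -
    have pos: "0 < \<alpha> + \<beta>" using x assms(3) by (cases "\<alpha> = 0"; cases "\<beta> = 0") auto
    define t where "t = \<beta> / (\<alpha> + \<beta>)"
    have t: "0 \<le> t" "t \<le> 1" "(\<alpha> + \<beta>) * (1 - t) = \<alpha>" "(\<alpha> + \<beta>) * t = \<beta>"
      using x pos by (auto simp: t_def field_simps)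
    have E: "x = (\<alpha> + \<beta>) *\<^sub>R ((1 - t) *\<^sub>R r + t *\<^sub>R s)" unfolding x(1) by (simp add: scaleR_add_right t)
    have "sgn ((1 - t) *\<^sub>R r + t *\<^sub>R s) = x" by (rule sgn_pos_comb[OF assms(3) E]) (rule pos)
    then show ?thesis using t by (auto simp: arc_points_def)
  qed
  from assms(2) show ?thesis
    unfolding ends_def using assms main[of \<alpha> p \<beta> q] main[of \<beta> q \<alpha> p]
    by (elim disjE) (simp_all add: add.commute)
qed

lemma valid_ends:
  assumes "valid_arc a" "ends a p q" shows "norm p = 1" "norm q = 1" "p \<noteq> q" "p \<noteq> - q" "p \<noteq> 0"
  using assms by (auto simp: valid_arc_def ends_def on_sphere_def)

section \<open>Disjoint cones of a diagram\<close>

locale diagram =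
  fixes D :: "arc set"
  assumes SD: "spherical_diagram D"
begin

lemma finD: "finite D" and neD: "D \<noteq> {}" and valid: "a \<in> D \<Longrightarrow> valid_arc a"
  using SD by (auto simp: spherical_diagram_def)

lemma blocked: "\<lbrakk>a \<in> D; ends a x y\<rbrakk> \<Longrightarrow> \<exists>b\<in>D. x \<in> arc_relint b"
  using SD unfolding spherical_diagram_def ends_def by force

lemma disjoint: "\<lbrakk>a \<in> D; b \<in> D; x \<in> arc_relint a; x \<in> arc_relint b\<rbrakk> \<Longrightarrow> a = b"
  using SD unfolding spherical_diagram_def by blast

text \<open>Normalizing the common vector gives a common interior point of the two arcs.\<close>

lemma cone_disjoint:
  assumes "a \<in> D" "b \<in> D" "ends a p q" "ends b r s"
    and "0 < \<alpha>" "0 < \<beta>" "0 < \<gamma>" "0 < \<delta>" "\<alpha> *\<^sub>R p + \<beta> *\<^sub>R q = \<gamma> *\<^sub>R r + \<delta> *\<^sub>R s"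
  shows "a = b"
proof -
  let ?v = "\<alpha> *\<^sub>R p + \<beta> *\<^sub>R q"
  have "?v \<noteq> 0" using chord_nonzero[OF valid[OF assms(1)] assms(3), of \<alpha> \<beta>] assms by simp
  then have n: "norm (sgn ?v) = 1" "0 < inverse (norm ?v)" by (auto simp: norm_sgn)
  let ?k = "inverse (norm ?v)"
  have "sgn ?v = (?k * \<alpha>) *\<^sub>R p + (?k * \<beta>) *\<^sub>R q" by (simp add: sgn_div_norm scaleR_add_right)
  then have 1: "sgn ?v \<in> arc_relint a"
    using relint_iff[OF valid[OF assms(1)] assms(3)] n assms by (metis mult_pos_pos)
  have "sgn ?v = (?k * \<gamma>) *\<^sub>R r + (?k * \<delta>) *\<^sub>R s"
    unfolding sgn_div_norm by (simp add: assms(9) scaleR_add_right)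
  then have 2: "sgn ?v \<in> arc_relint b"
    using relint_iff[OF valid[OF assms(2)] assms(4)] n assms by (metis mult_pos_pos)
  show ?thesis using disjoint[OF assms(1,2) 1 2] .
qed

lemma relintE:
  assumes "b \<in> D" "x \<in> arc_relint b" "ends b p q"
  obtains \<alpha> \<beta> where "0 < \<alpha>" "0 < \<beta>" "x = \<alpha> *\<^sub>R p + \<beta> *\<^sub>R q"
  using relint_iff[OF valid[OF assms(1)] assms(3)] assms(2) by blast

text \<open>Close to \<open>x\<close> the arc \<open>a\<close> would run inside the cone of
  \<open>b\<close>. Disjointness then gives \<open>a = b\<close>, but an arc does not contain its
  own end in its interior.\<close>

lemma coplanar_touch:
  assumes a: "a \<in> D" "ends a x y" and b: "b \<in> D" "ends b p q" "x \<in> arc_relint b"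
    and y: "y = \<gamma> *\<^sub>R p + \<delta> *\<^sub>R q"
  shows False
proof -
  obtain \<alpha> \<beta> where x: "0 < \<alpha>" "0 < \<beta>" "x = \<alpha> *\<^sub>R p + \<beta> *\<^sub>R q" using relintE[OF b(1,3,2)] .
  \<comment> \<open>Large enough to outweigh the coefficients of \<open>y\<close>, whatever their
    signs.\<close>
  define k where "k = 1 + \<bar>\<gamma>\<bar> / \<alpha> + \<bar>\<delta>\<bar> / \<beta>"
  have k: "0 < k" "0 < k * \<alpha> + \<gamma>" "0 < k * \<beta> + \<delta>"
  proof -
    show "0 < k" using x unfolding k_def by (smt (verit) divide_nonneg_pos)
    have "k * \<alpha> = \<alpha> + \<bar>\<gamma>\<bar> + \<alpha> * (\<bar>\<delta>\<bar> / \<beta>)" using x by (simp add: k_def field_simps)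
    moreover have "0 \<le> \<alpha> * (\<bar>\<delta>\<bar> / \<beta>)" using x by simp
    ultimately show "0 < k * \<alpha> + \<gamma>" using x by linarith
    have "k * \<beta> = \<beta> + \<bar>\<delta>\<bar> + \<beta> * (\<bar>\<gamma>\<bar> / \<alpha>)" using x by (simp add: k_def field_simps)
    moreover have "0 \<le> \<beta> * (\<bar>\<gamma>\<bar> / \<alpha>)" using x by simp
    ultimately show "0 < k * \<beta> + \<delta>" using x by linarith
  qed
  have eq: "k *\<^sub>R x + 1 *\<^sub>R y = (k * \<alpha> + \<gamma>) *\<^sub>R p + (k * \<beta> + \<delta>) *\<^sub>R q"
    using x y by (simp add: algebra_simps)
  have "a = b" using cone_disjoint[OF a(1) b(1) a(2) b(2) k(1) _ k(2,3) eq] by simp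
  then have "(x = p \<and> y = q) \<or> (x = q \<and> y = p)" using a b by (auto simp: ends_def)
  then show False
  proof
    assume "x = p \<and> y = q"
    then have "1 *\<^sub>R p + 0 *\<^sub>R q = \<alpha> *\<^sub>R p + \<beta> *\<^sub>R q" using x by simp
    from comb_unique(2)[OF valid[OF b(1)] b(2) this] x show False by simp
  next
    assume "x = q \<and> y = p"
    then have "0 *\<^sub>R p + 1 *\<^sub>R q = \<alpha> *\<^sub>R p + \<beta> *\<^sub>R q" using x by simp
    from comb_unique(1)[OF valid[OF b(1)] b(2) this] x show False by simp
  qed
qed

end

section \<open>The upper half of a diagram\<close>

lemma coord_zero:
  assumes "triple u w k \<noteq> 0" "x \<bullet> u = 0" "x \<bullet> w = 0" "x \<bullet> k = 0" shows "x = 0"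
proof -
  have "triple u w k *\<^sub>R x = (x \<bullet> u) *\<^sub>R cross3 w k + (x \<bullet> w) *\<^sub>R cross3 k u + (x \<bullet> k) *\<^sub>R cross3 u w"
    unfolding vec_eq_iff forall_3 triple_expand inner_expand cross3_def by (simp add: algebra_simps)
  then show ?thesis using assms by simp
qed

text \<open>\<open>cross3 w N\<close>, \<open>w\<close>, \<open>e\<close> serve as coordinate
  functionals around the axis; the first two vanish on \<open>N\<close>, so moving along the axis
  changes only the value on \<open>e\<close>.\<close>

lemma frame_positive:
  assumes "w \<noteq> 0" "w \<bullet> N = 0" "0 < N \<bullet> e"
  shows "cross3 w N \<bullet> N = 0" "cross3 w N \<bullet> w = 0" "0 < triple (cross3 w N) w e"
proof -
  have "triple (cross3 w N) w e = (w \<bullet> w) * (N \<bullet> e) - (w \<bullet> e) * (w \<bullet> N)"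
    unfolding triple_expand inner_expand cross3_def by (simp add: algebra_simps)
  then show "0 < triple (cross3 w N) w e" using assms by simp
qed (simp_all add: inner_expand cross3_def algebra_simps)

text \<open>Choose \<open>w\<close> orthogonal to the axis and to \<open>c1\<close>; the sign of
  \<open>w\<close> is then free to accommodate \<open>c2\<close>.\<close>

lemma avoid_two:
  fixes N c1 c2 :: point
  obtains w where "w \<noteq> 0" "w \<bullet> N = 0" "c1 \<bullet> w \<le> 0" "c2 \<bullet> w \<le> 0"
proof -
  note goal = that
  have *: thesis if "w \<noteq> 0" "w \<bullet> N = 0" "c1 \<bullet> w = 0" for w
  proof (cases "c2 \<bullet> w \<le> 0")
    case True then show thesis using that goal[of w] by auto
  next
    case False then show thesis using that goal[of "-w"] by auto
  qed
  show thesis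
  proof (cases "cross3 c1 N = 0")
    case False
    then show thesis
      by (intro *[of "cross3 c1 N"]) (simp_all add: inner_expand cross3_def algebra_simps)
  next
    case True
    then have "collinear {0, c1, N}" by (simp add: cross_eq_0)
    then obtain k where k: "c1 = 0 \<or> N = 0 \<or> N = k *\<^sub>R c1" by (auto simp: collinear_lemma)
    obtain w where w: "w \<noteq> 0" "orthogonal (if c1 = 0 then N else c1) w"
      using orthogonal_to_vector_exists[of "if c1 = 0 then N else c1"] by auto
    then show thesis using k by (intro *[of w]) (auto simp: orthogonal_def inner_commute split: if_splits)
  qed
qed

lemma lexmax:
  fixes f g :: "'b \<Rightarrow> real"
  assumes "finite E" "E \<noteq> {}"
  obtains x where "x \<in> E" "\<And>y. y \<in> E \<Longrightarrow> f y \<le> f x" "\<And>y. \<lbrakk>y \<in> E; f y = f x\<rbrakk> \<Longrightarrow> g y \<le> g x"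
proof -
  define E' where "E' = {x \<in> E. f x = Max (f ` E)}"
  have "Max (f ` E) \<in> f ` E" using assms by simp
  then obtain z where "z \<in> E" "f z = Max (f ` E)" by (metis imageE)
  then have E': "finite E'" "E' \<noteq> {}" using assms by (auto simp: E'_def)
  have "Max (g ` E') \<in> g ` E'" using E' by simp
  then obtain x where x: "x \<in> E'" "g x = Max (g ` E')" by auto
  have 1: "f y \<le> f x" if "y \<in> E" for y
    using that x(1) Max_ge[of "f ` E" "f y"] assms by (simp add: E'_def)
  have 2: "g y \<le> g x" if "y \<in> E" "f y = f x" for y
    using that x Max_ge[of "g ` E'" "g y"] E' by (simp add: E'_def)
  have "x \<in> E" using x by (simp add: E'_def)
  then show thesis using that[of x] 1 2 by blast
qed

text \<open>A point inside an arc is not lexicographically larger than both ends of the arc, in the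
  projective coordinates \<open>w / k\<close> and \<open>u / k\<close>.\<close>
lemma no_peak:
  assumes b: "valid_arc b" "ends b p q" and x: "x = \<alpha> *\<^sub>R p + \<beta> *\<^sub>R q" "0 < \<alpha>" "0 < \<beta>"
    and k: "0 < p \<bullet> k" "0 < q \<bullet> k" and ind: "triple u w k \<noteq> 0"
    and le: "\<And>y. y \<in> {p, q} \<Longrightarrow> (y \<bullet> w) / (y \<bullet> k) \<le> (x \<bullet> w) / (x \<bullet> k)"
    and le2: "\<And>y. \<lbrakk>y \<in> {p, q}; (y \<bullet> w) / (y \<bullet> k) = (x \<bullet> w) / (x \<bullet> k)\<rbrakk> \<Longrightarrow> (y \<bullet> u) / (y \<bullet> k) \<le> (x \<bullet> u) / (x \<bullet> k)"
  shows False
proof -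
  have xk: "0 < x \<bullet> k" using x k by (simp add: inner_add_left add_pos_pos)
  have avg: "y \<bullet> v = F * (y \<bullet> k)" if "\<And>z. z \<in> {p, q} \<Longrightarrow> (z \<bullet> v) / (z \<bullet> k) \<le> F" "F = (x \<bullet> v) / (x \<bullet> k)" "y \<in> {p, q}" for y v F
  proof -
    have p: "p \<bullet> v \<le> F * (p \<bullet> k)" "q \<bullet> v \<le> F * (q \<bullet> k)"
      using that(1)[of p] that(1)[of q] k by (simp_all add: pos_divide_le_eq)
    have "F * (x \<bullet> k) = x \<bullet> v" using that(2) xk by simp
    then have "\<alpha> * (F * (p \<bullet> k) - p \<bullet> v) + \<beta> * (F * (q \<bullet> k) - q \<bullet> v) = 0"
      unfolding x by (simp add: inner_add_left algebra_simps)
    moreover have "0 \<le> \<alpha> * (F * (p \<bullet> k) - p \<bullet> v)" "0 \<le> \<beta> * (F * (q \<bullet> k) - q \<bullet> v)" using p x by simp_all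
    ultimately have "\<alpha> * (F * (p \<bullet> k) - p \<bullet> v) = 0" "\<beta> * (F * (q \<bullet> k) - q \<bullet> v) = 0" by linarith+
    then show ?thesis using x that(3) by auto
  qed
  define F G where "F = (x \<bullet> w) / (x \<bullet> k)" and "G = (x \<bullet> u) / (x \<bullet> k)"
  have w: "p \<bullet> w = F * (p \<bullet> k)" "q \<bullet> w = F * (q \<bullet> k)" using avg[of w F] le by (auto simp: F_def)
  then have "(y \<bullet> w) / (y \<bullet> k) = (x \<bullet> w) / (x \<bullet> k)" if "y \<in> {p, q}" for y using that k by (auto simp: F_def)
  then have u: "p \<bullet> u = G * (p \<bullet> k)" "q \<bullet> u = G * (q \<bullet> k)" using avg[of u G] le2 by (auto simp: G_def)
  have "(q \<bullet> k) *\<^sub>R p + (- (p \<bullet> k)) *\<^sub>R q = 0"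
    by (rule coord_zero[OF ind]) (simp_all add: inner_diff_left w u)
  from valid_indep(1)[OF b this] k show False by simp
qed

section \<open>Radial arcs and arcs crossing the equator\<close>

definition radial :: "point \<Rightarrow> arc \<Rightarrow> bool" where
  "radial N a \<longleftrightarrow> triple N (fst a) (snd a) = 0"

text \<open>This is the orientation condition with respect to the pole \<open>N\<close>.\<close>

definition meridian :: "point \<Rightarrow> arc \<Rightarrow> bool" where
  "meridian N a \<longleftrightarrow> radial N a \<and> N \<notin> arc_points a \<and> - N \<notin> arc_points a"

lemma radial_ends: "ends a p q \<Longrightarrow> radial N a \<longleftrightarrow> triple N p q = 0"
  using triple_cong(2)[of N p q] by (auto simp: radial_def ends_def)

text \<open>\<open>N\<close> is the pole off the great circle \<open>e\<^sup>\<bottom>\<close> that carries all other poles: an arc directed by one of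
  the latter does not meet that circle unless it lies on it.\<close>
locale cap = diagram +
  fixes N e :: point
  assumes NN: "norm N = 1" and Ne: "0 < N \<bullet> e"
    and kinds: "a \<in> D \<Longrightarrow> (0 < fst a \<bullet> e \<and> 0 < snd a \<bullet> e) \<or> (fst a \<bullet> e < 0 \<and> snd a \<bullet> e < 0) \<or>
       (fst a \<bullet> e = 0 \<and> snd a \<bullet> e = 0) \<or> meridian N a"
begin

text \<open>Turning the axis over exchanges the hemispheres, so everything about upper arcs
  transfers to lower ones.\<close>

lemma cap_opposite: "cap D (- N) (- e)"
proof
  show "norm (- N) = 1" "0 < - N \<bullet> - e" using NN Ne by simp_all
  fix a assume "a \<in> D"
  then show "(0 < fst a \<bullet> - e \<and> 0 < snd a \<bullet> - e) \<or> (fst a \<bullet> - e < 0 \<and> snd a \<bullet> - e < 0) \<or>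
       (fst a \<bullet> - e = 0 \<and> snd a \<bullet> - e = 0) \<or> meridian (- N) a"
    using kinds[of a] triple_linear(4)[of "-1" N "fst a" "snd a"] by (auto simp: meridian_def radial_def)
qed

definition upper :: "arc \<Rightarrow> bool" where
  "upper a \<longleftrightarrow> a \<in> D \<and> 0 < fst a \<bullet> e \<and> 0 < snd a \<bullet> e"

text \<open>The lower end may lie on the equator itself: what counts is that only one end is
  strictly above.\<close>

definition mixed :: "arc \<Rightarrow> bool" where
  "mixed a \<longleftrightarrow> a \<in> D \<and> (0 < fst a \<bullet> e \<and> snd a \<bullet> e \<le> 0 \<or> fst a \<bullet> e \<le> 0 \<and> 0 < snd a \<bullet> e)"

lemma upperD: "upper a \<Longrightarrow> a \<in> D" "\<lbrakk>upper a; ends a p q\<rbrakk> \<Longrightarrow> 0 < p \<bullet> e"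
  by (auto simp: upper_def ends_def)

lemma mixedI: "\<lbrakk>a \<in> D; \<not> upper a; ends a x y; 0 < x \<bullet> e\<rbrakk> \<Longrightarrow> mixed a"
  by (auto simp: mixed_def upper_def ends_def not_less)

text \<open>As neither \<open>N\<close> nor \<open>- N\<close> is on the arc, the coefficients of
  \<open>N\<close> in terms of the ends have opposite signs. Solving for the lower end shows that
  both ends lie on the same side of the axis.\<close>

lemma mixedE:
  assumes "mixed a"
  obtains t s \<kappa> \<mu> where "ends a t s" "0 < t \<bullet> e" "s \<bullet> e \<le> 0" "s = \<kappa> *\<^sub>R t + \<mu> *\<^sub>R N" "0 < \<kappa>" "\<mu> < 0"
    "a \<in> D" "radial N a"
proof -
  have a: "a \<in> D" and m: "meridian N a" using assms kinds[of a] by (auto simp: mixed_def)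
  obtain t s where ts: "ends a t s" "0 < t \<bullet> e" "s \<bullet> e \<le> 0"
    using assms ends_self[of a] ends_sym[OF ends_self[of a]] unfolding mixed_def by blast
  have r: "radial N a" using m by (simp add: meridian_def)
  then obtain \<alpha> \<beta> where N: "N = \<alpha> *\<^sub>R t + \<beta> *\<^sub>R s"
    using plane_comb[of N t s] valid_cross[OF valid[OF a] ts(1)] radial_ends[OF ts(1)] by metis
  have nN: "norm (- N) = 1" using NN by simp
  have mN: "- N = (- \<alpha>) *\<^sub>R t + (- \<beta>) *\<^sub>R s" unfolding N by simp
  have no: "\<not> (0 \<le> \<alpha> \<and> 0 \<le> \<beta>)" "\<not> (\<alpha> \<le> 0 \<and> \<beta> \<le> 0)"
    using arc_points_comb[OF valid[OF a] ts(1) NN N] arc_points_comb[OF valid[OF a] ts(1) nN mN] m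
    unfolding meridian_def by auto
  then have b: "\<beta> \<noteq> 0" "0 < - \<alpha> / \<beta>" by (auto simp: zero_less_divide_iff divide_less_0_iff)
  have s: "s = (- \<alpha> / \<beta>) *\<^sub>R t + (1 / \<beta>) *\<^sub>R N"
    unfolding N using b(1) by (simp add: scaleR_add_right)
  have "1 / \<beta> < 0"
  proof (rule ccontr)
    assume "\<not> ?thesis"
    then have "0 \<le> 1 / \<beta> * (N \<bullet> e)" using Ne by simp
    moreover have "0 < - \<alpha> / \<beta> * (t \<bullet> e)" using b(2) ts(2) by (rule mult_pos_pos)
    moreover have "s \<bullet> e = - \<alpha> / \<beta> * (t \<bullet> e) + 1 / \<beta> * (N \<bullet> e)" by (subst s) (simp only: inner_add_left inner_scaleR_left)
    ultimately show False using ts(3) by linarith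
  qed
  then show thesis using that[OF ts s b(2) _ a r] by blast
qed

lemma above_kinds:
  assumes "b \<in> D" "x \<in> arc_relint b" "0 < x \<bullet> e" shows "upper b \<or> mixed b"
proof -
  obtain \<alpha> \<beta> where "0 < \<alpha>" "0 < \<beta>" "x = \<alpha> *\<^sub>R fst b + \<beta> *\<^sub>R snd b"
    using relintE[OF assms(1,2) ends_self] .
  then have "0 < \<alpha> * (fst b \<bullet> e) + \<beta> * (snd b \<bullet> e)" "0 < \<alpha>" "0 < \<beta>" using assms(3) by (auto simp: inner_add_left)
  then have "0 < fst b \<bullet> e \<or> 0 < snd b \<bullet> e" by (smt (verit) mult_nonneg_nonpos)
  then show ?thesis using assms(1) by (auto simp: upper_def mixed_def)
qed

text \<open>Both arcs would lie in the plane through the axis and \<open>x\<close>, against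
  \<open>coplanar_touch\<close>.\<close>

lemma radial_touch:
  assumes a: "a \<in> D" "ends a x y" "radial N a" and b: "b \<in> D" "radial N b" "x \<in> arc_relint b"
    and x: "x \<bullet> w \<noteq> 0" "N \<bullet> w = 0"
  shows False
proof -
  obtain p q where pq: "ends b p q" using ends_self by blast
  obtain \<alpha> \<beta> where xb: "x = \<alpha> *\<^sub>R p + \<beta> *\<^sub>R q" using relintE[OF b(1,3) pq] .
  obtain \<gamma> \<delta> where N: "N = \<gamma> *\<^sub>R x + \<delta> *\<^sub>R y"
    using plane_comb[of N x y] valid_cross[OF valid[OF a(1)] a(2)] radial_ends[OF a(2)] a(3) by metis
  obtain \<gamma>' \<delta>' where Nb: "N = \<gamma>' *\<^sub>R p + \<delta>' *\<^sub>R q"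
    using plane_comb[of N p q] valid_cross[OF valid[OF b(1)] pq] radial_ends[OF pq] b(2) by metis
  have "\<delta> \<noteq> 0"
  proof
    assume "\<delta> = 0"
    then have "\<gamma> * (x \<bullet> w) = 0" using N x(2) by (metis add.right_neutral inner_scaleR_left scaleR_zero_left)
    then have "N = 0" using N x(1) \<open>\<delta> = 0\<close> by simp
    then show False using NN by simp
  qed
  have "y = (1 / \<delta>) *\<^sub>R (N - \<gamma> *\<^sub>R x)" using \<open>\<delta> \<noteq> 0\<close> by (subst N) simp
  then have "y = ((\<gamma>' - \<gamma> * \<alpha>) / \<delta>) *\<^sub>R p + ((\<delta>' - \<gamma> * \<beta>) / \<delta>) *\<^sub>R q"
    unfolding xb by (subst (asm) Nb) (simp add: algebra_simps diff_divide_distrib)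
  then show False using coplanar_touch[OF a(1,2) b(1) pq b(3)] by blast
qed

lemma finite_ends: "finite {x. \<exists>a y. P a \<and> a \<in> D \<and> ends a x y}"
  by (rule finite_subset[of _ "fst ` D \<union> snd ` D"]) (use finD in \<open>force simp: ends_def\<close>)+

text \<open>After central projection a lexicographically largest end would lie inside an arc,
  against \<open>no_peak\<close>.\<close>

lemma no_open_hemisphere:
  assumes "\<And>a x y. \<lbrakk>a \<in> D; ends a x y\<rbrakk> \<Longrightarrow> 0 < x \<bullet> k" shows False
proof -
  have "k \<noteq> 0" using neD assms[OF _ ends_self] by force
  obtain w where w: "w \<noteq> 0" "orthogonal k w" using orthogonal_to_vector_exists[of k] by auto
  let ?u = "cross3 w k"
  have u: "0 < triple ?u w k" using frame_positive[of w k k] w \<open>k \<noteq> 0\<close> by (simp add: orthogonal_def inner_commute)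
  define E where "E = {x. \<exists>a y. True \<and> a \<in> D \<and> ends a x y}"
  have fE: "finite E" unfolding E_def by (rule finite_ends)
  obtain a0 where "a0 \<in> D" using neD by blast
  then have "fst a0 \<in> E" unfolding E_def using ends_self by blast
  then have nE: "E \<noteq> {}" by blast
  obtain x where x: "x \<in> E" "\<And>y. y \<in> E \<Longrightarrow> (y \<bullet> w) / (y \<bullet> k) \<le> (x \<bullet> w) / (x \<bullet> k)"
    "\<And>y. \<lbrakk>y \<in> E; (y \<bullet> w) / (y \<bullet> k) = (x \<bullet> w) / (x \<bullet> k)\<rbrakk> \<Longrightarrow> (y \<bullet> ?u) / (y \<bullet> k) \<le> (x \<bullet> ?u) / (x \<bullet> k)"
    by (rule lexmax[OF fE nE, of "\<lambda>y. (y \<bullet> w) / (y \<bullet> k)" "\<lambda>y. (y \<bullet> ?u) / (y \<bullet> k)"]) blast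
  obtain b where b: "b \<in> D" "x \<in> arc_relint b" using x(1) blocked unfolding E_def by blast
  obtain \<alpha> \<beta> where ab: "0 < \<alpha>" "0 < \<beta>" "x = \<alpha> *\<^sub>R fst b + \<beta> *\<^sub>R snd b" using relintE[OF b ends_self] .
  have "fst b \<in> E" "snd b \<in> E" using b(1) ends_self[of b] ends_sym[OF ends_self[of b]] unfolding E_def by blast+
  then show False
    using no_peak[OF valid[OF b(1)] ends_self ab(3,1,2), of k ?u w] x u assms[OF b(1) ends_self] assms[OF b(1) ends_sym[OF ends_self]]
    by auto
qed

lemma off_axis:
  assumes "a \<in> D" "meridian N a" "ends a x y"
  obtains w where "x \<bullet> w \<noteq> 0" "N \<bullet> w = 0"
proof -
  have "x \<noteq> N" "x \<noteq> - N"
    using assms arc_points_comb[OF valid[OF assms(1)] assms(3), of x 1 0] valid_ends[OF valid[OF assms(1)] assms(3)]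
    by (auto simp: meridian_def)
  then have nz: "cross3 x N \<noteq> 0"
    using valid_cross[of "(x, N)" x N] NN valid_ends[OF valid[OF assms(1)] assms(3)]
    by (auto simp: valid_arc_def ends_def on_sphere_def)
  \<comment> \<open>The component of \<open>x\<close> orthogonal to the axis.\<close>
  let ?w = "cross3 N (cross3 x N)"
  have "N \<bullet> ?w = 0" by (simp add: inner_expand cross3_def algebra_simps)
  moreover have "x \<bullet> ?w = cross3 x N \<bullet> cross3 x N"
    by (simp add: inner_expand cross3_def algebra_simps)
  then have "x \<bullet> ?w \<noteq> 0" using nz by simp
  ultimately show thesis using that by blast
qed

lemma mixed_meridian: "mixed a \<Longrightarrow> meridian N a" "mixed a \<Longrightarrow> a \<in> D" "mixed a \<Longrightarrow> radial N a"
  using kinds[of a] by (auto simp: mixed_def meridian_def)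

text \<open>By \<open>radial_touch\<close> the blocker of the upper end is not radial, so it cannot
  cross the equator.\<close>

lemma mixed_top:
  assumes "mixed b" "ends b t s" "0 < t \<bullet> e"
  obtains c p q \<gamma> \<delta> where "upper c" "\<not> radial N c" "t \<in> arc_relint c" "ends c p q" "0 < \<gamma>" "0 < \<delta>" "t = \<gamma> *\<^sub>R p + \<delta> *\<^sub>R q"
proof -
  note b = mixed_meridian[OF assms(1)]
  obtain w where w: "t \<bullet> w \<noteq> 0" "N \<bullet> w = 0" using off_axis[OF b(2,1) assms(2)] .
  obtain c where c: "c \<in> D" "t \<in> arc_relint c" using blocked[OF b(2) assms(2)] by blast
  have nr: "\<not> radial N c" using radial_touch[OF b(2) assms(2) b(3) c(1) _ c(2) w] by blast
  then have "upper c" using above_kinds[OF c assms(3)] mixed_meridian by blast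
  moreover obtain p q where pq: "ends c p q" using ends_self by blast
  moreover obtain \<gamma> \<delta> where "0 < \<gamma>" "0 < \<delta>" "t = \<gamma> *\<^sub>R p + \<delta> *\<^sub>R q" using relintE[OF c pq] .
  ultimately show thesis using that nr c(2) by blast
qed

text \<open>Without upper arcs no end is above the equator, by \<open>mixed_top\<close>. An end on
  the equator would have a blocker inside the equator, itself blocked by another such arc, against
  \<open>coplanar_touch\<close>. What remains is a diagram in an open hemisphere.\<close>

lemma upper_exists: "\<exists>a. upper a"
proof (rule ccontr)
  assume none: "\<nexists>a. upper a"
  have le0: "x \<bullet> e \<le> 0" if a: "a \<in> D" "ends a x y" for a x y
  proof (rule ccontr)
    assume pos: "\<not> ?thesis"
    then have "0 < x \<bullet> e" by simp
    then have "mixed a" using mixedI[OF a(1) _ a(2)] none by blast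
    then show False using mixed_top[OF _ a(2) \<open>0 < x \<bullet> e\<close>] none by blast
  qed
  have "0 < x \<bullet> - e" if a: "a \<in> D" "ends a x y" for a x y
  proof (rule ccontr)
    assume "\<not> ?thesis"
    then have x0: "x \<bullet> e = 0" using le0[OF a] by simp
    have flat: "p \<bullet> e = 0 \<and> q \<bullet> e = 0" if b: "b \<in> D" "ends b p q" "x \<in> arc_relint b" "x \<bullet> e = 0" for b p q x
    proof -
      obtain \<alpha> \<beta> where ab: "0 < \<alpha>" "0 < \<beta>" "x = \<alpha> *\<^sub>R p + \<beta> *\<^sub>R q" using relintE[OF b(1,3,2)] .
      have "\<alpha> * (p \<bullet> e) + \<beta> * (q \<bullet> e) = 0" using ab(3) b(4) by (simp add: inner_add_left)
      moreover have "\<alpha> * (p \<bullet> e) \<le> 0" "\<beta> * (q \<bullet> e) \<le> 0"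
        using le0[OF b(1,2)] le0[OF b(1) ends_sym[OF b(2)]] ab by (auto simp: mult_nonneg_nonpos)
      ultimately have "\<alpha> * (p \<bullet> e) = 0" "\<beta> * (q \<bullet> e) = 0" by linarith+
      then show ?thesis using ab by simp
    qed
    obtain b where b: "b \<in> D" "x \<in> arc_relint b" using blocked[OF a] by blast
    obtain p q where pq: "ends b p q" using ends_self by blast
    have f: "p \<bullet> e = 0" "q \<bullet> e = 0" using flat[OF b(1) pq b(2) x0] by auto
    obtain c where c: "c \<in> D" "p \<in> arc_relint c" using blocked[OF b(1) pq] by blast
    obtain r s where rs: "ends c r s" using ends_self by blast
    have g: "r \<bullet> e = 0" "s \<bullet> e = 0" using flat[OF c(1) rs c(2) f(1)] by auto
    have "triple q r s = 0"
    proof (rule ccontr)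
      assume "triple q r s \<noteq> 0"
      then have "e = 0" by (rule coord_zero) (simp_all add: f g inner_commute[of e])
      then show False using Ne by simp
    qed
    then obtain \<gamma> \<delta> where "q = \<gamma> *\<^sub>R r + \<delta> *\<^sub>R s"
      using plane_comb[of q r s] valid_cross[OF valid[OF c(1)] rs] by metis
    then show False using coplanar_touch[OF b(1) pq c(1) rs c(2)] by blast
  qed
  then show False using no_open_hemisphere[of "- e"] by blast
qed

text \<open>Otherwise take the upper end farthest in direction \<open>w\<close> after projection. An
  upper blocker contradicts \<open>no_peak\<close>. A crossing blocker leads to its top and to the
  non-radial arc there, whose ends are not farther; this forces that arc into the plane orthogonal
  to \<open>w\<close>, which contains the axis.\<close>

lemma upper_end_in_half:
  assumes w: "w \<noteq> 0" "w \<bullet> N = 0"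
  obtains a x y where "upper a" "ends a x y" "0 < x \<bullet> w"
proof -
  have "\<exists>a x y. upper a \<and> ends a x y \<and> 0 < x \<bullet> w"
  proof (rule ccontr)
    assume none: "\<not> ?thesis"
    let ?u = "cross3 w N"
    note fr = frame_positive[OF w Ne]
    have nw: "N \<bullet> w = 0" using w(2) by (simp add: inner_commute)
    define E where "E = {x. \<exists>a y. upper a \<and> a \<in> D \<and> ends a x y}"
    have fE: "finite E" unfolding E_def by (rule finite_ends)
    obtain a0 where "upper a0" using upper_exists by blast
    then have "fst a0 \<in> E" unfolding E_def using ends_self upperD(1) by blast
    then have nE: "E \<noteq> {}" by blast
    have Ee: "0 < x \<bullet> e" "x \<bullet> w \<le> 0" if "x \<in> E" for x
      using that none upperD(2) unfolding E_def by (blast, force)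
    obtain x where x: "x \<in> E" "\<And>y. y \<in> E \<Longrightarrow> (y \<bullet> w) / (y \<bullet> e) \<le> (x \<bullet> w) / (x \<bullet> e)"
      "\<And>y. \<lbrakk>y \<in> E; (y \<bullet> w) / (y \<bullet> e) = (x \<bullet> w) / (x \<bullet> e)\<rbrakk> \<Longrightarrow> (y \<bullet> ?u) / (y \<bullet> e) \<le> (x \<bullet> ?u) / (x \<bullet> e)"
      by (rule lexmax[OF fE nE, of "\<lambda>y. (y \<bullet> w) / (y \<bullet> e)" "\<lambda>y. (y \<bullet> ?u) / (y \<bullet> e)"]) blast
    obtain b where b: "b \<in> D" "x \<in> arc_relint b" using x(1) blocked unfolding E_def by blast
    have inE: "p \<in> E" "q \<in> E" if "upper c" "ends c p q" for c p q
      using that upperD(1) ends_sym unfolding E_def by blast+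
    show False
    proof (cases "upper b")
      case True
      obtain \<alpha> \<beta> where ab: "0 < \<alpha>" "0 < \<beta>" "x = \<alpha> *\<^sub>R fst b + \<beta> *\<^sub>R snd b" using relintE[OF b ends_self] .
      show False
        using no_peak[OF valid[OF b(1)] ends_self ab(3,1,2), of e ?u w] x fr inE[OF True ends_self] Ee by auto
    next
      case False
      then have mb: "mixed b" using above_kinds[OF b] Ee[OF x(1)] by auto
      then obtain t s \<kappa> \<mu> where ts: "ends b t s" "0 < t \<bullet> e" "s \<bullet> e \<le> 0" "s = \<kappa> *\<^sub>R t + \<mu> *\<^sub>R N" "0 < \<kappa>" "\<mu> < 0"
        by (rule mixedE)
      obtain \<alpha> \<beta> where ab: "0 < \<alpha>" "0 < \<beta>" "x = \<alpha> *\<^sub>R t + \<beta> *\<^sub>R s" using relintE[OF b ts(1)] .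
      have xt: "x = (\<alpha> + \<beta> * \<kappa>) *\<^sub>R t + (\<beta> * \<mu>) *\<^sub>R N" unfolding ab ts(4) by (simp add: algebra_simps)
      have k: "0 < \<alpha> + \<beta> * \<kappa>" "\<beta> * \<mu> < 0" using ab ts by (auto simp: add_pos_pos mult_pos_neg)
      obtain c p q \<gamma> \<delta> where c: "upper c" "\<not> radial N c" "ends c p q" "0 < \<gamma>" "0 < \<delta>" "t = \<gamma> *\<^sub>R p + \<delta> *\<^sub>R q"
        by (rule mixed_top[OF mb ts(1,2)]) blast
      have pq: "p \<in> E" "q \<in> E" using inE[OF c(1,3)] .
      have kt: "x \<bullet> w = (\<alpha> + \<beta> * \<kappa>) * (t \<bullet> w)" "x \<bullet> e = (\<alpha> + \<beta> * \<kappa>) * (t \<bullet> e) + \<beta> * \<mu> * (N \<bullet> e)"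
        unfolding xt using nw by (simp_all add: inner_add_left)
      define F where "F = (x \<bullet> w) / (x \<bullet> e)"
      have F: "F \<le> 0" "F * (x \<bullet> e) = x \<bullet> w" using Ee[OF x(1)] by (auto simp: F_def divide_nonpos_pos)
      have "p \<bullet> w \<le> F * (p \<bullet> e)" "q \<bullet> w \<le> F * (q \<bullet> e)"
        using x(2)[OF pq(1)] x(2)[OF pq(2)] Ee(1)[OF pq(1)] Ee(1)[OF pq(2)] by (simp_all add: F_def[symmetric] pos_divide_le_eq)
      then have "\<gamma> * (p \<bullet> w) + \<delta> * (q \<bullet> w) \<le> \<gamma> * (F * (p \<bullet> e)) + \<delta> * (F * (q \<bullet> e))"
        using c(4,5) by (intro add_mono mult_left_mono) auto
      then have "t \<bullet> w \<le> F * (t \<bullet> e)" unfolding c(6) by (simp add: inner_add_left algebra_simps)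
      then have "(\<alpha> + \<beta> * \<kappa>) * (t \<bullet> w) \<le> (\<alpha> + \<beta> * \<kappa>) * (F * (t \<bullet> e))" using k(1) by (intro mult_left_mono) auto
      \<comment> \<open>\<open>F\<close> is at most 0 and the other factor negative, so
        \<open>F = 0\<close>.\<close>
      then have "F * (\<beta> * \<mu> * (N \<bullet> e)) \<le> 0" using F(2) unfolding kt by (simp add: algebra_simps)
      moreover have "\<beta> * \<mu> * (N \<bullet> e) < 0" using k(2) Ne by (simp add: mult_neg_pos)
      ultimately have "F = 0" using F(1) by (simp add: mult_le_0_iff)
      then have "t \<bullet> w = 0" using F(2) kt(1) k(1) by auto
      then have "\<gamma> * (p \<bullet> w) + \<delta> * (q \<bullet> w) = 0" using c(6) by (simp add: inner_add_left)
      moreover have "\<gamma> * (p \<bullet> w) \<le> 0" "\<delta> * (q \<bullet> w) \<le> 0"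
        using Ee(2)[OF pq(1)] Ee(2)[OF pq(2)] c(4,5) by (auto simp: mult_nonneg_nonpos)
      ultimately have "\<gamma> * (p \<bullet> w) = 0" "\<delta> * (q \<bullet> w) = 0" by linarith+
      then have pw: "w \<bullet> p = 0" "w \<bullet> q = 0" using c(4,5) by (auto simp: inner_commute)
      have "triple N p q \<noteq> 0" using c(2) radial_ends[OF c(3)] by simp
      then have "w = 0" by (rule coord_zero) (use pw w in simp_all)
      then show False using w by simp
    qed
  qed
  then show thesis using that by blast
qed

text \<open>Among the upper ends in the open half-space take the lowest after projection. An upper
  arc through it would have an end that is lower or contradict \<open>no_peak\<close>, so its
  blocker crosses the equator.\<close>

lemma mixed_in_half:
  assumes w: "w \<noteq> 0" "w \<bullet> N = 0"
  obtains b t s where "mixed b" "ends b t s" "0 < t \<bullet> e" "s \<bullet> e \<le> 0" "0 < t \<bullet> w"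
proof -
  let ?u = "cross3 w N"
  note fr = frame_positive[OF w Ne]
  have tr: "triple ?u e w \<noteq> 0" using fr(3) triple_cong(2)[of ?u e w] by simp
  define E where "E = {x. \<exists>a y. upper a \<and> a \<in> D \<and> ends a x y} \<inter> {x. 0 < x \<bullet> w}"
  have fE: "finite E" unfolding E_def by (intro finite_Int disjI1 finite_ends)
  obtain a0 x0 y0 where "upper a0" "ends a0 x0 y0" "0 < x0 \<bullet> w" using upper_end_in_half[OF w] .
  then have "x0 \<in> E" using upperD(1) unfolding E_def by blast
  then have nE: "E \<noteq> {}" by blast
  have Ee: "0 < x \<bullet> e" "0 < x \<bullet> w" if "x \<in> E" for x
    using that upperD(2) unfolding E_def by blast+
  obtain x where x: "x \<in> E" "\<And>y. y \<in> E \<Longrightarrow> (y \<bullet> - e) / (y \<bullet> w) \<le> (x \<bullet> - e) / (x \<bullet> w)"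
    "\<And>y. \<lbrakk>y \<in> E; (y \<bullet> - e) / (y \<bullet> w) = (x \<bullet> - e) / (x \<bullet> w)\<rbrakk> \<Longrightarrow> (y \<bullet> ?u) / (y \<bullet> w) \<le> (x \<bullet> ?u) / (x \<bullet> w)"
    by (rule lexmax[OF fE nE, of "\<lambda>y. (y \<bullet> - e) / (y \<bullet> w)" "\<lambda>y. (y \<bullet> ?u) / (y \<bullet> w)"]) blast
  obtain b where b: "b \<in> D" "x \<in> arc_relint b" using x(1) blocked unfolding E_def by blast
  have "\<not> upper b"
  proof
    assume ub: "upper b"
    \<comment> \<open>If one end of \<open>b\<close> were outside the half-space, the other would be
      strictly lower than \<open>x\<close>.\<close>
    have bad: False if pq: "ends b p q" "q \<bullet> w \<le> 0" for p q
    proof -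
      obtain \<alpha> \<beta> where ab: "0 < \<alpha>" "0 < \<beta>" "x = \<alpha> *\<^sub>R p + \<beta> *\<^sub>R q" using relintE[OF b pq(1)] .
      have xw: "x \<bullet> w = \<alpha> * (p \<bullet> w) + \<beta> * (q \<bullet> w)" and xe: "x \<bullet> e = \<alpha> * (p \<bullet> e) + \<beta> * (q \<bullet> e)"
        using ab by (simp_all add: inner_add_left)
      have "\<beta> * (q \<bullet> w) \<le> 0" using ab pq by (simp add: mult_nonneg_nonpos)
      then have "0 < \<alpha> * (p \<bullet> w)" using xw Ee(2)[OF x(1)] by linarith
      then have pw: "0 < p \<bullet> w" using ab by (simp add: zero_less_mult_iff)
      then have "p \<in> E" using ub pq(1) upperD(1) unfolding E_def by blast
      then have "(x \<bullet> e) / (x \<bullet> w) \<le> (p \<bullet> e) / (p \<bullet> w)" using x(2)[of p] by simp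
      then have "(x \<bullet> e) * (p \<bullet> w) \<le> (p \<bullet> e) * (x \<bullet> w)" using pw Ee(2)[OF x(1)] by (simp add: divide_simps mult.commute)
      also have "\<dots> \<le> (p \<bullet> e) * (\<alpha> * (p \<bullet> w))"
        using xw \<open>\<beta> * (q \<bullet> w) \<le> 0\<close> upperD(2)[OF ub pq(1)] by (intro mult_left_mono) auto
      finally have "\<beta> * (q \<bullet> e) * (p \<bullet> w) \<le> 0" unfolding xe by (simp add: algebra_simps)
      moreover have "0 < \<beta> * (q \<bullet> e) * (p \<bullet> w)" using ab pw upperD(2)[OF ub ends_sym[OF pq(1)]] by simp
      ultimately show False by simp
    qed
    obtain \<alpha> \<beta> where ab: "0 < \<alpha>" "0 < \<beta>" "x = \<alpha> *\<^sub>R fst b + \<beta> *\<^sub>R snd b" using relintE[OF b ends_self] .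
    have k: "0 < fst b \<bullet> w" "0 < snd b \<bullet> w" using bad[OF ends_self] bad[OF ends_sym[OF ends_self]] by (auto simp: not_le[symmetric])
    then have "fst b \<in> E" "snd b \<in> E"
      using ub upperD(1) ends_self[of b] ends_sym[OF ends_self[of b]] unfolding E_def by blast+
    then show False
      using no_peak[OF valid[OF b(1)] ends_self ab(3,1,2) k, of ?u "- e"] x tr triple_linear(5)[of ?u "-1" e w] by auto
  qed
  then have mb: "mixed b" using above_kinds[OF b] Ee(1)[OF x(1)] by auto
  then obtain t s \<kappa> \<mu> where ts: "ends b t s" "0 < t \<bullet> e" "s \<bullet> e \<le> 0" "s = \<kappa> *\<^sub>R t + \<mu> *\<^sub>R N" "0 < \<kappa>" "\<mu> < 0"
    by (rule mixedE)
  obtain \<alpha> \<beta> where ab: "0 < \<alpha>" "0 < \<beta>" "x = \<alpha> *\<^sub>R t + \<beta> *\<^sub>R s" using relintE[OF b ts(1)] .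
  have "N \<bullet> w = 0" using w(2) by (simp add: inner_commute)
  then have "x \<bullet> w = (\<alpha> + \<beta> * \<kappa>) * (t \<bullet> w)" unfolding ab ts(4) by (simp add: algebra_simps inner_add_left)
  moreover have "0 < \<alpha> + \<beta> * \<kappa>" using ab ts by (auto simp: add_pos_pos)
  ultimately have "0 < t \<bullet> w" using Ee(2)[OF x(1)] by (simp add: zero_less_mult_iff)
  then show thesis using that[OF mb ts(1-3)] by blast
qed

end

section \<open>Counting arcs\<close>

context cap begin

lemma N_nonzero: "N \<noteq> 0" using NN by auto

lemma cross_axis: "\<lbrakk>x \<bullet> w \<noteq> 0; N \<bullet> w = 0\<rbrakk> \<Longrightarrow> cross3 x N \<noteq> 0"
proof
  assume w: "x \<bullet> w \<noteq> 0" "N \<bullet> w = 0" and "cross3 x N = 0"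
  then have "collinear {0, N, x}" using cross_eq_0[of x N] by (simp add: insert_commute)
  then obtain c where "N = 0 \<or> x = 0 \<or> x = c *\<^sub>R N" by (auto simp: collinear_lemma)
  then show False using w N_nonzero by auto
qed

lemma nonradial_indep:
  assumes "\<not> radial N b" "ends b p q" "\<alpha> *\<^sub>R p + \<beta> *\<^sub>R q + m *\<^sub>R N = 0"
  shows "\<alpha> = 0" "\<beta> = 0" "m = 0"
proof -
  have t: "triple N p q \<noteq> 0" using assms(1,2) radial_ends by blast
  have "triple (\<alpha> *\<^sub>R p + \<beta> *\<^sub>R q + m *\<^sub>R N) p q = 0" "triple N (\<alpha> *\<^sub>R p + \<beta> *\<^sub>R q + m *\<^sub>R N) q = 0"
    "triple N p (\<alpha> *\<^sub>R p + \<beta> *\<^sub>R q + m *\<^sub>R N) = 0"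
    unfolding assms(3) by (simp_all add: triple_expand)
  moreover have "triple q p q = 0" "triple N p p = 0" by simp_all
  ultimately have "m * triple N p q = 0" "\<alpha> * triple N p q = 0" "\<beta> * triple N p q = 0" by simp_all
  then show "\<alpha> = 0" "\<beta> = 0" "m = 0" using t by simp_all
qed

lemma nonradial_off_axis:
  assumes "\<not> radial N b" "ends b p q"
  shows "cross3 p N \<noteq> 0"
proof
  assume "cross3 p N = 0"
  then have "triple N p q = 0"
    using triple_cong(2,3)[of N p q] triple_cong(3)[of p q N] by (metis add.inverse_neutral cross_skew inner_zero_right triple_cong(3) triple_def)
  then show False using assms radial_ends by blast
qed

section \<open>Longitudes around the axis\<close>

text \<open>Seen from the axis \<open>N\<close>, the arc \<open>b\<close> passes through the direction of \<open>y\<close>.\<close>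
definition covers :: "arc \<Rightarrow> point \<Rightarrow> bool" where
  "covers b y \<longleftrightarrow> (\<exists>\<alpha>>0. \<exists>\<beta>>0. \<exists>m. y = \<alpha> *\<^sub>R fst b + \<beta> *\<^sub>R snd b + m *\<^sub>R N)"

lemma coversI:
  assumes "ends b p q" "y = \<alpha> *\<^sub>R p + \<beta> *\<^sub>R q + m *\<^sub>R N" "0 < \<alpha>" "0 < \<beta>"
  shows "covers b y"
proof -
  from assms(1) consider "b = (p, q)" | "b = (q, p)" by (auto simp: ends_def)
  then show ?thesis
  proof cases
    case 1 then show ?thesis using assms unfolding covers_def 1 fst_conv snd_conv by blast
  next
    case 2
    have "y = \<beta> *\<^sub>R q + \<alpha> *\<^sub>R p + m *\<^sub>R N" using assms(2) by simp
    then show ?thesis using assms(3,4) unfolding covers_def 2 fst_conv snd_conv by blast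
  qed
qed

lemma coversE:
  assumes "covers b y" "ends b p q"
  obtains \<alpha> \<beta> m where "y = \<alpha> *\<^sub>R p + \<beta> *\<^sub>R q + m *\<^sub>R N" "0 < \<alpha>" "0 < \<beta>"
proof -
  obtain \<alpha> \<beta> m where y: "y = \<alpha> *\<^sub>R fst b + \<beta> *\<^sub>R snd b + m *\<^sub>R N" "0 < \<alpha>" "0 < \<beta>"
    using assms(1) unfolding covers_def by blast
  from assms(2) consider "b = (p, q)" | "b = (q, p)" by (auto simp: ends_def)
  then show thesis
  proof cases
    case 1
    have "y = \<alpha> *\<^sub>R p + \<beta> *\<^sub>R q + m *\<^sub>R N" using y 1 by simp
    then show thesis using that y by blast
  next
    case 2
    have "y = \<beta> *\<^sub>R p + \<alpha> *\<^sub>R q + m *\<^sub>R N" using y 2 by simp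
    then show thesis using that y by blast
  qed
qed

text \<open>The directions covered by one arc form a convex cone, insensitive to shifts along the
  axis.\<close>

lemma covers_comb:
  assumes "covers b x" "covers b y" "0 < k" "0 < l" shows "covers b (k *\<^sub>R x + l *\<^sub>R y + m *\<^sub>R N)"
proof -
  obtain \<alpha> \<beta> n where 1: "x = \<alpha> *\<^sub>R fst b + \<beta> *\<^sub>R snd b + n *\<^sub>R N" "0 < \<alpha>" "0 < \<beta>"
    using coversE[OF assms(1) ends_self] .
  obtain \<gamma> \<delta> n' where 2: "y = \<gamma> *\<^sub>R fst b + \<delta> *\<^sub>R snd b + n' *\<^sub>R N" "0 < \<gamma>" "0 < \<delta>"
    using coversE[OF assms(2) ends_self] .
  have "k *\<^sub>R x + l *\<^sub>R y + m *\<^sub>R N = (k * \<alpha> + l * \<gamma>) *\<^sub>R fst b + (k * \<beta> + l * \<delta>) *\<^sub>R snd b + (k * n + l * n' + m) *\<^sub>R N"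
    unfolding 1(1) 2(1) by (simp add: algebra_simps)
  then show ?thesis by (rule coversI[OF ends_self]) (use 1 2 assms in \<open>simp_all add: add_pos_pos\<close>)
qed

lemma covers_shift:
  assumes "covers b x" "0 < k" shows "covers b (k *\<^sub>R x + m *\<^sub>R N)"
proof -
  have "k *\<^sub>R x + m *\<^sub>R N = (k / 2) *\<^sub>R x + (k / 2) *\<^sub>R x + m *\<^sub>R N" by (simp add: scaleR_add_left[symmetric])
  then show ?thesis using covers_comb[OF assms(1,1), of "k/2" "k/2" m] assms(2) by simp
qed

text \<open>The ends bound the open range of longitudes of the arc, and this range is shorter than a
  half-turn.\<close>

lemma covers_own_end:
  assumes "\<not> radial N a" "ends a p q" "k = 1 \<or> k = - 1" shows "\<not> covers a (k *\<^sub>R p)"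
proof
  assume "covers a (k *\<^sub>R p)"
  then obtain \<alpha> \<beta> m where c: "k *\<^sub>R p = \<alpha> *\<^sub>R p + \<beta> *\<^sub>R q + m *\<^sub>R N" "0 < \<beta>" using coversE[OF _ assms(2)] by metis
  then have "(\<alpha> - k) *\<^sub>R p + \<beta> *\<^sub>R q + m *\<^sub>R N = 0" by (simp add: algebra_simps)
  from nonradial_indep(2)[OF assms(1,2) this] c(2) show False by simp
qed

lemma covers_opposite:
  assumes "\<not> radial N a" "covers a y" "covers a (- y)" shows False
proof -
  obtain \<alpha> \<beta> n where 1: "y + - y = \<alpha> *\<^sub>R fst a + \<beta> *\<^sub>R snd a + n *\<^sub>R N" "0 < \<alpha>"
    using covers_comb[OF assms(2,3), of 1 1 0] coversE[OF _ ends_self] by (metis add.right_neutral scaleR_one scaleR_zero_left zero_less_one)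
  then have "\<alpha> *\<^sub>R fst a + \<beta> *\<^sub>R snd a + n *\<^sub>R N = 0" by simp
  from nonradial_indep(1)[OF assms(1) ends_self this] 1(2) show False by simp
qed

text \<open>The endpoint of an upper arc lies on a non-radial upper arc, or below one on the same meridian.\<close>
lemma end_covered:
  assumes a: "upper a" "ends a x x'" and w: "0 < x \<bullet> w" "N \<bullet> w = 0"
  obtains b where "upper b" "\<not> radial N b" "covers b x"
proof -
  obtain b0 where b0: "b0 \<in> D" "x \<in> arc_relint b0" using blocked upperD(1)[OF a(1)] a(2) by blast
  have xe: "0 < x \<bullet> e" using upperD(2)[OF a] .
  show thesis
  proof (cases "radial N b0")
    case False
    then have "upper b0" using above_kinds[OF b0 xe] mixed_meridian by blast
    moreover obtain \<alpha> \<beta> where "0 < \<alpha>" "0 < \<beta>" "x = \<alpha> *\<^sub>R fst b0 + \<beta> *\<^sub>R snd b0" using relintE[OF b0 ends_self] .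
    then have "covers b0 x" by (intro coversI[OF ends_self, where \<alpha> = \<alpha> and \<beta> = \<beta> and m = 0]) auto
    ultimately show thesis using that False by blast
  next
    case True
    \<comment> \<open>On a radial blocker pass to its end \<open>o1\<close> on the same side of the
      axis: it has the longitude of \<open>x\<close>, and by \<open>radial_touch\<close> its own
      blocker is not radial.\<close>
    have "\<exists>o1 o2. ends b0 o1 o2 \<and> 0 < o1 \<bullet> w \<and> 0 < o1 \<bullet> e"
      using above_kinds[OF b0 xe]
    proof
      assume u: "upper b0"
      obtain \<alpha> \<beta> where ab: "0 < \<alpha>" "0 < \<beta>" "x = \<alpha> *\<^sub>R fst b0 + \<beta> *\<^sub>R snd b0" using relintE[OF b0 ends_self] .
      have "0 < \<alpha> * (fst b0 \<bullet> w) + \<beta> * (snd b0 \<bullet> w)" using w ab by (simp add: inner_add_left)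
      then have "0 < fst b0 \<bullet> w \<or> 0 < snd b0 \<bullet> w" using ab by (smt (verit) mult_nonneg_nonpos)
      then show ?thesis using upperD(2)[OF u] ends_self[of b0] ends_sym[OF ends_self[of b0]] by blast
    next
      assume "mixed b0"
      then obtain t s \<kappa> \<mu> where ts: "ends b0 t s" "0 < t \<bullet> e" "s = \<kappa> *\<^sub>R t + \<mu> *\<^sub>R N" "0 < \<kappa>"
        by (rule mixedE)
      obtain \<alpha> \<beta> where ab: "0 < \<alpha>" "0 < \<beta>" "x = \<alpha> *\<^sub>R t + \<beta> *\<^sub>R s" using relintE[OF b0 ts(1)] .
      have "x \<bullet> w = (\<alpha> + \<beta> * \<kappa>) * (t \<bullet> w)" unfolding ab ts(3) using w by (simp add: inner_add_left algebra_simps)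
      moreover have "0 < \<alpha> + \<beta> * \<kappa>" using ab ts by (simp add: add_pos_pos)
      ultimately have "0 < t \<bullet> w" using w by (simp add: zero_less_mult_iff)
      then show ?thesis using ts by blast
    qed
    then obtain o1 o2 where o: "ends b0 o1 o2" "0 < o1 \<bullet> w" "0 < o1 \<bullet> e" by blast
    obtain \<alpha> \<beta> where ab: "0 < \<alpha>" "0 < \<beta>" "x = \<alpha> *\<^sub>R o1 + \<beta> *\<^sub>R o2" using relintE[OF b0 o(1)] .
    have "triple o1 x N = 0"
      using True radial_ends[OF o(1)] triple_cong(3)[of N o1 o2] unfolding ab by simp
    moreover have "cross3 x N \<noteq> 0" using cross_axis[of x w] w by simp
    ultimately obtain k m where km: "o1 = k *\<^sub>R x + m *\<^sub>R N" using plane_comb by metis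
    then have "o1 \<bullet> w = k * (x \<bullet> w)" using w by (simp add: inner_add_left)
    then have k: "0 < k" using o w by (simp add: zero_less_mult_iff)
    obtain c where c: "c \<in> D" "o1 \<in> arc_relint c" using blocked[OF b0(1) o(1)] by blast
    have "o1 \<bullet> w \<noteq> 0" using o by simp
    then have nr: "\<not> radial N c" using radial_touch[OF b0(1) o(1) True c(1) _ c(2)] w by blast
    then have u: "upper c" using above_kinds[OF c o(3)] mixed_meridian by blast
    obtain \<gamma> \<delta> where gd: "0 < \<gamma>" "0 < \<delta>" "o1 = \<gamma> *\<^sub>R fst c + \<delta> *\<^sub>R snd c" using relintE[OF c ends_self] .
    then have "covers c o1" by (intro coversI[OF ends_self, where \<alpha> = \<gamma> and \<beta> = \<delta> and m = 0]) auto
    from covers_shift[OF this, of "1 / k" "- m / k"] k have "covers c ((1 / k) *\<^sub>R o1 + (- m / k) *\<^sub>R N)" by simp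
    moreover have "(1 / k) *\<^sub>R o1 + (- m / k) *\<^sub>R N = x" unfolding km using k by (simp add: scaleR_add_right)
    ultimately show thesis using that u nr by simp
  qed
qed

text \<open>Both vectors lie in one half-plane bounded by the axis. The ratio of their components
  along \<open>cross3 w N\<close> gives the factor, and the difference is a multiple of
  \<open>N\<close>.\<close>

lemma same_direction:
  assumes w: "w \<noteq> 0" "w \<bullet> N = 0" and z: "z \<bullet> w = 0" "0 < z \<bullet> cross3 w N" and y: "y \<bullet> w = 0" "0 < y \<bullet> cross3 w N"
  obtains k m where "0 < k" "y = k *\<^sub>R z + m *\<^sub>R N"
proof -
  let ?u = "cross3 w N"
  note fr = frame_positive[OF w Ne]
  have nu: "N \<bullet> ?u = 0" "N \<bullet> w = 0" using fr(1) w(2) by (simp_all add: inner_commute)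
  define c where "c = (y \<bullet> ?u) / (z \<bullet> ?u)"
  define m where "m = (y \<bullet> e - c * (z \<bullet> e)) / (N \<bullet> e)"
  have "y - (c *\<^sub>R z + m *\<^sub>R N) = 0"
  proof (rule coord_zero[of ?u w e])
    show "triple ?u w e \<noteq> 0" using fr by simp
    show "(y - (c *\<^sub>R z + m *\<^sub>R N)) \<bullet> ?u = 0" using z nu by (simp add: inner_diff_left inner_add_left c_def)
    show "(y - (c *\<^sub>R z + m *\<^sub>R N)) \<bullet> w = 0" using z y nu by (simp add: inner_diff_left inner_add_left)
    show "(y - (c *\<^sub>R z + m *\<^sub>R N)) \<bullet> e = 0" using Ne by (simp add: inner_diff_left inner_add_left m_def)
  qed
  moreover have "0 < c" using y z by (simp add: c_def)
  ultimately show thesis using that[of c m] by simp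
qed

text \<open>On one side of the meridian plane of \<open>y\<close> take the upper end nearest to
  \<open>y\<close> in longitude. The arc covering it must reach \<open>y\<close>: it passes there,
  or it ends there and the arc covering that end is taken.\<close>

lemma direction_covered:
  assumes y: "cross3 y N \<noteq> 0"
  obtains b where "upper b" "\<not> radial N b" "covers b y"
proof -
  note goal = that
  \<comment> \<open>\<open>w\<close> vanishes on \<open>y\<close> and on the axis while
    \<open>y\<close> is positive on \<open>?u\<close>, so the largest quotient \<open>u / w\<close>
    means nearest to \<open>y\<close>.\<close>
  define w where "w = cross3 N y"
  let ?u = "cross3 w N"
  have w: "w \<noteq> 0" "w \<bullet> N = 0" "y \<bullet> w = 0"
    using y cross_skew[of N y] by (auto simp: w_def inner_expand cross3_def algebra_simps)
  have "y \<bullet> ?u = w \<bullet> w" by (simp add: w_def inner_expand cross3_def algebra_simps)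
  then have yu: "0 < y \<bullet> ?u" using w by simp
  note fr = frame_positive[OF w(1,2) Ne]
  have nu: "N \<bullet> ?u = 0" "N \<bullet> w = 0" using fr(1) w(2) by (simp_all add: inner_commute)
  define E where "E = {x. \<exists>a y. upper a \<and> a \<in> D \<and> ends a x y} \<inter> {x. 0 < x \<bullet> w}"
  have fE: "finite E" unfolding E_def by (intro finite_Int disjI1 finite_ends)
  obtain a0 x0 y0 where "upper a0" "ends a0 x0 y0" "0 < x0 \<bullet> w" using upper_end_in_half[OF w(1,2)] .
  then have "x0 \<in> E" using upperD(1) unfolding E_def by blast
  then have nE: "E \<noteq> {}" by blast
  obtain x where x: "x \<in> E" "\<And>y. y \<in> E \<Longrightarrow> (y \<bullet> ?u) / (y \<bullet> w) \<le> (x \<bullet> ?u) / (x \<bullet> w)"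
    by (rule lexmax[OF fE nE, of "\<lambda>y. (y \<bullet> ?u) / (y \<bullet> w)" "\<lambda>y. 0"]) blast
  obtain a x' where a: "upper a" "ends a x x'" and xw: "0 < x \<bullet> w" using x(1) unfolding E_def by blast
  obtain b where b: "upper b" "\<not> radial N b" "covers b x" using end_covered[OF a xw nu(2)] .
  define F where "F = (x \<bullet> ?u) / (x \<bullet> w)"
  have le: "z \<bullet> ?u \<le> F * (z \<bullet> w)" if "ends b z z'" "0 < z \<bullet> w" for z z'
  proof -
    have "z \<in> E" using that b upperD(1) unfolding E_def by blast
    from x(2)[OF this] show ?thesis using that by (simp add: F_def pos_divide_le_eq)
  qed
  have comb: "\<alpha> * (p \<bullet> ?u) + \<beta> * (q \<bullet> ?u) = F * (x \<bullet> w)" "\<alpha> * (p \<bullet> w) + \<beta> * (q \<bullet> w) = x \<bullet> w"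
    if "x = \<alpha> *\<^sub>R p + \<beta> *\<^sub>R q + m *\<^sub>R N" for \<alpha> \<beta> m p q
  proof -
    show "\<alpha> * (p \<bullet> w) + \<beta> * (q \<bullet> w) = x \<bullet> w" unfolding that using nu by (simp add: inner_add_left)
    have "F * (x \<bullet> w) = x \<bullet> ?u" using xw by (simp add: F_def)
    then show "\<alpha> * (p \<bullet> ?u) + \<beta> * (q \<bullet> ?u) = F * (x \<bullet> w)" unfolding that using nu by (simp add: inner_add_left)
  qed
  \<comment> \<open>Two ends of the same extreme longitude would make the arc radial.\<close>
  have not_both: False
    if "ends b p q" "p \<bullet> ?u = F * (p \<bullet> w)" "q \<bullet> ?u = F * (q \<bullet> w)" "0 < p \<bullet> w" for p q
  proof -
    define v where "v = (q \<bullet> w) *\<^sub>R p - (p \<bullet> w) *\<^sub>R q"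
    have "(N \<bullet> e) *\<^sub>R v - (v \<bullet> e) *\<^sub>R N = 0"
      by (rule coord_zero[of ?u w e]) (use fr nu that in \<open>simp_all add: v_def inner_diff_left\<close>)
    then have "((N \<bullet> e) * (q \<bullet> w)) *\<^sub>R p + (- ((N \<bullet> e) * (p \<bullet> w))) *\<^sub>R q + (- (v \<bullet> e)) *\<^sub>R N = 0"
      unfolding v_def by (simp add: algebra_simps)
    from nonradial_indep(2)[OF b(2) that(1) this] show False using that Ne by simp
  qed
  have main: thesis if pq: "ends b p q" "q \<bullet> w \<le> 0" for p q
  proof -
    obtain \<alpha> \<beta> m where ab: "x = \<alpha> *\<^sub>R p + \<beta> *\<^sub>R q + m *\<^sub>R N" "0 < \<alpha>" "0 < \<beta>" using coversE[OF b(3) pq(1)] .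
    have "\<beta> * (q \<bullet> w) \<le> 0" using ab pq by (simp add: mult_nonneg_nonpos)
    then have "0 < \<alpha> * (p \<bullet> w)" using comb(2)[OF ab(1)] xw by linarith
    then have pw: "0 < p \<bullet> w" using ab by (simp add: zero_less_mult_iff)
    define d where "d = F * (p \<bullet> w) - p \<bullet> ?u"
    have qu: "\<beta> * (q \<bullet> ?u) = \<beta> * (F * (q \<bullet> w)) + \<alpha> * d"
      using comb(1)[OF ab(1)] unfolding comb(2)[OF ab(1), symmetric] d_def by (simp add: algebra_simps)
    have d: "0 < d"
    proof (rule ccontr)
      assume "\<not> 0 < d"
      then have "d = 0" using le[OF pq(1) pw] by (simp add: d_def)
      then show False using not_both[OF pq(1) _ _ pw] qu ab by (simp add: d_def)
    qed
    show thesis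
    proof (cases "q \<bullet> w = 0")
      case True
      then have "0 < \<beta> * (q \<bullet> ?u)" using qu d ab by simp
      then have qu0: "0 < q \<bullet> ?u" using ab by (simp add: zero_less_mult_iff)
      obtain k m where km: "0 < k" "y = k *\<^sub>R q + m *\<^sub>R N" using same_direction[OF w(1,2) True qu0 w(3) yu] .
      obtain b' where b': "upper b'" "\<not> radial N b'" "covers b' q"
        using end_covered[OF b(1) ends_sym[OF pq(1)] qu0 nu(1)] .
      have "covers b' y" unfolding km(2) by (rule covers_shift[OF b'(3) km(1)])
      then show thesis by (rule goal[OF b'(1,2)])
    next
      case False
      then have qw: "q \<bullet> w < 0" using pq by simp
      \<comment> \<open>The positive combination of the two ends that lies in the meridian plane of
        \<open>y\<close>.\<close>
      define z where "z = (- (q \<bullet> w)) *\<^sub>R p + (p \<bullet> w) *\<^sub>R q"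
      have z: "z \<bullet> w = 0" by (simp add: z_def inner_diff_left)
      have "\<beta> * (z \<bullet> ?u) = - (q \<bullet> w) * \<beta> * (p \<bullet> ?u) + (p \<bullet> w) * (\<beta> * (q \<bullet> ?u))"
        unfolding z_def by (simp add: inner_diff_left algebra_simps)
      also have "\<dots> = d * (\<alpha> * (p \<bullet> w) + \<beta> * (q \<bullet> w))" unfolding qu d_def by (simp add: algebra_simps)
      finally have "0 < \<beta> * (z \<bullet> ?u)" using d xw unfolding comb(2)[OF ab(1)] by simp
      then have zu: "0 < z \<bullet> ?u" using ab by (simp add: zero_less_mult_iff)
      obtain k m where km: "0 < k" "y = k *\<^sub>R z + m *\<^sub>R N" using same_direction[OF w(1,2) z zu w(3) yu] .
      have "covers b z" by (rule coversI[OF pq(1), where \<alpha> = "- (q \<bullet> w)" and \<beta> = "p \<bullet> w" and m = 0]) (use qw pw in \<open>simp_all add: z_def\<close>)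
      then have "covers b y" unfolding km(2) by (rule covers_shift[OF _ km(1)])
      then show thesis by (rule goal[OF b(1,2)])
    qed
  qed
  show thesis
  proof (cases "0 < fst b \<bullet> w \<and> 0 < snd b \<bullet> w")
    case False
    then show thesis using main[OF ends_self] main[OF ends_sym[OF ends_self]] by (auto simp: not_less)
  next
    case True
    obtain \<alpha> \<beta> m where ab: "x = \<alpha> *\<^sub>R fst b + \<beta> *\<^sub>R snd b + m *\<^sub>R N" "0 < \<alpha>" "0 < \<beta>" using coversE[OF b(3) ends_self] .
    have "\<alpha> * (F * (fst b \<bullet> w) - fst b \<bullet> ?u) + \<beta> * (F * (snd b \<bullet> w) - snd b \<bullet> ?u) = 0"
      using comb(1)[OF ab(1)] unfolding comb(2)[OF ab(1), symmetric] by (simp add: algebra_simps)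
    moreover have "0 \<le> \<alpha> * (F * (fst b \<bullet> w) - fst b \<bullet> ?u)" "0 \<le> \<beta> * (F * (snd b \<bullet> w) - snd b \<bullet> ?u)"
      using le[OF ends_self] le[OF ends_sym[OF ends_self]] True ab by simp_all
    ultimately have "\<alpha> * (F * (fst b \<bullet> w) - fst b \<bullet> ?u) = 0" "\<beta> * (F * (snd b \<bullet> w) - snd b \<bullet> ?u) = 0" by linarith+
    then show thesis using not_both[OF ends_self] True ab by simp
  qed
qed

text \<open>\<open>a\<close> covers neither \<open>p\<close> nor the opposite direction, and no arc
  covers two opposite directions, so three different arcs are involved.\<close>

lemma two_more_uppers:
  assumes a: "upper a" "\<not> radial N a" "ends a p q"
  obtains b c where "upper b" "\<not> radial N b" "covers b p" "upper c" "\<not> radial N c" "covers c (- p)"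
    "b \<noteq> a" "c \<noteq> a" "b \<noteq> c"
proof -
  have x: "cross3 p N \<noteq> 0" "cross3 (- p) N \<noteq> 0"
    using nonradial_off_axis[OF a(2,3)] by (simp_all add: cross_minus_left)
  obtain b where b: "upper b" "\<not> radial N b" "covers b p" using direction_covered[OF x(1)] .
  obtain c where c: "upper c" "\<not> radial N c" "covers c (- p)" using direction_covered[OF x(2)] .
  have "b \<noteq> a" using b covers_own_end[OF a(2,3), of 1] by auto
  moreover have "c \<noteq> a" using c covers_own_end[OF a(2,3), of "-1"] by auto
  moreover have "b \<noteq> c" using b c covers_opposite by blast
  ultimately show thesis using that b c by blast
qed

lemma three_uppers:
  obtains a b c where "upper a" "\<not> radial N a" "upper b" "\<not> radial N b" "upper c" "\<not> radial N c"
    "a \<noteq> b" "b \<noteq> c" "a \<noteq> c"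
proof -
  obtain a0 where a0: "upper a0" using upper_exists by blast
  obtain w where w: "w \<noteq> 0" "w \<bullet> N = 0" using avoid_two[of N 0 0] by blast
  obtain m t s where "mixed m" "ends m t s" "0 < t \<bullet> e" using mixed_in_half[OF w] by blast
  then obtain a where "upper a" "\<not> radial N a" using mixed_top by blast
  then show thesis using two_more_uppers[OF _ _ ends_self, of a] that by metis
qed

lemma finite_upper: "finite {a. upper a}" and finite_mixed: "finite {a. mixed a}"
  using finD by (auto simp: upper_def mixed_def intro: finite_subset)

lemma card_upper: "3 \<le> card {a. upper a}"
proof -
  obtain a b c where "upper a" "upper b" "upper c" "a \<noteq> b" "b \<noteq> c" "a \<noteq> c" using three_uppers by metis
  then have "{a, b, c} \<subseteq> {a. upper a}" "card {a, b, c} = 3" by auto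
  then show ?thesis using card_mono[OF finite_upper] by metis
qed

lemma mixed_ends_unique:
  assumes "ends m t s" "ends m t' s'" "0 < t \<bullet> e" "s \<bullet> e \<le> 0" "0 < t' \<bullet> e" "s' \<bullet> e \<le> 0"
  shows "t' = t"
  using assms by (auto simp: ends_def)

text \<open>Each further half-space is chosen by \<open>avoid_two\<close> to exclude the tops of the
  crossing arcs already found.\<close>

lemma card_mixed: "3 \<le> card {a. mixed a}"
proof -
  obtain w where w: "w \<noteq> 0" "w \<bullet> N = 0" using avoid_two[of N 0 0] by blast
  obtain m1 t1 s1 where 1: "mixed m1" "ends m1 t1 s1" "0 < t1 \<bullet> e" "s1 \<bullet> e \<le> 0" "0 < t1 \<bullet> w" by (rule mixed_in_half[OF w])
  obtain w2 where w2: "w2 \<noteq> 0" "w2 \<bullet> N = 0" "t1 \<bullet> w2 \<le> 0" using avoid_two[of N t1 t1] by blast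
  obtain m2 t2 s2 where 2: "mixed m2" "ends m2 t2 s2" "0 < t2 \<bullet> e" "s2 \<bullet> e \<le> 0" "0 < t2 \<bullet> w2" by (rule mixed_in_half[OF w2(1,2)])
  obtain w3 where w3: "w3 \<noteq> 0" "w3 \<bullet> N = 0" "t1 \<bullet> w3 \<le> 0" "t2 \<bullet> w3 \<le> 0" using avoid_two[of N t1 t2] by blast
  obtain m3 t3 s3 where 3: "mixed m3" "ends m3 t3 s3" "0 < t3 \<bullet> e" "s3 \<bullet> e \<le> 0" "0 < t3 \<bullet> w3" by (rule mixed_in_half[OF w3(1,2)])
  have "m1 \<noteq> m2" using mixed_ends_unique[OF 1(2) _ 1(3,4), of t2 s2] 2 w2 by fastforce
  moreover have "m1 \<noteq> m3" using mixed_ends_unique[OF 1(2) _ 1(3,4), of t3 s3] 3 w3 by fastforce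
  moreover have "m2 \<noteq> m3" using mixed_ends_unique[OF 2(2) _ 2(3,4), of t3 s3] 3 w3 by fastforce
  ultimately have "{m1, m2, m3} \<subseteq> {a. mixed a}" "card {m1, m2, m3} = 3" using 1 2 3 by auto
  then show ?thesis using card_mono[OF finite_mixed] by metis
qed

text \<open>The factor for \<open>N\<close> makes the sign independent of the order of the ends:
  positive on the side of \<open>N\<close>, negative beyond the arc.\<close>

definition side :: "arc \<Rightarrow> point \<Rightarrow> real" where
  "side b x = triple x (fst b) (snd b) * triple N (fst b) (snd b)"

lemma side_comb: "side b (k *\<^sub>R x + l *\<^sub>R y) = k * side b x + l * side b y"
  by (simp add: side_def algebra_simps)

lemma side_plane:
  assumes "ends b p q" shows "side b (\<alpha> *\<^sub>R p + \<beta> *\<^sub>R q + m *\<^sub>R N) = m * side b N"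
proof -
  have "triple p (fst b) (snd b) = 0" "triple q (fst b) (snd b) = 0"
    using assms by (auto simp: ends_def)
  then show ?thesis by (simp add: side_def)
qed

lemma side_N: "\<not> radial N b \<Longrightarrow> 0 < side b N"
  by (auto simp: side_def radial_def zero_less_mult_iff linorder_neq_iff)

lemma pos_small: "0 < (a::real) \<Longrightarrow> \<forall>\<^sub>F \<epsilon> in at_right 0. 0 < a + \<epsilon> * c"
proof (rule order_tendstoD(1))
  show "((\<lambda>\<epsilon>. a + \<epsilon> * c) \<longlongrightarrow> a) (at_right 0)" by (auto intro!: tendsto_eq_intros)
qed simp

text \<open>Moves from the end \<open>E\<close> slightly into its arc: being covered and a negative
  side are open conditions, and a zero side is decided by \<open>F\<close>.\<close>

lemma near_end:
  assumes b: "\<not> radial N b" "covers b E" "side b E \<le> 0" "side b E = 0 \<Longrightarrow> side b F < 0"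
  obtains \<epsilon> where "0 < \<epsilon>" "covers b (E + \<epsilon> *\<^sub>R F)" "side b (E + \<epsilon> *\<^sub>R F) < 0"
proof -
  obtain \<alpha> \<beta> m where E: "E = \<alpha> *\<^sub>R fst b + \<beta> *\<^sub>R snd b + m *\<^sub>R N" "0 < \<alpha>" "0 < \<beta>" using coversE[OF b(2) ends_self] .
  let ?t = "triple N (fst b) (snd b)"
  have t: "?t \<noteq> 0" using b(1) by (simp add: radial_def)
  have "inverse ?t *\<^sub>R (?t *\<^sub>R F) = inverse ?t *\<^sub>R (triple F (fst b) (snd b) *\<^sub>R N + triple N F (snd b) *\<^sub>R fst b + triple N (fst b) F *\<^sub>R snd b)"
    using cramer3[of N "fst b" "snd b" F] by simp
  then have "F = (inverse ?t * triple F (fst b) (snd b)) *\<^sub>R N + (inverse ?t * triple N F (snd b)) *\<^sub>R fst b +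
      (inverse ?t * triple N (fst b) F) *\<^sub>R snd b"
    using t by (simp add: scaleR_add_right)
  then have "F = (inverse ?t * triple N F (snd b)) *\<^sub>R fst b + (inverse ?t * triple N (fst b) F) *\<^sub>R snd b +
      (inverse ?t * triple F (fst b) (snd b)) *\<^sub>R N"
    by (rule trans) (simp only: ac_simps)
  then obtain \<gamma> \<delta> n where F: "F = \<gamma> *\<^sub>R fst b + \<delta> *\<^sub>R snd b + n *\<^sub>R N" by blast
  have s: "\<forall>\<^sub>F \<epsilon> in at_right 0. side b (E + \<epsilon> *\<^sub>R F) < 0"
  proof (cases "side b E = 0")
    case True
    have "\<forall>\<^sub>F \<epsilon> in at_right (0::real). 0 < \<epsilon>" by (rule eventually_at_right_less)
    then show ?thesis
    proof eventually_elim
      case (elim \<epsilon>)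
      then show ?case using b(4)[OF True] side_comb[of b 1 E \<epsilon> F] True by (simp add: mult_pos_neg)
    qed
  next
    case False
    then have "0 < - side b E" using b(3) by simp
    from pos_small[OF this, of "- side b F"] show ?thesis
      by eventually_elim (use side_comb[of b 1 E _ F] in simp)
  qed
  have "\<forall>\<^sub>F \<epsilon> in at_right 0. 0 < \<epsilon> \<and> 0 < \<alpha> + \<epsilon> * \<gamma> \<and> 0 < \<beta> + \<epsilon> * \<delta> \<and> side b (E + \<epsilon> *\<^sub>R F) < 0"
    using eventually_at_right_less[of 0] pos_small[OF E(2), of \<gamma>] pos_small[OF E(3), of \<delta>] s
    by eventually_elim simp
  then obtain \<epsilon> where \<epsilon>: "0 < \<epsilon>" "0 < \<alpha> + \<epsilon> * \<gamma>" "0 < \<beta> + \<epsilon> * \<delta>" "side b (E + \<epsilon> *\<^sub>R F) < 0"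
    using eventually_happens'[OF trivial_limit_at_right_real] by blast
  have "E + \<epsilon> *\<^sub>R F = (\<alpha> + \<epsilon> * \<gamma>) *\<^sub>R fst b + (\<beta> + \<epsilon> * \<delta>) *\<^sub>R snd b + (m + \<epsilon> * n) *\<^sub>R N"
    unfolding E(1) F by (simp add: algebra_simps)
  then have "covers b (E + \<epsilon> *\<^sub>R F)" by (rule coversI[OF ends_self]) (use \<epsilon> in simp_all)
  then show thesis using that \<epsilon> by blast
qed

text \<open>Each of two arcs would pass outside the other one: they would cross.\<close>
lemma mutually_outer:
  assumes b1: "b1 \<in> D" "\<not> radial N b1" "ends b1 E1 F1" and b2: "b2 \<in> D" "\<not> radial N b2" "ends b2 E2 F2"
    and ne: "b1 \<noteq> b2"
    and c1: "covers b2 E1" "side b2 E1 \<le> 0" "side b2 E1 = 0 \<Longrightarrow> side b2 F1 < 0"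
    and c2: "covers b1 E2" "side b1 E2 \<le> 0" "side b1 E2 = 0 \<Longrightarrow> side b1 F2 < 0"
  shows False
proof -
  obtain \<epsilon> where x0: "0 < \<epsilon>" "covers b2 (E1 + \<epsilon> *\<^sub>R F1)" "side b2 (E1 + \<epsilon> *\<^sub>R F1) < 0"
    using near_end[OF b2(2) c1] .
  obtain \<delta> where y0: "0 < \<delta>" "covers b1 (E2 + \<delta> *\<^sub>R F2)" "side b1 (E2 + \<delta> *\<^sub>R F2) < 0"
    using near_end[OF b1(2) c2] .
  obtain \<alpha> \<beta> m where ab: "E2 + \<delta> *\<^sub>R F2 = \<alpha> *\<^sub>R E1 + \<beta> *\<^sub>R F1 + m *\<^sub>R N" "0 < \<alpha>" "0 < \<beta>"
    using coversE[OF y0(2) b1(3)] .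
  have m: "m < 0" using y0(3) side_plane[OF b1(3)] side_N[OF b1(2)] unfolding ab(1) by (simp add: mult_less_0_iff)
  \<comment> \<open>Two vectors in the cone of \<open>b1\<close>: \<open>x0\<close> is beyond
    \<open>b2\<close>, while \<open>x1\<close>, straight above a point of \<open>b2\<close>, is on
    the inner side of \<open>b2\<close>. Between them, \<open>z\<close> lies on both cones.\<close>
  define x0 where "x0 = E1 + \<epsilon> *\<^sub>R F1"
  define x1 where "x1 = \<alpha> *\<^sub>R E1 + \<beta> *\<^sub>R F1"
  have x1: "x1 = 1 *\<^sub>R E2 + \<delta> *\<^sub>R F2 + (- m) *\<^sub>R N" using ab(1) by (simp add: x1_def)
  have cov1: "covers b2 x1" by (rule coversI[OF b2(3) x1]) (use y0 in simp_all)
  have s1: "0 < side b2 x1" unfolding x1 side_plane[OF b2(3)] using m side_N[OF b2(2)] by (simp add: mult_neg_pos)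
  have s0: "0 < - side b2 x0" using \<open>side b2 (E1 + \<epsilon> *\<^sub>R F1) < 0\<close> by (simp add: x0_def)
  define z where "z = side b2 x1 *\<^sub>R x0 + (- side b2 x0) *\<^sub>R x1"
  have "covers b2 z" using covers_comb[OF _ cov1 s1 s0, of x0 0] \<open>covers b2 (E1 + \<epsilon> *\<^sub>R F1)\<close> by (simp add: z_def x0_def)
  then obtain \<gamma> \<gamma>' n where z: "z = \<gamma> *\<^sub>R E2 + \<gamma>' *\<^sub>R F2 + n *\<^sub>R N" "0 < \<gamma>" "0 < \<gamma>'" using coversE[OF _ b2(3)] by metis
  have "side b2 z = 0" unfolding z_def side_comb by simp
  then have "n = 0" unfolding z(1) side_plane[OF b2(3)] using side_N[OF b2(2)] by simp
  have "z = (side b2 x1 + (- side b2 x0) * \<alpha>) *\<^sub>R E1 + (side b2 x1 * \<epsilon> + (- side b2 x0) * \<beta>) *\<^sub>R F1"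
    unfolding z_def by (simp add: x0_def x1_def algebra_simps)
  then have eq: "(side b2 x1 + (- side b2 x0) * \<alpha>) *\<^sub>R E1 + (side b2 x1 * \<epsilon> + (- side b2 x0) * \<beta>) *\<^sub>R F1 = \<gamma> *\<^sub>R E2 + \<gamma>' *\<^sub>R F2"
    using z(1) \<open>n = 0\<close> by simp
  have "0 < side b2 x1 + (- side b2 x0) * \<alpha>" "0 < side b2 x1 * \<epsilon> + (- side b2 x0) * \<beta>"
    using s0 s1 ab \<open>0 < \<epsilon>\<close> by (intro add_pos_pos mult_pos_pos; simp)+
  from cone_disjoint[OF b1(1) b2(1) b1(3) b2(3) this z(2,3) eq] ne show False by simp
qed

text \<open>With three upper arcs, two of them carry tops of crossing arcs and can be hit from the
  outer side only. Each of these two has an end covered by the other alone, and that end lies on or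
  beyond the other: they are mutually outer.\<close>

lemma card_upper_one_sided:
  assumes sod: "\<And>a b c s t. \<lbrakk>a \<in> D; b \<in> D; c \<in> D; hits_from_side b a s; hits_from_side c a t\<rbrakk> \<Longrightarrow> s = t"
  shows "4 \<le> card {a. upper a}"
proof (rule ccontr)
  assume "\<not> ?thesis"
  then have c3: "card {a. upper a} = 3" using card_upper by simp
  have all3: "d \<in> {a, b, c}" if "upper a" "upper b" "upper c" "a \<noteq> b" "b \<noteq> c" "a \<noteq> c" "upper d" for a b c d
  proof (rule ccontr)
    assume "d \<notin> {a, b, c}"
    then have 4: "card {a, b, c, d} = 4" "{a, b, c, d} \<subseteq> {a. upper a}" using that by auto
    from card_mono[OF finite_upper 4(2)] show False unfolding 4(1) c3 by simp
  qed
  have nr: "\<not> radial N d" if "upper d" for d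
  proof -
    obtain a b c where "upper a" "\<not> radial N a" "upper b" "\<not> radial N b" "upper c" "\<not> radial N c" "a \<noteq> b" "b \<noteq> c" "a \<noteq> c"
      using three_uppers .
    then show ?thesis using all3[of a b c d] that by blast
  qed
  \<comment> \<open>A crossing arc hangs from \<open>b\<close> on its outer side; one-sidedness
    extends this to every arc that hits \<open>b\<close>.\<close>
  define host where "host b \<longleftrightarrow> (\<exists>m t s. mixed m \<and> ends m t s \<and> 0 < t \<bullet> e \<and> t \<in> arc_relint b \<and> side b s < 0)" for b
  have mk_host: "host b" if b: "upper b" "mixed m" "ends m t s" "0 < t \<bullet> e" "s \<bullet> e \<le> 0" "t \<in> arc_relint b" for b m t s
  proof -
    obtain t' s' \<kappa> \<mu> where ts: "ends m t' s'" "0 < t' \<bullet> e" "s' \<bullet> e \<le> 0" "s' = \<kappa> *\<^sub>R t' + \<mu> *\<^sub>R N" "0 < \<kappa>" "\<mu> < 0"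
      using mixedE[OF b(2)] by metis
    have t': "t' = t" "s' = s" using ts b by (auto simp: ends_def)
    obtain \<alpha> \<beta> where "t = \<alpha> *\<^sub>R fst b + \<beta> *\<^sub>R snd b" using relintE[OF upperD(1)[OF b(1)] b(6) ends_self] .
    then have "s = (\<kappa> * \<alpha>) *\<^sub>R fst b + (\<kappa> * \<beta>) *\<^sub>R snd b + \<mu> *\<^sub>R N" using ts t' by (simp add: scaleR_add_right)
    then have "side b s = \<mu> * side b N" using side_plane[OF ends_self] by simp
    then have "side b s < 0" using ts side_N[OF nr[OF b(1)]] by (simp add: mult_neg_pos)
    then show ?thesis using b unfolding host_def by blast
  qed
  obtain w where w: "w \<noteq> 0" "w \<bullet> N = 0" using avoid_two[of N 0 0] by blast
  obtain m1 t1 s1 where 1: "mixed m1" "ends m1 t1 s1" "0 < t1 \<bullet> e" "s1 \<bullet> e \<le> 0" by (rule mixed_in_half[OF w])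
  obtain b1 where b1: "upper b1" "t1 \<in> arc_relint b1" by (rule mixed_top[OF 1(1-3)])
  \<comment> \<open>Excluding both ends of \<open>b1\<close> excludes all of it, so the second
    carrier is another arc.\<close>
  obtain w2 where w2: "w2 \<noteq> 0" "w2 \<bullet> N = 0" "fst b1 \<bullet> w2 \<le> 0" "snd b1 \<bullet> w2 \<le> 0" using avoid_two[of N "fst b1" "snd b1"] by blast
  obtain m2 t2 s2 where 2: "mixed m2" "ends m2 t2 s2" "0 < t2 \<bullet> e" "s2 \<bullet> e \<le> 0" "0 < t2 \<bullet> w2" by (rule mixed_in_half[OF w2(1,2)])
  obtain b2 where b2: "upper b2" "t2 \<in> arc_relint b2" by (rule mixed_top[OF 2(1-3)])
  have h: "host b1" "host b2" using mk_host[OF b1(1) 1 b1(2)] mk_host[OF b2(1) 2(1-4) b2(2)] .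
  have ne: "b1 \<noteq> b2"
  proof
    assume "b1 = b2"
    then obtain \<alpha> \<beta> where "0 < \<alpha>" "0 < \<beta>" "t2 = \<alpha> *\<^sub>R fst b1 + \<beta> *\<^sub>R snd b1"
      using relintE[OF upperD(1)[OF b1(1)] _ ends_self] b2 by metis
    then have "t2 \<bullet> w2 \<le> 0" using w2 by (simp add: inner_add_left mult_nonneg_nonpos add_nonpos_nonpos)
    then show False using 2 by simp
  qed
  \<comment> \<open>Then \<open>b\<close> would cover whatever \<open>a\<close> covers. But
    \<open>a\<close> is one of the two other arcs, which cover \<open>fst b\<close> and its
    opposite.\<close>
  have no_double: False if a: "upper a" "ends a p q" and b: "upper b" "covers b p" "covers b q" "a \<noteq> b" for a b p q
  proof -
    have sub: "covers b y" if cy: "covers a y" for y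
    proof -
      obtain \<alpha> \<beta> m where "y = \<alpha> *\<^sub>R p + \<beta> *\<^sub>R q + m *\<^sub>R N" "0 < \<alpha>" "0 < \<beta>" using coversE[OF cy a(2)] .
      then show ?thesis using covers_comb[OF b(2,3)] by simp
    qed
    obtain c d where cd: "upper c" "covers c (fst b)" "upper d" "covers d (- fst b)" "c \<noteq> b" "d \<noteq> b" "c \<noteq> d"
      using two_more_uppers[OF b(1) nr[OF b(1)] ends_self] by metis
    have "a \<in> {b, c, d}" using all3[OF b(1) cd(1,3) cd(5)[symmetric] cd(7) cd(6)[symmetric] a(1)] .
    then have "covers b (fst b) \<or> covers b (- fst b)" using sub cd b(4) by auto
    then show False using covers_own_end[OF nr[OF b(1)] ends_self, of 1] covers_own_end[OF nr[OF b(1)] ends_self, of "-1"] by simp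
  qed
  \<comment> \<open>By \<open>no_double\<close> the two other arcs share the ends of
    \<open>a\<close>, one each.\<close>
  have excl: "\<exists>E F. ends a E F \<and> covers b E \<and> (\<forall>d. upper d \<longrightarrow> covers d E \<longrightarrow> d = b)"
    if a: "upper a" and b: "upper b" "a \<noteq> b" for a b
  proof -
    obtain p q where pq: "ends a p q" using ends_self by blast
    have cov: "\<exists>d. upper d \<and> covers d p \<and> d \<noteq> a" if "ends a p q" for p q
      using two_more_uppers[OF a nr[OF a] that] by metis
    obtain d where d: "upper d" "covers d p" "d \<noteq> a" using cov[OF pq] by blast
    obtain d' where d': "upper d'" "covers d' q" "d' \<noteq> a" using cov[OF ends_sym[OF pq]] by blast
    have dd': "d \<noteq> d'" using no_double[OF a pq d(1,2)] d' d by blast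
    have in3: "x = a \<or> x = d \<or> x = d'" if "upper x" for x
      using all3[OF a d(1) d'(1) d(3)[symmetric] dd' d'(3)[symmetric] that] by blast
    have own: "\<not> covers a p" "\<not> covers a q"
      using covers_own_end[OF nr[OF a] pq, of 1] covers_own_end[OF nr[OF a] ends_sym[OF pq], of 1] by auto
    have "\<not> covers d q" using no_double[OF a pq d(1,2)] d by blast
    moreover have "\<not> covers d' p" using no_double[OF a ends_sym[OF pq] d'(1,2)] d' by blast
    ultimately have "\<forall>x. upper x \<longrightarrow> covers x p \<longrightarrow> x = d" "\<forall>x. upper x \<longrightarrow> covers x q \<longrightarrow> x = d'"
      using in3 own by blast+
    moreover have "b = d \<or> b = d'" using in3[OF b(1)] b(2) by blast
    ultimately show ?thesis using pq ends_sym[OF pq] d d' by blast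
  qed
  \<comment> \<open>The blocker of \<open>E\<close> is \<open>b\<close> itself, where one-sidedness
    decides about \<open>F\<close>, or a crossing arc, which must hang from
    \<open>b\<close>.\<close>
  have descent: "side b E \<le> 0 \<and> (side b E = 0 \<longrightarrow> side b F < 0)"
    if b: "upper b" "host b" and a: "upper a" "ends a E F" and ex: "\<forall>d. upper d \<longrightarrow> covers d E \<longrightarrow> d = b" for a b E F
  proof -
    have Ee: "0 < E \<bullet> e" using upperD(2)[OF a] .
    obtain b0 where b0: "b0 \<in> D" "E \<in> arc_relint b0" using blocked upperD(1)[OF a(1)] a(2) by blast
    show ?thesis
      using above_kinds[OF b0 Ee]
    proof
      assume u: "upper b0"
      obtain \<alpha> \<beta> where ab: "0 < \<alpha>" "0 < \<beta>" "E = \<alpha> *\<^sub>R fst b0 + \<beta> *\<^sub>R snd b0" using relintE[OF b0 ends_self] .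
      then have E: "E = \<alpha> *\<^sub>R fst b0 + \<beta> *\<^sub>R snd b0 + 0 *\<^sub>R N" by simp
      have "covers b0 E" by (rule coversI[OF ends_self E ab(1,2)])
      then have bb: "b0 = b" using ex u by blast
      have s0: "side b E = 0" unfolding E bb side_plane[OF ends_self] by simp
      obtain m t s where m: "mixed m" "ends m t s" "t \<in> arc_relint b" "side b s < 0" using b(2) unfolding host_def by blast
      have "hits_from_side m b (sgn (s \<bullet> cross3 (fst b) (snd b)))" "hits_from_side a b (sgn (F \<bullet> cross3 (fst b) (snd b)))"
        using m a(2) b0(2) bb unfolding hits_from_side_def ends_def by blast+
      from sod[OF upperD(1)[OF b(1)] mixed_meridian(2)[OF m(1)] upperD(1)[OF a(1)] this]
      have "sgn (triple s (fst b) (snd b)) = sgn (triple F (fst b) (snd b))" by (simp add: triple_def)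
      then have "sgn (side b s) = sgn (side b F)" by (simp add: side_def sgn_mult)
      then have "side b F < 0" using m(4) by (metis sgn_less)
      then show ?thesis using s0 by simp
    next
      assume mx: "mixed b0"
      obtain t s \<kappa> \<mu> where ts: "ends b0 t s" "0 < t \<bullet> e" "s \<bullet> e \<le> 0" "s = \<kappa> *\<^sub>R t + \<mu> *\<^sub>R N" "0 < \<kappa>" "\<mu> < 0"
        using mixedE[OF mx] by metis
      obtain c p q \<gamma> \<delta> where c: "upper c" "ends c p q" "0 < \<gamma>" "0 < \<delta>" "t = \<gamma> *\<^sub>R p + \<delta> *\<^sub>R q"
        by (rule mixed_top[OF mx ts(1,2)])
      obtain \<alpha> \<beta> where ab: "0 < \<alpha>" "0 < \<beta>" "E = \<alpha> *\<^sub>R t + \<beta> *\<^sub>R s" using relintE[OF b0 ts(1)] .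
      have E: "E = ((\<alpha> + \<beta> * \<kappa>) * \<gamma>) *\<^sub>R p + ((\<alpha> + \<beta> * \<kappa>) * \<delta>) *\<^sub>R q + (\<beta> * \<mu>) *\<^sub>R N"
        unfolding ab ts(4) c(5) by (simp add: algebra_simps)
      have pos: "0 < \<alpha> + \<beta> * \<kappa>" using ab ts by (simp add: add_pos_pos)
      have "covers c E" by (rule coversI[OF c(2) E]) (use pos c in simp_all)
      then have "c = b" using ex c by blast
      have "side b E = \<beta> * \<mu> * side b N" unfolding E using side_plane[OF c(2)] \<open>c = b\<close> by simp
      moreover have "\<beta> * \<mu> < 0" using ab ts by (simp add: mult_pos_neg)
      ultimately have "side b E < 0" using side_N[OF nr[OF b(1)]] by (simp add: mult_neg_pos)
      then show ?thesis by simp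
    qed
  qed
  obtain E1 F1 where E1: "ends b1 E1 F1" "covers b2 E1" "\<forall>d. upper d \<longrightarrow> covers d E1 \<longrightarrow> d = b2"
    using excl[OF b1(1) b2(1) ne] by blast
  obtain E2 F2 where E2: "ends b2 E2 F2" "covers b1 E2" "\<forall>d. upper d \<longrightarrow> covers d E2 \<longrightarrow> d = b1"
    using excl[OF b2(1) b1(1)] ne by metis
  show False
    using mutually_outer[OF upperD(1)[OF b1(1)] nr[OF b1(1)] E1(1) upperD(1)[OF b2(1)] nr[OF b2(1)] E2(1) ne]
      E1(2) E2(2) descent[OF b2(1) h(2) b1(1) E1(1,3)] descent[OF b1(1) h(1) b2(1) E2(1,3)] by blast
qed

end

section \<open>Central projection of a quarter of the sphere\<close>

text \<open>The half-space \<open>w > 0\<close> is projected centrally; meridians of \<open>N\<close> become vertical lines and the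
  equator becomes the horizontal axis.\<close>
locale quarter = cap +
  fixes w :: point
  assumes w0: "w \<noteq> 0" and wN: "w \<bullet> N = 0"
begin

definition u where "u = cross3 w N"
definition absc where "absc x = (x \<bullet> u) / (x \<bullet> w)"
definition elev where "elev x = (x \<bullet> e) / (x \<bullet> w)"
text \<open>Differences of abscissas and of elevations with denominators cleared, so that they keep
  a meaning for ends outside the half-space.\<close>

definition D2 where "D2 x y = (x \<bullet> u) * (y \<bullet> w) - (y \<bullet> u) * (x \<bullet> w)"
definition E2 where "E2 x y = (x \<bullet> e) * (y \<bullet> w) - (y \<bullet> e) * (x \<bullet> w)"

lemma frame: "N \<bullet> u = 0" "N \<bullet> w = 0" "0 < triple u w e"
  using frame_positive[OF w0 wN Ne] wN by (simp_all add: u_def inner_commute)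

lemma vec_eqI: "\<lbrakk>x \<bullet> u = y \<bullet> u; x \<bullet> w = y \<bullet> w; x \<bullet> e = y \<bullet> e\<rbrakk> \<Longrightarrow> x = y"
  using coord_zero[of u w e "x - y"] frame(3) by (simp add: inner_diff_left)

text \<open>The cross products form the dual basis up to the factor
  \<open>triple u w e\<close>.\<close>

lemma vec_exists: "\<exists>y. y \<bullet> u = a \<and> y \<bullet> w = b \<and> y \<bullet> e = c"
proof -
  let ?t = "triple u w e"
  let ?y = "(a / ?t) *\<^sub>R cross3 w e + (b / ?t) *\<^sub>R cross3 e u + (c / ?t) *\<^sub>R cross3 u w"
  have c: "cross3 w e \<bullet> u = ?t" "cross3 w e \<bullet> w = 0" "cross3 w e \<bullet> e = 0"
    "cross3 e u \<bullet> u = 0" "cross3 e u \<bullet> w = ?t" "cross3 e u \<bullet> e = 0"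
    "cross3 u w \<bullet> u = 0" "cross3 u w \<bullet> w = 0" "cross3 u w \<bullet> e = ?t"
    unfolding triple_expand inner_expand cross3_def by (simp_all add: algebra_simps)
  show ?thesis using frame(3) by (intro exI[of _ ?y]) (simp add: inner_add_left c)
qed

text \<open>Orientation in terms of projected coordinates, as an instance of
  \<open>triple_gram\<close>.\<close>

lemma triple_chart: "triple x y z * triple u w e = (z \<bullet> u) * E2 y x + (z \<bullet> w) * ((x \<bullet> e) * (y \<bullet> u) - (x \<bullet> u) * (y \<bullet> e)) + (z \<bullet> e) * D2 x y"
  unfolding triple_gram D2_def E2_def by algebra

lemma radial_iff_D2: "ends a p q \<Longrightarrow> radial N a \<longleftrightarrow> D2 p q = 0"
proof -
  assume "ends a p q"
  moreover have "triple N p q * triple u w e = (N \<bullet> e) * D2 p q"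
    unfolding triple_gram D2_def using frame by (simp add: algebra_simps)
  then have "triple N p q = 0 \<longleftrightarrow> D2 p q = 0" using frame(3) Ne by auto
  ultimately show ?thesis using radial_ends by blast
qed

text \<open>The order of the ends is read off from \<open>D2\<close> or \<open>E2\<close> and hence
  also makes sense when one of them is outside the half-space.\<close>

definition hiE where "hiE a = (if D2 (fst a) (snd a) < 0 then snd a else fst a)"
definition loE where "loE a = (if D2 (fst a) (snd a) < 0 then fst a else snd a)"
definition topE where "topE a = (if E2 (fst a) (snd a) < 0 then snd a else fst a)"
definition botE where "botE a = (if E2 (fst a) (snd a) < 0 then fst a else snd a)"
text \<open>\<open>slope\<close> and \<open>icpt\<close> are the coefficients of the plane of the
  arc, solved for the coordinate \<open>e\<close>; see \<open>plane_eq\<close>.\<close>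

definition slope where "slope a = E2 (loE a) (hiE a) / D2 (loE a) (hiE a)"
definition icpt where "icpt a = ((loE a \<bullet> u) * (hiE a \<bullet> e) - (hiE a \<bullet> u) * (loE a \<bullet> e)) / D2 (loE a) (hiE a)"
definition pts where "pts = fst ` D \<union> snd ` D"
definition wid where "wid = 1 + (\<Sum>x\<in>pts. \<bar>absc x\<bar>)"
definition ceilg where "ceilg = 1 + (\<Sum>a\<in>D. \<bar>slope a\<bar> * wid + \<bar>icpt a\<bar>) + (\<Sum>x\<in>pts. \<bar>elev x\<bar>)"

text \<open>\<open>wid\<close>, \<open>ceilg\<close> and \<open>- 1\<close> stand for coordinates of ends outside the open quarter: they only have to
  exceed all coordinates of ends inside it.\<close>
definition A where "A = \<lparr>
  seg = {a. upper a \<and> \<not> radial N a \<and> (0 < fst a \<bullet> w \<or> 0 < snd a \<bullet> w)},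
  ver = {a \<in> D. radial N a \<and> (\<exists>x y. ends a x y \<and> 0 < x \<bullet> w \<and> 0 < x \<bullet> e)},
  lf = (\<lambda>a. if 0 < loE a \<bullet> w then absc (loE a) else - wid),
  rt = (\<lambda>a. if 0 < hiE a \<bullet> w then absc (hiE a) else wid),
  ht = (\<lambda>a Y. slope a * Y + icpt a), sl = slope, xv = (\<lambda>v. absc (botE v)),
  bt = (\<lambda>v. if 0 < botE v \<bullet> e then elev (botE v) else - 1),
  tp = (\<lambda>v. if 0 < topE v \<bullet> w then elev (topE v) else ceilg),
  lbl = {a. 0 < loE a \<bullet> w}, rbl = {a. 0 < hiE a \<bullet> w},
  bbl = {v. 0 < botE v \<bullet> e}, tbl = {v. 0 < topE v \<bullet> w}, wd = wid\<rparr>"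

lemma A_sel:
  "seg A = {a. upper a \<and> \<not> radial N a \<and> (0 < fst a \<bullet> w \<or> 0 < snd a \<bullet> w)}"
  "ver A = {a \<in> D. radial N a \<and> (\<exists>x y. ends a x y \<and> 0 < x \<bullet> w \<and> 0 < x \<bullet> e)}"
  "lf A a = (if 0 < loE a \<bullet> w then absc (loE a) else - wid)"
  "rt A a = (if 0 < hiE a \<bullet> w then absc (hiE a) else wid)"
  "ht A a Y = slope a * Y + icpt a" "sl A a = slope a" "xv A a = absc (botE a)"
  "bt A a = (if 0 < botE a \<bullet> e then elev (botE a) else - 1)"
  "tp A a = (if 0 < topE a \<bullet> w then elev (topE a) else ceilg)"
  "a \<in> lbl A \<longleftrightarrow> 0 < loE a \<bullet> w" "a \<in> rbl A \<longleftrightarrow> 0 < hiE a \<bullet> w"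
  "a \<in> bbl A \<longleftrightarrow> 0 < botE a \<bullet> e" "a \<in> tbl A \<longleftrightarrow> 0 < topE a \<bullet> w" "wd A = wid"
  by (simp_all add: A_def)

lemma ends_lo_hi: "ends a (loE a) (hiE a)" and ends_bot_top: "ends a (botE a) (topE a)"
  by (auto simp: ends_def loE_def hiE_def botE_def topE_def)

lemma D2_swap: "D2 y x = - D2 x y" and E2_swap: "E2 y x = - E2 x y"
  by (simp_all add: D2_def E2_def)

lemma D2_lo_hi: "\<not> radial N a \<Longrightarrow> D2 (loE a) (hiE a) < 0"
  using radial_iff_D2[OF ends_self, of a] D2_swap[of "fst a" "snd a"] by (auto simp: loE_def hiE_def)

lemma ends_pts: "\<lbrakk>a \<in> D; ends a x y\<rbrakk> \<Longrightarrow> x \<in> pts"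
  by (force simp: pts_def ends_def)

lemma fin_pts: "finite pts" using finD by (simp add: pts_def)

lemma absc_bound: assumes "a \<in> D" "ends a x y" shows "\<bar>absc x\<bar> < wid"
  using member_le_sum[OF ends_pts[OF assms], of "\<lambda>x. \<bar>absc x\<bar>"] fin_pts by (simp add: wid_def)

lemma wid_pos: "0 < wid" unfolding wid_def by (simp add: sum_nonneg add_pos_nonneg)

lemma ceilg_bounds:
  "\<lbrakk>a \<in> D; \<bar>Y\<bar> \<le> wid\<rbrakk> \<Longrightarrow> slope a * Y + icpt a < ceilg"
  "\<lbrakk>a \<in> D; ends a x y\<rbrakk> \<Longrightarrow> elev x < ceilg"
proof -
  have s1: "0 \<le> (\<Sum>a\<in>D. \<bar>slope a\<bar> * wid + \<bar>icpt a\<bar>)" "0 \<le> (\<Sum>x\<in>pts. \<bar>elev x\<bar>)"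
    using wid_pos by (auto intro!: sum_nonneg add_nonneg_nonneg mult_nonneg_nonneg)
  { assume a: "a \<in> D" "\<bar>Y\<bar> \<le> wid"
    have "slope a * Y \<le> \<bar>slope a\<bar> * \<bar>Y\<bar>" by (metis abs_ge_self abs_mult)
    also have "\<dots> \<le> \<bar>slope a\<bar> * wid" using a by (intro mult_left_mono) auto
    finally have "slope a * Y + icpt a \<le> \<bar>slope a\<bar> * wid + \<bar>icpt a\<bar>" by linarith
    also have "\<dots> \<le> (\<Sum>a\<in>D. \<bar>slope a\<bar> * wid + \<bar>icpt a\<bar>)"
      using member_le_sum[OF a(1), of "\<lambda>a. \<bar>slope a\<bar> * wid + \<bar>icpt a\<bar>"] finD wid_pos by auto
    finally show "slope a * Y + icpt a < ceilg" using s1 unfolding ceilg_def by linarith }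
  { assume "a \<in> D" "ends a x y"
    then have "\<bar>elev x\<bar> \<le> (\<Sum>x\<in>pts. \<bar>elev x\<bar>)"
      using member_le_sum[OF ends_pts, of a x y "\<lambda>x. \<bar>elev x\<bar>"] fin_pts by auto
    then show "elev x < ceilg" using s1 unfolding ceilg_def by linarith }
qed

lemma segD: "a \<in> seg A \<Longrightarrow> upper a" "a \<in> seg A \<Longrightarrow> \<not> radial N a" "a \<in> seg A \<Longrightarrow> a \<in> D"
  "a \<in> seg A \<Longrightarrow> 0 < loE a \<bullet> w \<or> 0 < hiE a \<bullet> w" "a \<in> seg A \<Longrightarrow> 0 < loE a \<bullet> e" "a \<in> seg A \<Longrightarrow> 0 < hiE a \<bullet> e"
proof -
  assume a: "a \<in> seg A"
  then show "upper a" "\<not> radial N a" "a \<in> D" using upperD(1) by (auto simp: A_sel)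
  then show "0 < loE a \<bullet> e" "0 < hiE a \<bullet> e" using upperD(2) ends_lo_hi ends_sym by blast+
  show "0 < loE a \<bullet> w \<or> 0 < hiE a \<bullet> w" using a by (auto simp: A_sel loE_def hiE_def)
qed

lemma plane_eq:
  assumes "\<not> radial N a"
  shows "x \<in> {loE a, hiE a} \<Longrightarrow> x \<bullet> e = slope a * (x \<bullet> u) + icpt a * (x \<bullet> w)"
proof -
  have d: "D2 (loE a) (hiE a) \<noteq> 0" using D2_lo_hi[OF assms] by simp
  assume "x \<in> {loE a, hiE a}"
  then have "(x \<bullet> e) * D2 (loE a) (hiE a) = E2 (loE a) (hiE a) * (x \<bullet> u) +
     ((loE a \<bullet> u) * (hiE a \<bullet> e) - (hiE a \<bullet> u) * (loE a \<bullet> e)) * (x \<bullet> w)"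
    by (auto simp: D2_def E2_def algebra_simps)
  then have "x \<bullet> e = (E2 (loE a) (hiE a) * (x \<bullet> u) +
     ((loE a \<bullet> u) * (hiE a \<bullet> e) - (hiE a \<bullet> u) * (loE a \<bullet> e)) * (x \<bullet> w)) / D2 (loE a) (hiE a)"
    using d by (simp add: eq_divide_eq)
  then show ?thesis unfolding slope_def icpt_def by (simp add: add_divide_distrib)
qed

lemma plane_comb_eq:
  assumes "\<not> radial N a" "x = \<alpha> *\<^sub>R loE a + \<beta> *\<^sub>R hiE a"
  shows "x \<bullet> e = slope a * (x \<bullet> u) + icpt a * (x \<bullet> w)"
  unfolding assms(2) using plane_eq[OF assms(1), of "loE a"] plane_eq[OF assms(1), of "hiE a"]
  by (simp add: inner_add_left algebra_simps)

text \<open>By Cramer's rule the coefficients are quotients of \<open>D2\<close>. For an end inside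
  the half-space the sign is a comparison of abscissas; for an end outside it follows from the order
  of the two ends.\<close>

lemma seg_param:
  assumes a: "a \<in> seg A" and y: "0 < y \<bullet> w" "y \<bullet> e = ht A a (absc y) * (y \<bullet> w)"
    and X: "lf A a \<le> absc y" "absc y \<le> rt A a"
  shows "\<exists>\<alpha>\<ge>0. \<exists>\<beta>\<ge>0. y = \<alpha> *\<^sub>R loE a + \<beta> *\<^sub>R hiE a \<and> (over A a (absc y) \<longrightarrow> 0 < \<alpha> \<and> 0 < \<beta>)"
proof -
  let ?l = "loE a" and ?h = "hiE a"
  have nr: "\<not> radial N a" using segD(2)[OF a] .
  have d: "D2 ?l ?h < 0" using D2_lo_hi[OF nr] .
  define \<alpha> \<beta> where "\<alpha> = D2 y ?h / D2 ?l ?h" and "\<beta> = D2 ?l y / D2 ?l ?h"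
  have xy: "y \<bullet> u = absc y * (y \<bullet> w)" using y by (simp add: absc_def)
  have id: "D2 y ?h * (?l \<bullet> u) + D2 ?l y * (?h \<bullet> u) = (y \<bullet> u) * D2 ?l ?h"
    "D2 y ?h * (?l \<bullet> w) + D2 ?l y * (?h \<bullet> w) = (y \<bullet> w) * D2 ?l ?h"
    by (simp_all add: D2_def algebra_simps)
  have yu: "y \<bullet> u = \<alpha> * (?l \<bullet> u) + \<beta> * (?h \<bullet> u)"
    and yw: "y \<bullet> w = \<alpha> * (?l \<bullet> w) + \<beta> * (?h \<bullet> w)"
    using id d by (simp_all add: \<alpha>_def \<beta>_def field_simps)
  have ye: "y \<bullet> e = slope a * (y \<bullet> u) + icpt a * (y \<bullet> w)" using y xy by (simp add: A_sel algebra_simps)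
  have eq: "y = \<alpha> *\<^sub>R ?l + \<beta> *\<^sub>R ?h"
  proof (rule vec_eqI)
    show "y \<bullet> e = (\<alpha> *\<^sub>R ?l + \<beta> *\<^sub>R ?h) \<bullet> e"
      unfolding plane_comb_eq[OF nr refl] ye yu yw by (simp add: inner_add_left)
  qed (simp_all add: inner_add_left yu yw)
  have dl: "D2 ?l y = (absc ?l - absc y) * (?l \<bullet> w) * (y \<bullet> w)" if "0 < ?l \<bullet> w"
    using that y by (simp add: D2_def absc_def field_simps)
  have dh: "D2 y ?h = (absc y - absc ?h) * (?h \<bullet> w) * (y \<bullet> w)" if "0 < ?h \<bullet> w"
    using that y by (simp add: D2_def absc_def field_simps)
  have "D2 y ?h \<le> 0 \<and> (over A a (absc y) \<longrightarrow> D2 y ?h < 0)"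
  proof (cases "0 < ?h \<bullet> w")
    case True
    then show ?thesis using X y by (auto simp: dh A_sel over_def mult_le_0_iff mult_less_0_iff)
  next
    case False
    then have l: "0 < ?l \<bullet> w" using segD(4)[OF a] by simp
    have "(y \<bullet> u) * (?l \<bullet> w) \<ge> (?l \<bullet> u) * (y \<bullet> w)"
      using X l y by (simp add: A_sel absc_def field_simps)
    then have "((y \<bullet> u) * (?l \<bullet> w)) * (?h \<bullet> w) \<le> ((?l \<bullet> u) * (y \<bullet> w)) * (?h \<bullet> w)"
      using False by (intro mult_right_mono_neg) auto
    moreover have "(?l \<bullet> u) * (?h \<bullet> w) * (y \<bullet> w) < (?h \<bullet> u) * (?l \<bullet> w) * (y \<bullet> w)"
      using d y by (intro mult_strict_right_mono) (auto simp: D2_def)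
    ultimately have "(?l \<bullet> w) * D2 y ?h < 0" by (simp add: D2_def algebra_simps)
    then show ?thesis using l by (simp add: mult_less_0_iff)
  qed
  moreover have "D2 ?l y \<le> 0 \<and> (over A a (absc y) \<longrightarrow> D2 ?l y < 0)"
  proof (cases "0 < ?l \<bullet> w")
    case True
    then show ?thesis using X y by (auto simp: dl A_sel over_def mult_le_0_iff mult_less_0_iff)
  next
    case False
    then have h: "0 < ?h \<bullet> w" using segD(4)[OF a] by simp
    have "(y \<bullet> u) * (?h \<bullet> w) \<le> (?h \<bullet> u) * (y \<bullet> w)"
      using X h y by (simp add: A_sel absc_def field_simps)
    then have "((?h \<bullet> u) * (y \<bullet> w)) * (?l \<bullet> w) \<le> ((y \<bullet> u) * (?h \<bullet> w)) * (?l \<bullet> w)"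
      using False by (intro mult_right_mono_neg) auto
    moreover have "(?l \<bullet> u) * (?h \<bullet> w) * (y \<bullet> w) < (?h \<bullet> u) * (?l \<bullet> w) * (y \<bullet> w)"
      using d y by (intro mult_strict_right_mono) (auto simp: D2_def)
    ultimately have "(?h \<bullet> w) * D2 ?l y < 0" by (simp add: D2_def algebra_simps)
    then show ?thesis using h by (simp add: mult_less_0_iff)
  qed
  ultimately have "0 \<le> \<alpha>" "0 \<le> \<beta>" "over A a (absc y) \<longrightarrow> 0 < \<alpha> \<and> 0 < \<beta>"
    using d by (auto simp: \<alpha>_def \<beta>_def divide_nonpos_neg zero_less_divide_iff)
  then show ?thesis using eq by blast
qed

lemma seg_relint:
  assumes a: "a \<in> seg A" and x: "x \<in> arc_relint a" "0 < x \<bullet> w" "\<bar>absc x\<bar> < wid"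
  shows "over A a (absc x)" "ht A a (absc x) = elev x"
proof -
  let ?l = "loE a" and ?h = "hiE a"
  have nr: "\<not> radial N a" using segD(2)[OF a] .
  have d: "D2 ?l ?h < 0" using D2_lo_hi[OF nr] .
  obtain \<alpha> \<beta> where ab: "0 < \<alpha>" "0 < \<beta>" "x = \<alpha> *\<^sub>R ?l + \<beta> *\<^sub>R ?h" using relintE[OF segD(3)[OF a] x(1) ends_lo_hi] .
  have dh: "D2 x ?h = \<alpha> * D2 ?l ?h" "D2 ?l x = \<beta> * D2 ?l ?h"
    unfolding ab D2_def by (simp_all add: inner_add_left algebra_simps)
  have neg: "D2 x ?h < 0" "D2 ?l x < 0" using dh ab d by (simp_all add: mult_pos_neg)
  have "absc x < rt A a"
  proof (cases "0 < ?h \<bullet> w")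
    case True then show ?thesis using neg(1) x by (simp add: A_sel absc_def D2_def field_simps)
  next
    case False then show ?thesis using x by (simp add: A_sel)
  qed
  moreover have "lf A a < absc x"
  proof (cases "0 < ?l \<bullet> w")
    case True then show ?thesis using neg(2) x by (simp add: A_sel absc_def D2_def field_simps)
  next
    case False then show ?thesis using x by (simp add: A_sel)
  qed
  ultimately show "over A a (absc x)" by (simp add: over_def)
  show "ht A a (absc x) = elev x"
    using plane_comb_eq[OF nr ab(3)] x by (simp add: A_sel absc_def elev_def field_simps)
qed

lemma seg_pos:
  assumes a: "a \<in> seg A" and X: "lf A a \<le> Y" "Y \<le> rt A a" shows "0 < ht A a Y"
proof -
  obtain y where y: "y \<bullet> u = Y" "y \<bullet> w = 1" "y \<bullet> e = ht A a Y" using vec_exists by blast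
  then have "absc y = Y" by (simp add: absc_def)
  then obtain \<alpha> \<beta> where ab: "0 \<le> \<alpha>" "0 \<le> \<beta>" "y = \<alpha> *\<^sub>R loE a + \<beta> *\<^sub>R hiE a"
    using seg_param[OF a, of y] y X by auto
  have "\<alpha> \<noteq> 0 \<or> \<beta> \<noteq> 0" using ab y(2) by auto
  then have "0 < \<alpha> * (loE a \<bullet> e) + \<beta> * (hiE a \<bullet> e)"
    using ab(1,2) segD(5,6)[OF a] by (smt (verit) mult_nonneg_nonneg mult_pos_pos)
  then show ?thesis using ab y by (simp add: inner_add_left)
qed

text \<open>A radial arc can leave the half-space only at its upper end. A crossing arc stays on one
  side of the axis, so both its ends are inside.\<close>

lemma ver_facts:
  assumes v: "v \<in> ver A"
  shows "v \<in> D" "radial N v" "E2 (botE v) (topE v) < 0" "D2 (botE v) (topE v) = 0" "0 < botE v \<bullet> w" "0 < topE v \<bullet> e"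
    "botE v \<bullet> e \<le> 0 \<Longrightarrow> 0 < topE v \<bullet> w"
proof -
  show D: "v \<in> D" and r: "radial N v" using v by (auto simp: A_sel)
  show D20: "D2 (botE v) (topE v) = 0" using radial_iff_D2[OF ends_bot_top] r by blast
  obtain x y where xy: "ends v x y" "0 < x \<bullet> w" "0 < x \<bullet> e" using v by (auto simp: A_sel)
  have E0: "E2 x y \<noteq> 0"
  proof
    assume E: "E2 x y = 0"
    have D: "D2 x y = 0" using radial_iff_D2[OF xy(1)] r by blast
    have "(y \<bullet> w) *\<^sub>R x + (- (x \<bullet> w)) *\<^sub>R y = 0"
      by (rule vec_eqI) (use D E in \<open>simp_all add: D2_def E2_def inner_diff_left algebra_simps\<close>)
    from valid_indep(2)[OF valid[OF \<open>v \<in> D\<close>] xy(1) this] xy show False by simp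
  qed
  have bt: "(botE v = x \<and> topE v = y \<and> E2 x y < 0) \<or> (botE v = y \<and> topE v = x \<and> E2 y x < 0)"
  proof -
    have s: "E2 y x = - E2 x y" by (rule E2_swap)
    consider "v = (x, y)" | "v = (y, x)" using xy(1) by (auto simp: ends_def)
    then show ?thesis
    proof cases
      case 1 then show ?thesis using E0 s by (cases "E2 x y < 0") (simp_all add: botE_def topE_def)
    next
      case 2 then show ?thesis using E0 s by (cases "E2 x y < 0") (simp_all add: botE_def topE_def)
    qed
  qed
  then show "E2 (botE v) (topE v) < 0" by auto
  have "0 < botE v \<bullet> w \<and> 0 < topE v \<bullet> e \<and> (botE v \<bullet> e \<le> 0 \<longrightarrow> 0 < topE v \<bullet> w)"
  proof (cases "0 < y \<bullet> e")
    case True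
    have "0 < y \<bullet> w" if "E2 y x < 0"
    proof (rule ccontr)
      assume "\<not> 0 < y \<bullet> w"
      then have "(x \<bullet> e) * (y \<bullet> w) \<le> 0" using xy by (simp add: mult_nonneg_nonpos)
      moreover have "0 < (y \<bullet> e) * (x \<bullet> w)" using True xy by simp
      ultimately show False using that by (simp add: E2_def)
    qed
    then show ?thesis using bt xy True by auto
  next
    case False
    then have m: "mixed v" using mixedI[OF D _ xy(1,3)] upperD(2)[OF _ ends_sym[OF xy(1)]] by blast
    obtain t s \<kappa> \<mu> where ts: "ends v t s" "0 < t \<bullet> e" "s \<bullet> e \<le> 0" "s = \<kappa> *\<^sub>R t + \<mu> *\<^sub>R N" "0 < \<kappa>"
      using mixedE[OF m] by metis
    have tx: "t = x" "s = y" using ts xy False by (auto simp: ends_def)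
    have "s \<bullet> w = \<kappa> * (t \<bullet> w)" unfolding ts(4) using frame by (simp add: inner_add_left)
    then have yw: "0 < y \<bullet> w" using ts(5) xy tx by simp
    have "(y \<bullet> e) * (x \<bullet> w) \<le> 0" "0 < (x \<bullet> e) * (y \<bullet> w)" using False xy yw by (simp_all add: mult_nonpos_nonneg)
    then have "\<not> E2 x y < 0" by (simp add: E2_def)
    then show ?thesis using bt xy yw by auto
  qed
  then show "0 < botE v \<bullet> w" "0 < topE v \<bullet> e" "botE v \<bullet> e \<le> 0 \<Longrightarrow> 0 < topE v \<bullet> w" by auto
qed

lemma ver_param:
  assumes v: "v \<in> ver A" and y: "0 < y \<bullet> w" "0 < y \<bullet> e" "absc y = xv A v" "bt A v < elev y"
    "0 < topE v \<bullet> w \<Longrightarrow> elev y < elev (topE v)"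
  shows "\<exists>\<alpha>>0. \<exists>\<beta>>0. y = \<alpha> *\<^sub>R botE v + \<beta> *\<^sub>R topE v"
proof -
  let ?b = "botE v" and ?t = "topE v"
  note f = ver_facts[OF v]
  define \<alpha> \<beta> where "\<alpha> = E2 y ?t / E2 ?b ?t" and "\<beta> = E2 ?b y / E2 ?b ?t"
  have c: "y \<bullet> u = absc ?b * (y \<bullet> w)" "?b \<bullet> u = absc ?b * (?b \<bullet> w)"
    using y f by (auto simp: A_sel absc_def field_simps)
  have "(?t \<bullet> u) * (?b \<bullet> w) = (?b \<bullet> u) * (?t \<bullet> w)" using f(4) by (simp add: D2_def)
  also have "\<dots> = (absc ?b * (?t \<bullet> w)) * (?b \<bullet> w)" unfolding c(2) by (simp only: mult_ac)
  finally have ct: "?t \<bullet> u = absc ?b * (?t \<bullet> w)" using f(5) by simp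
  have id: "E2 y ?t * (?b \<bullet> w) + E2 ?b y * (?t \<bullet> w) = (y \<bullet> w) * E2 ?b ?t"
    "E2 y ?t * (?b \<bullet> e) + E2 ?b y * (?t \<bullet> e) = (y \<bullet> e) * E2 ?b ?t"
    by (simp_all add: E2_def algebra_simps)
  have yw: "y \<bullet> w = \<alpha> * (?b \<bullet> w) + \<beta> * (?t \<bullet> w)" and ye: "y \<bullet> e = \<alpha> * (?b \<bullet> e) + \<beta> * (?t \<bullet> e)"
    using id f(3) unfolding \<alpha>_def \<beta>_def by (simp_all add: field_simps)
  have eq: "y = \<alpha> *\<^sub>R ?b + \<beta> *\<^sub>R ?t"
  proof (rule vec_eqI)
    have "y \<bullet> u = \<alpha> * (absc ?b * (?b \<bullet> w)) + \<beta> * (absc ?b * (?t \<bullet> w))" unfolding c(1) yw by (simp add: algebra_simps)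
    then show "y \<bullet> u = (\<alpha> *\<^sub>R ?b + \<beta> *\<^sub>R ?t) \<bullet> u" using c(2) ct by (simp add: inner_add_left)
  qed (simp_all add: inner_add_left yw ye)
  have "E2 y ?t < 0"
  proof (cases "0 < ?t \<bullet> w")
    case True then show ?thesis using y by (simp add: E2_def elev_def field_simps)
  next
    case False
    then have "(y \<bullet> e) * (?t \<bullet> w) \<le> 0" using y by (simp add: mult_nonneg_nonpos)
    moreover have "0 < (?t \<bullet> e) * (y \<bullet> w)" using y f by simp
    ultimately show ?thesis by (simp add: E2_def)
  qed
  moreover have "E2 ?b y < 0"
  proof (cases "0 < ?b \<bullet> e")
    case True then show ?thesis using y f by (simp add: A_sel E2_def elev_def field_simps)
  next
    case False
    then have "(?b \<bullet> e) * (y \<bullet> w) \<le> 0" using y by (simp add: mult_nonpos_nonneg)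
    moreover have "0 < (y \<bullet> e) * (?b \<bullet> w)" using y f by simp
    ultimately show ?thesis by (simp add: E2_def)
  qed
  ultimately have "0 < \<alpha>" "0 < \<beta>" using f(3) by (simp_all add: \<alpha>_def \<beta>_def zero_less_divide_iff)
  then show ?thesis using eq by blast
qed

lemma ver_relint:
  assumes v: "v \<in> ver A" and x: "x \<in> arc_relint v" "0 < x \<bullet> w" "0 < x \<bullet> e"
  shows "absc x = xv A v" "bt A v < elev x" "0 < topE v \<bullet> w \<Longrightarrow> elev x < elev (topE v)"
proof -
  let ?b = "botE v" and ?t = "topE v"
  note f = ver_facts[OF v]
  obtain \<alpha> \<beta> where ab: "0 < \<alpha>" "0 < \<beta>" "x = \<alpha> *\<^sub>R ?b + \<beta> *\<^sub>R ?t" using relintE[OF f(1) x(1) ends_bot_top] .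
  have "D2 ?b x = \<beta> * D2 ?b ?t" unfolding ab D2_def by (simp add: inner_add_left algebra_simps)
  then show "absc x = xv A v" using f x by (simp add: A_sel absc_def D2_def field_simps)
  have e: "E2 ?b x = \<beta> * E2 ?b ?t" "E2 x ?t = \<alpha> * E2 ?b ?t" unfolding ab E2_def by (simp_all add: inner_add_left algebra_simps)
  then have neg: "E2 ?b x < 0" "E2 x ?t < 0" using ab f by (simp_all add: mult_pos_neg)
  show "bt A v < elev x"
  proof (cases "0 < ?b \<bullet> e")
    case True then show ?thesis using neg f x by (simp add: A_sel E2_def elev_def field_simps)
  next
    case False
    have "0 < elev x" using x by (simp add: elev_def)
    then show ?thesis using False by (simp add: A_sel)
  qed
  show "elev x < elev ?t" if "0 < ?t \<bullet> w" using neg that x by (simp add: E2_def elev_def field_simps)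
qed

lemma blocker_kinds:
  assumes "b \<in> D" "x \<in> arc_relint b" "0 < x \<bullet> w" "0 < x \<bullet> e"
  shows "b \<in> seg A \<or> b \<in> ver A"
proof -
  obtain \<alpha> \<beta> where ab: "0 < \<alpha>" "0 < \<beta>" "x = \<alpha> *\<^sub>R fst b + \<beta> *\<^sub>R snd b" using relintE[OF assms(1,2) ends_self] .
  have "0 < \<alpha> * (fst b \<bullet> w) + \<beta> * (snd b \<bullet> w)" using assms ab by (simp add: inner_add_left)
  then have e: "0 < fst b \<bullet> w \<or> 0 < snd b \<bullet> w" using ab by (smt (verit) mult_nonneg_nonpos)
  show ?thesis
    using above_kinds[OF assms(1,2,4)]
  proof
    assume u: "upper b"
    then have "0 < fst b \<bullet> e" "0 < snd b \<bullet> e" by (auto simp: upper_def)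
    then have "\<exists>x y. ends b x y \<and> 0 < x \<bullet> w \<and> 0 < x \<bullet> e" using e ends_self[of b] ends_sym[OF ends_self[of b]] by blast
    then show ?thesis using u e assms(1) by (auto simp: A_sel)
  next
    assume m: "mixed b"
    obtain t s \<kappa> \<mu> where ts: "ends b t s" "0 < t \<bullet> e" "s \<bullet> e \<le> 0" "s = \<kappa> *\<^sub>R t + \<mu> *\<^sub>R N" "0 < \<kappa>"
      using mixedE[OF m] by metis
    have "s \<bullet> w = \<kappa> * (t \<bullet> w)" unfolding ts(4) using frame by (simp add: inner_add_left)
    moreover have "0 < t \<bullet> w \<or> 0 < s \<bullet> w" using e ts(1) by (auto simp: ends_def)
    ultimately have "0 < t \<bullet> w" using ts by (auto simp: zero_less_mult_iff)
    then have "b \<in> ver A" using ts(1,2) mixed_meridian[OF m] unfolding A_sel by blast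
    then show ?thesis by blast
  qed
qed

text \<open>Blocking in the chart; by \<open>radial_touch\<close> a vertical is never blocked by a
  vertical.\<close>

lemma end_blocked:
  assumes a: "a \<in> D" "ends a x y" and x: "0 < x \<bullet> w" "0 < x \<bullet> e"
  shows "(\<exists>b\<in>seg A. x \<in> arc_relint b \<and> over A b (absc x) \<and> ht A b (absc x) = elev x) \<or>
    (\<exists>v\<in>ver A. x \<in> arc_relint v \<and> xv A v = absc x \<and> bt A v < elev x \<and> elev x < tp A v \<and> \<not> radial N a)"
proof -
  obtain b where b: "b \<in> D" "x \<in> arc_relint b" using blocked[OF a] by blast
  from blocker_kinds[OF b x] show ?thesis
  proof
    assume s: "b \<in> seg A"
    then show ?thesis using seg_relint[OF s b(2) x(1) absc_bound[OF a]] b by blast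
  next
    assume v: "b \<in> ver A"
    have "\<not> radial N a"
    proof
      assume "radial N a"
      then show False using radial_touch[OF a _ b(1) ver_facts(2)[OF v] b(2), of w] x frame by simp
    qed
    moreover have "elev x < tp A b" using ver_relint(3)[OF v b(2) x] ceilg_bounds(2)[OF a] by (simp add: A_sel)
    ultimately show ?thesis using ver_relint[OF v b(2) x] v b(2) by fastforce
  qed
qed

lemma over_wid: "a \<in> seg A \<Longrightarrow> over A a Y \<Longrightarrow> \<bar>Y\<bar> \<le> wid"
  using absc_bound[OF segD(3) ends_lo_hi, of a] absc_bound[OF segD(3) ends_sym[OF ends_lo_hi], of a]
  by (auto simp: over_def A_sel split: if_splits)

text \<open>An upper end outside the half-space is projected beyond infinity upwards, which yields
  the slope conditions. The verticals with free lower end are those reaching down to the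
  equator.\<close>

sublocale half_arrangement A
proof
  have "seg A \<subseteq> D" "ver A \<subseteq> D" using segD(3) ver_facts(1) by blast+
  then show "finite (seg A)" "finite (ver A)" using finD by (blast intro: finite_subset)+
  show "seg A \<inter> ver A = {}" using segD(2) ver_facts(2) by blast
next
  fix a assume a: "a \<in> seg A"
  have d: "D2 (loE a) (hiE a) < 0" using D2_lo_hi segD(2)[OF a] by blast
  have b: "\<bar>absc (loE a)\<bar> < wid" "\<bar>absc (hiE a)\<bar> < wid"
    using absc_bound[OF segD(3)[OF a]] ends_lo_hi ends_sym by blast+
  show "lf A a < rt A a" using b d wid_pos by (auto simp: A_sel absc_def D2_def field_simps)
  show "a \<notin> rbl A \<Longrightarrow> rt A a = wd A" "a \<notin> lbl A \<Longrightarrow> lf A a = - wd A" by (auto simp: A_sel)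
  show "a \<in> rbl A \<Longrightarrow> rt A a < wd A" "a \<in> lbl A \<Longrightarrow> - wd A < lf A a" using b by (auto simp: A_sel)
  show "ht A a X = ht A a Y + sl A a * (X - Y)" for X Y by (simp add: A_sel algebra_simps)
  show "0 < ht A a X" if "lf A a \<le> X" "X \<le> rt A a" for X using seg_pos[OF a that] .
  have hte: "ht A a (absc x) = elev x" if "x \<in> {loE a, hiE a}" "0 < x \<bullet> w" for x
    using plane_eq[OF segD(2)[OF a] that(1)] that(2) by (simp add: A_sel absc_def elev_def field_simps)
  show "(\<exists>b\<in>seg A. over A b (rt A a) \<and> ht A b (rt A a) = ht A a (rt A a)) \<or>
       (\<exists>v\<in>ver A. xv A v = rt A a \<and> bt A v < ht A a (rt A a) \<and> ht A a (rt A a) < tp A v)" if "a \<in> rbl A"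
    using end_blocked[OF segD(3)[OF a] ends_sym[OF ends_lo_hi]] segD(6)[OF a] that hte[of "hiE a"] by (auto simp: A_sel(4,11))
  show "(\<exists>b\<in>seg A. over A b (lf A a) \<and> ht A b (lf A a) = ht A a (lf A a)) \<or>
       (\<exists>v\<in>ver A. xv A v = lf A a \<and> bt A v < ht A a (lf A a) \<and> ht A a (lf A a) < tp A v)" if "a \<in> lbl A"
    using end_blocked[OF segD(3)[OF a] ends_lo_hi] segD(5)[OF a] that hte[of "loE a"] by (auto simp: A_sel(3,10))
  show "0 < sl A a" if "a \<notin> rbl A"
  proof -
    have h: "hiE a \<bullet> w \<le> 0" "0 < loE a \<bullet> w" using that segD(4)[OF a] by (auto simp: A_sel)
    then have "(loE a \<bullet> e) * (hiE a \<bullet> w) \<le> 0" "0 < (hiE a \<bullet> e) * (loE a \<bullet> w)"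
      using segD(5,6)[OF a] by (simp_all add: mult_nonneg_nonpos)
    then show ?thesis using d by (simp add: A_sel slope_def E2_def zero_less_divide_iff)
  qed
  show "sl A a < 0" if "a \<notin> lbl A"
  proof -
    have h: "loE a \<bullet> w \<le> 0" "0 < hiE a \<bullet> w" using that segD(4)[OF a] by (auto simp: A_sel)
    then have "(hiE a \<bullet> e) * (loE a \<bullet> w) \<le> 0" "0 < (loE a \<bullet> e) * (hiE a \<bullet> w)"
      using segD(5,6)[OF a] by (simp_all add: mult_nonneg_nonpos)
    then show ?thesis using d by (simp add: A_sel slope_def E2_def divide_less_0_iff)
  qed
next
  fix a b X assume a: "a \<in> seg A" "b \<in> seg A" "over A a X" "over A b X" "ht A a X = ht A b X"
  obtain y where y: "y \<bullet> u = X" "y \<bullet> w = 1" "y \<bullet> e = ht A a X" using vec_exists by blast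
  have X: "absc y = X" using y by (simp add: absc_def)
  obtain \<alpha> \<beta> where 1: "0 < \<alpha>" "0 < \<beta>" "y = \<alpha> *\<^sub>R loE a + \<beta> *\<^sub>R hiE a"
    using seg_param[OF a(1), of y] X y a by (auto simp: over_def)
  obtain \<gamma> \<delta> where 2: "0 < \<gamma>" "0 < \<delta>" "y = \<gamma> *\<^sub>R loE b + \<delta> *\<^sub>R hiE b"
    using seg_param[OF a(2), of y] X y a by (auto simp: over_def)
  show "a = b" using cone_disjoint[OF segD(3)[OF a(1)] segD(3)[OF a(2)] ends_lo_hi ends_lo_hi 1(1,2) 2(1,2)] 1(3) 2(3) by simp
next
  fix a v assume a: "a \<in> seg A" "v \<in> ver A" "over A a (xv A v)" "bt A v < ht A a (xv A v)" "ht A a (xv A v) < tp A v"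
  obtain y where y: "y \<bullet> u = xv A v" "y \<bullet> w = 1" "y \<bullet> e = ht A a (xv A v)" using vec_exists by blast
  have X: "absc y = xv A v" "elev y = ht A a (xv A v)" using y by (simp_all add: absc_def elev_def)
  obtain \<alpha> \<beta> where 1: "0 < \<alpha>" "0 < \<beta>" "y = \<alpha> *\<^sub>R loE a + \<beta> *\<^sub>R hiE a"
    using seg_param[OF a(1), of y] X y a by (auto simp: over_def)
  have pos: "0 < y \<bullet> e" using seg_pos[OF a(1), of "xv A v"] a(3) y by (simp add: over_def)
  obtain \<gamma> \<delta> where 2: "0 < \<gamma>" "0 < \<delta>" "y = \<gamma> *\<^sub>R botE v + \<delta> *\<^sub>R topE v"
  proof -
    have "elev y < elev (topE v)" if "0 < topE v \<bullet> w" using a(5) X that by (simp add: A_sel(9))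
    moreover have "bt A v < elev y" "0 < y \<bullet> w" using a(4) X y by simp_all
    ultimately show ?thesis using ver_param[OF a(2) _ pos X(1)] that by blast
  qed
  have "a = v" using cone_disjoint[OF segD(3)[OF a(1)] ver_facts(1)[OF a(2)] ends_lo_hi ends_bot_top 1(1,2) 2(1,2)] 1(3) 2(3) by simp
  then show False using segD(2)[OF a(1)] ver_facts(2)[OF a(2)] by simp
next
  fix v assume v: "v \<in> ver A"
  note f = ver_facts[OF v]
  show "- wd A < xv A v \<and> xv A v < wd A" using absc_bound[OF f(1) ends_bot_top] by (auto simp: A_sel abs_less_iff)
  have xt: "absc (topE v) = xv A v" if "0 < topE v \<bullet> w" using f that by (simp add: A_sel absc_def D2_def field_simps)
  show "\<exists>a\<in>seg A. over A a (xv A v) \<and> ht A a (xv A v) = tp A v" if "v \<in> tbl A"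
    using end_blocked[OF f(1) ends_sym[OF ends_bot_top]] that f xt by (auto simp: A_sel(9,13))
  show "\<exists>a\<in>seg A. over A a (xv A v) \<and> ht A a (xv A v) = bt A v" if "v \<in> bbl A"
    using end_blocked[OF f(1) ends_bot_top] that f by (auto simp: A_sel(7,8,12))
  show "ht A a (xv A v) < tp A v" if "v \<notin> tbl A" "a \<in> seg A" "over A a (xv A v)" for a
    using ceilg_bounds(1)[OF segD(3)[OF that(2)] over_wid[OF that(2,3)]] that by (simp add: A_sel)
  show "bt A v < ht A a (xv A v)" if "v \<notin> bbl A" "a \<in> seg A" "over A a (xv A v)" for a
  proof -
    have "0 < ht A a (xv A v)" using seg_pos[OF that(2)] that(3) by (simp add: over_def)
    moreover have "bt A v = - 1" using that(1) by (simp add: A_sel)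
    ultimately show ?thesis by simp
  qed
  show "v \<in> tbl A \<and> bt A v < 0" if "v \<notin> bbl A" using that f by (auto simp: A_sel)
next
  fix v v' assume v: "v \<in> ver A" "v \<notin> bbl A" "v' \<in> ver A" "v' \<notin> bbl A" "xv A v = xv A v'"
  note f = ver_facts[OF v(1)] and f' = ver_facts[OF v(3)]
  have t: "0 < topE v \<bullet> w" "0 < topE v' \<bullet> w" using f(7) f'(7) v by (auto simp: A_sel)
  have el: "0 < elev (topE v)" "0 < elev (topE v')" using t f f' by (simp_all add: elev_def)
  \<comment> \<open>Both verticals pass through this height, below their tops and above their
    bottoms, so the two arcs meet.\<close>
  define \<epsilon> where "\<epsilon> = min (elev (topE v)) (elev (topE v')) / 2"
  have \<epsilon>: "0 < \<epsilon>" "\<epsilon> < elev (topE v)" "\<epsilon> < elev (topE v')" using el by (auto simp: \<epsilon>_def min_def)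
  obtain y where y: "y \<bullet> u = xv A v" "y \<bullet> w = 1" "y \<bullet> e = \<epsilon>" using vec_exists by blast
  have X: "absc y = xv A v" "absc y = xv A v'" "elev y = \<epsilon>" using y v by (simp_all add: absc_def elev_def)
  have bt: "bt A v = - 1" "bt A v' = - 1" using v by (simp_all add: A_sel)
  obtain \<alpha> \<beta> where 1: "0 < \<alpha>" "0 < \<beta>" "y = \<alpha> *\<^sub>R botE v + \<beta> *\<^sub>R topE v"
  proof -
    have "\<exists>\<alpha>>0. \<exists>\<beta>>0. y = \<alpha> *\<^sub>R botE v + \<beta> *\<^sub>R topE v"
      by (rule ver_param[OF v(1) _ _ X(1)]) (use y \<epsilon> X bt in simp_all)
    then show ?thesis using that by blast
  qed
  obtain \<gamma> \<delta> where 2: "0 < \<gamma>" "0 < \<delta>" "y = \<gamma> *\<^sub>R botE v' + \<delta> *\<^sub>R topE v'"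
  proof -
    have "\<exists>\<alpha>>0. \<exists>\<beta>>0. y = \<alpha> *\<^sub>R botE v' + \<beta> *\<^sub>R topE v'"
      by (rule ver_param[OF v(3) _ _ X(2)]) (use y \<epsilon> X bt in simp_all)
    then show ?thesis using that by blast
  qed
  show "v = v'" using cone_disjoint[OF f(1) f'(1) ends_bot_top ends_bot_top 1(1,2) 2(1,2)] 1(3) 2(3) by simp
qed

end

section \<open>Closed walks are swirls\<close>

text \<open>Orbits in a finite set are eventually periodic; the least period keeps the states of the
  cycle distinct.\<close>

lemma periodic_point:
  assumes "finite S" "S \<noteq> {}" "\<And>s. s \<in> S \<Longrightarrow> f s \<in> S"
  obtains s m where "s \<in> S" "0 < m" "(f ^^ m) s = s" "inj_on (\<lambda>i. (f ^^ i) s) {..<m}" "\<And>i. (f ^^ i) s \<in> S"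
proof -
  obtain s0 where s0: "s0 \<in> S" using assms by blast
  have orb: "(f ^^ i) s \<in> S" if "s \<in> S" for i s using that assms(3) by (induction i) auto
  have "\<not> inj_on (\<lambda>i. (f ^^ i) s0) (UNIV :: nat set)"
    using finite_imageD[of "\<lambda>i. (f ^^ i) s0" UNIV] finite_subset[OF _ assms(1), of "range (\<lambda>i. (f ^^ i) s0)"] orb[OF s0]
    by auto
  then obtain i j where "(f ^^ i) s0 = (f ^^ j) s0" "i < j" by (auto simp: inj_on_def) (metis linorder_neqE_nat)
  define s where "s = (f ^^ i) s0"
  have s: "s \<in> S" using orb s0 by (simp add: s_def)
  have "(f ^^ (j - i)) s = (f ^^ j) s0"
    using \<open>i < j\<close> by (simp add: s_def funpow_add[symmetric, THEN fun_cong, unfolded comp_def])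
  then have ex: "0 < j - i \<and> (f ^^ (j - i)) s = s" using \<open>i < j\<close> \<open>(f ^^ i) s0 = (f ^^ j) s0\<close> by (simp add: s_def)
  define m where "m = (LEAST m. 0 < m \<and> (f ^^ m) s = s)"
  have m: "0 < m" "(f ^^ m) s = s" using LeastI[of "\<lambda>m. 0 < m \<and> (f ^^ m) s = s", OF ex] by (auto simp: m_def)
  have no: False if "a < b" "b < m" "(f ^^ a) s = (f ^^ b) s" for a b
  proof -
    have "(f ^^ (m - b + a)) s = (f ^^ (m - b)) ((f ^^ b) s)" using that(3) by (simp only: funpow_add comp_def)
    also have "\<dots> = (f ^^ (m - b + b)) s" by (simp only: funpow_add comp_def)
    also have "\<dots> = s" using that m by simp
    finally have "0 < m - b + a \<and> (f ^^ (m - b + a)) s = s" using that by simp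
    moreover have "m - b + a < m" using that by simp
    ultimately show False using not_less_Least[of "m - b + a" "\<lambda>m. 0 < m \<and> (f ^^ m) s = s"] by (simp add: m_def)
  qed
  have "inj_on (\<lambda>i. (f ^^ i) s) {..<m}"
    by (rule inj_onI) (metis lessThan_iff linorder_neqE_nat no)
  then show thesis using that[OF s m] orb[OF s] by blast
qed

text \<open>An invariant under rotation of the list, used to tell swirls apart and to locate
  them.\<close>

definition corners :: "arc list \<Rightarrow> point set" where
  "corners xs = {x. \<exists>i<length xs. (\<exists>y. ends (xs ! i) x y) \<and> x \<in> arc_relint (xs ! ((i + 1) mod length xs))}"

context diagram begin

text \<open>Two ends of \<open>a\<close> on \<open>b\<close> would put \<open>a\<close> into the
  plane of \<open>b\<close>.\<close>

lemma corner_unique: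
  assumes "a \<in> D" "b \<in> D" "ends a x y" "x \<in> arc_relint b" "ends a x' y'" "x' \<in> arc_relint b"
  shows "x' = x"
proof (rule ccontr)
  assume "x' \<noteq> x"
  then have "x' = y" using assms by (auto simp: ends_def)
  obtain \<gamma> \<delta> where "y = \<gamma> *\<^sub>R fst b + \<delta> *\<^sub>R snd b" using relintE[OF assms(2,6) ends_self] \<open>x' = y\<close> by metis
  then show False using coplanar_touch[OF assms(1,3,2) ends_self assms(4)] by blast
qed

text \<open>Fix one successor for each state and take a periodic orbit. The factor \<sigma> treats
  both senses of rotation at once.\<close>

lemma swirl_of_cycle:
  assumes S: "finite S" "S \<noteq> {}" "inj_on fst S"
    and step: "\<And>s. s \<in> S \<Longrightarrow> \<exists>t\<in>S. pt s \<in> arc_relint (fst t) \<and> 0 < \<sigma> * triple (op s) (pt s) (pt t)"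
    and D: "\<And>s. s \<in> S \<Longrightarrow> fst s \<in> D \<and> ends (fst s) (op s) (pt s)"
  obtains xs where "is_swirl D xs" "corners xs \<subseteq> pt ` S"
proof -
  obtain f where f: "\<And>s. s \<in> S \<Longrightarrow> f s \<in> S \<and> pt s \<in> arc_relint (fst (f s)) \<and> 0 < \<sigma> * triple (op s) (pt s) (pt (f s))"
    using step by metis
  obtain s m where s: "s \<in> S" "0 < m" "(f ^^ m) s = s" "inj_on (\<lambda>i. (f ^^ i) s) {..<m}" "\<And>i. (f ^^ i) s \<in> S"
    using periodic_point[OF S(1,2), of f] f by blast
  define st where "st i = (f ^^ i) s" for i
  have stS: "st i \<in> S" for i using s by (simp add: st_def)
  have nxt: "st ((i + 1) mod m) = f (st i)" if "i < m" for i
  proof (cases "i + 1 = m")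
    case True
    then have "f (st i) = (f ^^ m) s" by (auto simp: st_def)
    then show ?thesis using s True by (simp add: st_def)
  qed (use that in \<open>simp add: st_def\<close>)
  define xs where "xs = map (\<lambda>i. fst (st i)) [0..<m]"
  have len: "length xs = m" and nth: "\<And>i. i < m \<Longrightarrow> xs ! i = fst (st i)" by (simp_all add: xs_def)
  have nth1: "xs ! ((i + 1) mod length xs) = fst (f (st i))" if "i < m" for i
    using nth[of "(i + 1) mod m"] nxt[OF that] s(2) len by simp
  have "inj_on st {..<m}" using s(4) by (simp add: inj_on_def st_def)
  moreover have "st ` {..<m} \<subseteq> S" using stS by auto
  then have "inj_on fst (st ` {..<m})" by (rule inj_on_subset[OF S(3)])
  ultimately have "inj_on (\<lambda>i. fst (st i)) {..<m}" by (rule comp_inj_on[unfolded comp_def])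
  then have dist: "distinct xs" by (simp add: xs_def distinct_map lessThan_atLeast0)
  have "fst (st i) \<in> D" for i using D[OF stS] by simp
  then have sub: "set xs \<subseteq> D" unfolding xs_def set_map by blast
  have hit: "\<forall>i<length xs. (xs ! i = (op (st i), pt (st i)) \<or> xs ! i = (pt (st i), op (st i))) \<and>
      pt (st i) \<in> arc_relint (xs ! ((i + 1) mod length xs))"
  proof (intro allI impI)
    fix i assume "i < length xs"
    then have i: "i < m" by (simp add: len)
    show "(xs ! i = (op (st i), pt (st i)) \<or> xs ! i = (pt (st i), op (st i))) \<and>
      pt (st i) \<in> arc_relint (xs ! ((i + 1) mod length xs))"
      unfolding nth1[OF i] nth[OF i] using D[OF stS[of i]] f[OF stS[of i]] by (simp add: ends_def)
  qed
  have t: "0 < \<sigma> * triple (op (st i)) (pt (st i)) (pt (st ((i + 1) mod length xs)))" if "i < length xs" for i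
    using f[OF stS[of i]] nxt[of i] that len by simp
  have turns: "(\<forall>i<length xs. triple (op (st i)) (pt (st i)) (pt (st ((i + 1) mod length xs))) > 0) \<or>
    (\<forall>i<length xs. triple (op (st i)) (pt (st i)) (pt (st ((i + 1) mod length xs))) < 0)"
    using t by (cases "0 < \<sigma>") (auto simp: zero_less_mult_iff)
  have "is_swirl D xs"
    unfolding is_swirl_def
  proof (intro conjI)
    show "xs \<noteq> []" using s(2) by (simp add: xs_def)
    show "distinct xs" "set xs \<subseteq> D" by fact+
  qed (rule exI[of _ "\<lambda>i. pt (st i)"], rule exI[of _ "\<lambda>i. op (st i)"], rule conjI, rule hit, rule turns)
  moreover have "corners xs \<subseteq> pt ` S"
  proof
    fix x assume "x \<in> corners xs"
    then obtain i y where i: "i < m" "ends (xs ! i) x y" "x \<in> arc_relint (xs ! ((i + 1) mod length xs))"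
      by (auto simp: corners_def len)
    have "x = pt (st i)"
    proof (rule corner_unique)
      show "fst (st i) \<in> D" "fst (f (st i)) \<in> D" "ends (fst (st i)) (pt (st i)) (op (st i))" "pt (st i) \<in> arc_relint (fst (f (st i)))"
        using D stS f ends_sym by blast+
      show "ends (fst (st i)) x y" using i nth by simp
      show "x \<in> arc_relint (fst (f (st i)))" using i nth1 by simp
    qed
    then show "x \<in> pt ` S" using stS by blast
  qed
  ultimately show thesis using that by blast
qed

end

section \<open>Signs of turns in the projection\<close>

primrec pt_of :: "('b \<Rightarrow> 'c) \<Rightarrow> ('b \<Rightarrow> 'c) \<Rightarrow> ('b \<Rightarrow> 'c) \<Rightarrow> ('b \<Rightarrow> 'c) \<Rightarrow> dir \<Rightarrow> 'b \<Rightarrow> 'c" where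
  "pt_of l r u d Lt = l" | "pt_of l r u d Rt = r" | "pt_of l r u d Up = u" | "pt_of l r u d Dn = d"

text \<open>Translates a direction of travel in the mirrored chart back to the chart.\<close>

primrec swap_lr :: "dir \<Rightarrow> dir" where
  "swap_lr Lt = Rt" | "swap_lr Rt = Lt" | "swap_lr Up = Up" | "swap_lr Dn = Dn"

context quarter begin

text \<open>\<open>pt\<close> is the end ahead of the walker, \<open>op\<close> the end
  behind.\<close>

definition pt where "pt s = pt_of loE hiE topE botE (snd s) (fst s)"
definition op where "op s = pt_of hiE loE botE topE (snd s) (fst s)"

lemma pt_simps [simp]: "pt (a, Lt) = loE a" "pt (a, Rt) = hiE a" "pt (a, Up) = topE a" "pt (a, Dn) = botE a"
  "op (a, Lt) = hiE a" "op (a, Rt) = loE a" "op (a, Up) = botE a" "op (a, Dn) = topE a"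
  by (simp_all add: pt_def op_def)

text \<open>\<open>D2\<close> of the ends is negative, so the sense of a turn from a segment towards
  \<open>z\<close> depends only on whether \<open>z\<close> is above or below its line.\<close>

lemma seg_triple:
  assumes a: "a \<in> seg A" and z: "0 < z \<bullet> w"
  shows "triple (loE a) (hiE a) z * triple u w e = D2 (loE a) (hiE a) * (z \<bullet> w) * (elev z - ht A a (absc z))"
proof -
  let ?l = "loE a" and ?h = "hiE a"
  have d: "D2 ?l ?h \<noteq> 0" using D2_lo_hi[OF segD(2)[OF a]] by simp
  have s: "E2 ?h ?l = - slope a * D2 ?l ?h" "(?l \<bullet> e) * (?h \<bullet> u) - (?l \<bullet> u) * (?h \<bullet> e) = - icpt a * D2 ?l ?h"
    using d E2_swap[of ?h ?l] by (simp_all add: slope_def icpt_def)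
  have "(z \<bullet> w) * (elev z - ht A a (absc z)) = z \<bullet> e - slope a * (z \<bullet> u) - icpt a * (z \<bullet> w)"
    using z by (simp add: A_sel elev_def absc_def field_simps)
  then have "D2 ?l ?h * (z \<bullet> w) * (elev z - ht A a (absc z)) = D2 ?l ?h * (z \<bullet> e - slope a * (z \<bullet> u) - icpt a * (z \<bullet> w))"
    by (simp only: mult.assoc)
  then show ?thesis unfolding triple_chart s by (simp add: algebra_simps)
qed

lemma ver_triple:
  assumes v: "v \<in> ver A" and z: "0 < z \<bullet> w"
  shows "triple (botE v) (topE v) z * triple u w e = - E2 (botE v) (topE v) * (z \<bullet> w) * (absc z - xv A v)"
proof -
  let ?b = "botE v" and ?t = "topE v" and ?c = "xv A v"
  note f = ver_facts[OF v]
  have b: "?b \<bullet> u = ?c * (?b \<bullet> w)" using f by (simp add: A_sel absc_def)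
  have "(?t \<bullet> u) * (?b \<bullet> w) = (?b \<bullet> u) * (?t \<bullet> w)" using f(4) by (simp add: D2_def)
  also have "\<dots> = (?c * (?t \<bullet> w)) * (?b \<bullet> w)" unfolding b by (simp only: mult_ac)
  finally have t: "?t \<bullet> u = ?c * (?t \<bullet> w)" using f(5) by simp
  have m: "(?b \<bullet> e) * (?t \<bullet> u) - (?b \<bullet> u) * (?t \<bullet> e) = ?c * E2 ?b ?t"
    unfolding b t by (simp add: E2_def algebra_simps)
  have "(z \<bullet> w) * (absc z - ?c) = z \<bullet> u - ?c * (z \<bullet> w)" using z by (simp add: absc_def field_simps)
  then have "- E2 ?b ?t * (z \<bullet> w) * (absc z - ?c) = - E2 ?b ?t * (z \<bullet> u - ?c * (z \<bullet> w))" by (simp only: mult.assoc)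
  then show ?thesis unfolding triple_chart m f(4) E2_swap[of ?t ?b] by (auto simp: algebra_simps)
qed

lemma seg_sign:
  assumes a: "a \<in> seg A" and z: "0 < z \<bullet> w"
  shows "elev z < ht A a (absc z) \<Longrightarrow> 0 < triple (loE a) (hiE a) z \<and> triple (hiE a) (loE a) z < 0"
    "ht A a (absc z) < elev z \<Longrightarrow> triple (loE a) (hiE a) z < 0 \<and> 0 < triple (hiE a) (loE a) z"
proof -
  have d: "D2 (loE a) (hiE a) * (z \<bullet> w) < 0" using D2_lo_hi[OF segD(2)[OF a]] z by (simp add: mult_neg_pos)
  have s: "triple (hiE a) (loE a) z = - triple (loE a) (hiE a) z" by (rule triple_cong)
  { assume "elev z < ht A a (absc z)"
    then have "0 < triple (loE a) (hiE a) z * triple u w e" unfolding seg_triple[OF a z] using d by (simp add: mult_neg_neg)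
    then show "0 < triple (loE a) (hiE a) z \<and> triple (hiE a) (loE a) z < 0" using frame(3) s by (simp add: zero_less_mult_iff) }
  { assume "ht A a (absc z) < elev z"
    then have "triple (loE a) (hiE a) z * triple u w e < 0" unfolding seg_triple[OF a z] using d by (simp add: mult_neg_pos)
    then show "triple (loE a) (hiE a) z < 0 \<and> 0 < triple (hiE a) (loE a) z" using frame(3) s by (simp add: mult_less_0_iff) }
qed

lemma ver_sign:
  assumes v: "v \<in> ver A" and z: "0 < z \<bullet> w"
  shows "xv A v < absc z \<Longrightarrow> 0 < triple (botE v) (topE v) z \<and> triple (topE v) (botE v) z < 0"
    "absc z < xv A v \<Longrightarrow> triple (botE v) (topE v) z < 0 \<and> 0 < triple (topE v) (botE v) z"
proof -
  have d: "0 < - E2 (botE v) (topE v) * (z \<bullet> w)" using ver_facts(3)[OF v] z by (simp add: mult_neg_pos)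
  have s: "triple (topE v) (botE v) z = - triple (botE v) (topE v) z" by (rule triple_cong)
  { assume "xv A v < absc z"
    then have "0 < triple (botE v) (topE v) z * triple u w e"
      unfolding ver_triple[OF v z] using mult_pos_pos[OF d, of "absc z - xv A v"] by simp
    then show "0 < triple (botE v) (topE v) z \<and> triple (topE v) (botE v) z < 0" using frame(3) s by (simp add: zero_less_mult_iff) }
  { assume "absc z < xv A v"
    then have "triple (botE v) (topE v) z * triple u w e < 0"
      unfolding ver_triple[OF v z] using mult_pos_neg[OF d, of "absc z - xv A v"] by simp
    then show "triple (botE v) (topE v) z < 0 \<and> 0 < triple (topE v) (botE v) z" using frame(3) s by (simp add: mult_less_0_iff) }
qed

text \<open>An end that lies in the open quarter and at which the walk can continue.\<close>
definition good where
  "good t \<longleftrightarrow> (case snd t of Lt \<Rightarrow> fst t \<in> seg A \<and> fst t \<in> lbl A | Rt \<Rightarrow> fst t \<in> seg A \<and> fst t \<in> rbl A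
     | Up \<Rightarrow> fst t \<in> ver A \<and> fst t \<in> tbl A | Dn \<Rightarrow> fst t \<in> ver A \<and> fst t \<in> bbl A)"

lemma good_simps [simp]: "good (a, Lt) \<longleftrightarrow> a \<in> seg A \<and> a \<in> lbl A" "good (a, Rt) \<longleftrightarrow> a \<in> seg A \<and> a \<in> rbl A"
  "good (a, Up) \<longleftrightarrow> a \<in> ver A \<and> a \<in> tbl A" "good (a, Dn) \<longleftrightarrow> a \<in> ver A \<and> a \<in> bbl A"
  by (simp_all add: good_def)

lemma rstep_good: "rstep A s t \<Longrightarrow> good s" "rstep (mir A) s t \<Longrightarrow> good (apsnd swap_lr s)"
  by (auto elim: rstep.cases)

lemma goodD:
  assumes "good s"
  shows "fst s \<in> D" "ends (fst s) (op s) (pt s)" "0 < pt s \<bullet> w" "0 < pt s \<bullet> e"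
proof -
  obtain a d where s: "s = (a, d)" by (cases s)
  have "a \<in> D \<and> ends a (op s) (pt s) \<and> 0 < pt s \<bullet> w \<and> 0 < pt s \<bullet> e"
    using assms ends_lo_hi[of a] ends_bot_top[of a] ends_sym[OF ends_lo_hi[of a]] ends_sym[OF ends_bot_top[of a]]
      segD(3,5,6)[of a] ver_facts(1,5,6)[of a]
    by (cases d) (auto simp: s A_sel(10-13))
  then show "fst s \<in> D" "ends (fst s) (op s) (pt s)" "0 < pt s \<bullet> w" "0 < pt s \<bullet> e" by (simp_all add: s)
qed

lemma seg_end: assumes "a \<in> seg A"
  shows "a \<in> rbl A \<Longrightarrow> absc (hiE a) = rt A a \<and> elev (hiE a) = ht A a (rt A a)"
    "a \<in> lbl A \<Longrightarrow> absc (loE a) = lf A a \<and> elev (loE a) = ht A a (lf A a)"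
proof -
  have *: "elev x = ht A a (absc x)" if "x \<in> {loE a, hiE a}" "0 < x \<bullet> w" for x
    using plane_eq[OF segD(2)[OF assms] that(1)] that(2) by (simp add: A_sel absc_def elev_def field_simps)
  show "a \<in> rbl A \<Longrightarrow> absc (hiE a) = rt A a \<and> elev (hiE a) = ht A a (rt A a)"
    "a \<in> lbl A \<Longrightarrow> absc (loE a) = lf A a \<and> elev (loE a) = ht A a (lf A a)"
    using *[of "hiE a"] *[of "loE a"] by (simp_all add: A_sel(3,4,10,11))
qed

lemma ver_end: assumes "v \<in> ver A"
  shows "v \<in> tbl A \<Longrightarrow> absc (topE v) = xv A v \<and> elev (topE v) = tp A v"
    "v \<in> bbl A \<Longrightarrow> absc (botE v) = xv A v \<and> elev (botE v) = bt A v"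
  using ver_facts(4,5)[OF assms] by (auto simp: A_sel(7-9,12,13) absc_def D2_def field_simps)

lemma relint_segI:
  assumes s: "good s" and b: "b \<in> seg A" "over A b (absc (pt s))" "ht A b (absc (pt s)) = elev (pt s)"
  shows "pt s \<in> arc_relint b"
proof -
  note g = goodD[OF s]
  have "pt s \<bullet> e = ht A b (absc (pt s)) * (pt s \<bullet> w)" using b g by (simp add: elev_def)
  then obtain \<alpha> \<beta> where "0 < \<alpha>" "0 < \<beta>" "pt s = \<alpha> *\<^sub>R loE b + \<beta> *\<^sub>R hiE b"
    using seg_param[OF b(1) g(3)] b(2) by (auto simp: over_def)
  then show ?thesis
    using relint_iff[OF valid[OF segD(3)[OF b(1)]] ends_lo_hi] valid_ends[OF valid[OF g(1)] g(2)] by blast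
qed

lemma relint_verI:
  assumes s: "good s" and v: "v \<in> ver A" "xv A v = absc (pt s)" "bt A v < elev (pt s)" "elev (pt s) < tp A v"
  shows "pt s \<in> arc_relint v"
proof -
  note g = goodD[OF s]
  have "\<exists>\<alpha>>0. \<exists>\<beta>>0. pt s = \<alpha> *\<^sub>R botE v + \<beta> *\<^sub>R topE v"
    by (rule ver_param[OF v(1) g(3,4) v(2)[symmetric] v(3)]) (use v(4) in \<open>simp add: A_sel\<close>)
  then show ?thesis
    using relint_iff[OF valid[OF ver_facts(1)[OF v(1)]] ends_bot_top] valid_ends[OF valid[OF g(1)] g(2)] by blast
qed

text \<open>Passing from a non-radial arc to a non-radial arc: the sign of the turn is the sign of the difference of slopes
  times the direction of travel.\<close>
lemma seg_seg_turn:
  assumes "a \<in> seg A" "b \<in> seg A" "over A b X" "ht A b X = ht A a X"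
  shows "b \<in> rbl A \<Longrightarrow> sl A b < sl A a \<Longrightarrow> 0 < triple (loE a) (hiE a) (hiE b) \<and> triple (hiE a) (loE a) (hiE b) < 0"
    "b \<in> rbl A \<Longrightarrow> sl A a < sl A b \<Longrightarrow> triple (loE a) (hiE a) (hiE b) < 0 \<and> 0 < triple (hiE a) (loE a) (hiE b)"
    "b \<in> lbl A \<Longrightarrow> sl A a < sl A b \<Longrightarrow> 0 < triple (loE a) (hiE a) (loE b) \<and> triple (hiE a) (loE a) (loE b) < 0"
    "b \<in> lbl A \<Longrightarrow> sl A b < sl A a \<Longrightarrow> triple (loE a) (hiE a) (loE b) < 0 \<and> 0 < triple (hiE a) (loE a) (loE b)"
proof -
  have X: "lf A b < X" "X < rt A b" using assms by (auto simp: over_def)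
  note st = steeper[OF assms(1,2) assms(4)[symmetric]] steeper[OF assms(2,1,4)]
  { assume b: "b \<in> rbl A"
    then have w: "0 < hiE b \<bullet> w" by (simp add: A_sel)
    note e = seg_end(1)[OF assms(2) b]
    show "sl A b < sl A a \<Longrightarrow> 0 < triple (loE a) (hiE a) (hiE b) \<and> triple (hiE a) (loE a) (hiE b) < 0"
      "sl A a < sl A b \<Longrightarrow> triple (loE a) (hiE a) (hiE b) < 0 \<and> 0 < triple (hiE a) (loE a) (hiE b)"
      using seg_sign[OF assms(1) w] st[of "rt A b"] X e by auto }
  { assume b: "b \<in> lbl A"
    then have w: "0 < loE b \<bullet> w" by (simp add: A_sel)
    note e = seg_end(2)[OF assms(2) b]
    show "sl A a < sl A b \<Longrightarrow> 0 < triple (loE a) (hiE a) (loE b) \<and> triple (hiE a) (loE a) (loE b) < 0"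
      "sl A b < sl A a \<Longrightarrow> triple (loE a) (hiE a) (loE b) < 0 \<and> 0 < triple (hiE a) (loE a) (loE b)"
      using seg_sign[OF assms(1) w] st[of "lf A b"] X e by auto }
qed

lemma seg_ver_turn:
  assumes "a \<in> seg A" "v \<in> ver A" "bt A v < ht A a (xv A v)" "ht A a (xv A v) < tp A v"
  shows "v \<in> bbl A \<Longrightarrow> 0 < triple (loE a) (hiE a) (botE v) \<and> triple (hiE a) (loE a) (botE v) < 0"
    "v \<in> tbl A \<Longrightarrow> triple (loE a) (hiE a) (topE v) < 0 \<and> 0 < triple (hiE a) (loE a) (topE v)"
  using seg_sign(1)[OF assms(1), of "botE v"] seg_sign(2)[OF assms(1), of "topE v"] ver_end[OF assms(2)] ver_facts(5)[OF assms(2)] assms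
  by (auto simp: A_sel(13))

lemma ver_seg_turn:
  assumes "v \<in> ver A" "b \<in> seg A" "over A b (xv A v)"
  shows "b \<in> rbl A \<Longrightarrow> 0 < triple (botE v) (topE v) (hiE b) \<and> triple (topE v) (botE v) (hiE b) < 0"
    "b \<in> lbl A \<Longrightarrow> triple (botE v) (topE v) (loE b) < 0 \<and> 0 < triple (topE v) (botE v) (loE b)"
  using ver_sign(1)[OF assms(1), of "hiE b"] ver_sign(2)[OF assms(1), of "loE b"] seg_end[OF assms(2)] assms
  by (auto simp: A_sel(10,11) over_def)

text \<open>Every rule of \<open>rstep\<close> gives the same sign of \<open>triple\<close>, so the
  whole walk has one sense of rotation.\<close>

lemma step_right:
  assumes "rstep A s t" "good t"
  shows "pt s \<in> arc_relint (fst t) \<and> 0 < triple (op s) (pt s) (pt t)"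
  using assms
proof (cases rule: rstep.cases)
  case (RR a b)
  then show ?thesis using relint_segI[of s b] seg_end(1)[of a] seg_seg_turn(1)[of a b "rt A a"] assms(2) by simp
next
  case (RL a b)
  then show ?thesis using relint_segI[of s b] seg_end(1)[of a] seg_seg_turn(3)[of a b "rt A a"] assms(2) by simp
next
  case (RD a v)
  then show ?thesis using relint_verI[of s v] seg_end(1)[of a] seg_ver_turn(1)[of a v] assms(2) by simp
next
  case (LL a b)
  then show ?thesis using relint_segI[of s b] seg_end(2)[of a] seg_seg_turn(4)[of a b "lf A a"] assms(2) by simp
next
  case (LR a b)
  then show ?thesis using relint_segI[of s b] seg_end(2)[of a] seg_seg_turn(2)[of a b "lf A a"] assms(2) by simp
next
  case (LU a v)
  then show ?thesis using relint_verI[of s v] seg_end(2)[of a] seg_ver_turn(2)[of a v] assms(2) by simp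
next
  case (UR v b)
  then show ?thesis using relint_segI[of s b] ver_end(1)[of v] ver_seg_turn(1)[of v b] assms(2) by simp
next
  case (DL v b)
  then show ?thesis using relint_segI[of s b] ver_end(2)[of v] ver_seg_turn(2)[of v b] assms(2) by simp
qed

text \<open>Mirroring reverses orientation: right turns in \<open>mir A\<close> are left turns in
  \<open>A\<close>.\<close>

lemma step_left:
  assumes "rstep (mir A) s t" "good (apsnd swap_lr t)"
  shows "pt (apsnd swap_lr s) \<in> arc_relint (fst t) \<and> triple (op (apsnd swap_lr s)) (pt (apsnd swap_lr s)) (pt (apsnd swap_lr t)) < 0"
  using assms
proof (cases rule: rstep.cases)
  case (RR a b)
  then show ?thesis using relint_segI[of "(a, Lt)" b] seg_end(2)[of a] seg_seg_turn(3)[of a b "lf A a"] assms(2) by simp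
next
  case (RL a b)
  then show ?thesis using relint_segI[of "(a, Lt)" b] seg_end(2)[of a] seg_seg_turn(1)[of a b "lf A a"] assms(2) by simp
next
  case (RD a v)
  then show ?thesis using relint_verI[of "(a, Lt)" v] seg_end(2)[of a] seg_ver_turn(1)[of a v] assms(2) by simp
next
  case (LL a b)
  then show ?thesis using relint_segI[of "(a, Rt)" b] seg_end(1)[of a] seg_seg_turn(2)[of a b "rt A a"] assms(2) by simp
next
  case (LR a b)
  then show ?thesis using relint_segI[of "(a, Rt)" b] seg_end(1)[of a] seg_seg_turn(4)[of a b "rt A a"] assms(2) by simp
next
  case (LU a v)
  then show ?thesis using relint_verI[of "(a, Rt)" v] seg_end(1)[of a] seg_ver_turn(2)[of a v] assms(2) by simp
next
  case (UR v b)
  then show ?thesis using relint_segI[of "(v, Up)" b] ver_end(1)[of v] ver_seg_turn(2)[of v b] assms(2) by simp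
next
  case (DL v b)
  then show ?thesis using relint_segI[of "(v, Dn)" b] ver_end(2)[of v] ver_seg_turn(1)[of v b] assms(2) by simp
qed

text \<open>A crossing arc with its top in the quarter is a vertical with free lower end, so
  \<open>closed_walk_exists\<close> applies. The walk turns only at ends inside the quarter, which
  are the corners of the swirl.\<close>

lemma swirl_in_quarter:
  obtains xs where "is_swirl D xs" "\<And>x. x \<in> corners xs \<Longrightarrow> 0 < x \<bullet> w \<and> 0 < x \<bullet> e"
proof -
  have finS: "finite S" if "\<And>s. s \<in> S \<Longrightarrow> fst s \<in> D" for S :: "(arc \<times> dir) set"
  proof (rule finite_subset)
    show "S \<subseteq> D \<times> {Lt, Rt, Up, Dn}" using that dir.exhaust by (auto simp: mem_Times_iff) (metis)
  qed (use finD in simp)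
  obtain b t s where b: "mixed b" "ends b t s" "0 < t \<bullet> e" "s \<bullet> e \<le> 0" "0 < t \<bullet> w" using mixed_in_half[OF w0 wN] .
  have v: "b \<in> ver A" using b mixed_meridian[OF b(1)] unfolding A_sel by blast
  have "botE b = s" using ver_facts(6)[OF v] ends_bot_top[of b] b by (auto simp: ends_def)
  then have nb: "b \<notin> bbl A" using b by (simp add: A_sel)
  from closed_walk_exists[OF v nb] show thesis
  proof
    assume "\<exists>S. closed_walk A S"
    then obtain S where S: "S \<noteq> {}" "inj_on fst S" and st: "\<forall>s\<in>S. \<exists>t\<in>S. rstep A s t" unfolding closed_walk_def by blast
    have g: "good s" if "s \<in> S" for s using st rstep_good(1) that by blast
    have "\<exists>t\<in>S. pt s \<in> arc_relint (fst t) \<and> 0 < 1 * triple (op s) (pt s) (pt t)" if "s \<in> S" for s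
      using st that step_right g by fastforce
    then obtain xs where xs: "is_swirl D xs" "corners xs \<subseteq> pt ` S"
      using swirl_of_cycle[of S pt 1 op] finS[of S] S goodD(1,2)[OF g] by metis
    show thesis by (rule that[OF xs(1)]) (use xs(2) goodD(3,4)[OF g] in blast)
  next
    assume "\<exists>S. closed_walk (mir A) S"
    then obtain S where S: "S \<noteq> {}" "inj_on fst S" and st: "\<forall>s\<in>S. \<exists>t\<in>S. rstep (mir A) s t" unfolding closed_walk_def by blast
    have g: "good (apsnd swap_lr s)" if "s \<in> S" for s using st rstep_good(2) that by blast
    let ?p = "\<lambda>s. pt (apsnd swap_lr s)" and ?o = "\<lambda>s. op (apsnd swap_lr s)"
    have 1: "\<exists>t\<in>S. ?p s \<in> arc_relint (fst t) \<and> 0 < (- 1) * triple (?o s) (?p s) (?p t)" if "s \<in> S" for s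
      using st that step_left g by fastforce
    have 2: "fst s \<in> D \<and> ends (fst s) (?o s) (?p s)" if "s \<in> S" for s using goodD(1,2)[OF g[OF that]] by simp
    obtain xs where xs: "is_swirl D xs" "corners xs \<subseteq> ?p ` S"
      using swirl_of_cycle[of S ?p "-1" ?o] finS[of S] S 1 2 by metis
    show thesis by (rule that[OF xs(1)]) (use xs(2) goodD(3,4)[OF g] in blast)
  qed
qed

end

section \<open>Lower bounds\<close>

lemma corners_rotate: "corners (rotate n xs) \<subseteq> corners xs"
proof
  fix x assume "x \<in> corners (rotate n xs)"
  then obtain i y where i: "i < length xs" "ends (rotate n xs ! i) x y"
    "x \<in> arc_relint (rotate n xs ! ((i + 1) mod length xs))" by (auto simp: corners_def)
  let ?j = "(n + i) mod length xs"
  have "0 < length xs" using i by auto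
  then have "?j < length xs" "rotate n xs ! i = xs ! ?j" using i nth_rotate[of i xs n] by (auto simp: add.commute)
  moreover have "rotate n xs ! ((i + 1) mod length xs) = xs ! ((?j + 1) mod length xs)"
    using nth_rotate[of "(i + 1) mod length xs" xs n] \<open>0 < length xs\<close> by (simp add: mod_simps ac_simps)
  ultimately show "x \<in> corners xs" using i unfolding corners_def by auto
qed

lemma swirl_corners: "is_swirl D xs \<Longrightarrow> corners xs \<noteq> {}"
proof -
  assume "is_swirl D xs"
  then obtain p q where "0 < length xs" "xs ! 0 = (q 0, p 0) \<or> xs ! 0 = (p 0, q 0)"
    "p 0 \<in> arc_relint (xs ! ((0 + 1) mod length xs))"
    unfolding is_swirl_def by fastforce
  then have "p 0 \<in> corners xs" unfolding corners_def ends_def by blast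
  then show ?thesis by blast
qed

lemma finite_swirls: "finite D \<Longrightarrow> finite {xs. is_swirl D xs}"
proof -
  assume D: "finite D"
  have "length xs \<le> card D" if "is_swirl D xs" for xs
    using that card_mono[OF D, of "set xs"] distinct_card[of xs] by (simp add: is_swirl_def)
  then have "{xs. is_swirl D xs} \<subseteq> {xs. set xs \<subseteq> D \<and> length xs \<le> card D}" by (auto simp: is_swirl_def)
  then show ?thesis using finite_lists_length_le[OF D] finite_subset by blast
qed

text \<open>Rotated lists have the same corners, so different corner sets mean different rotation
  classes.\<close>

lemma num_swirls_ge:
  assumes "finite D" and T: "\<And>xs. xs \<in> T \<Longrightarrow> is_swirl D xs" and inj: "inj_on corners T"
  shows "card T \<le> num_swirls D"
proof -
  let ?c = "\<lambda>xs. {rotate n xs |n. True}"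
  have c: "corners xs = corners ys" if "?c xs = ?c ys" for xs ys :: "arc list"
  proof -
    have sub: "corners ys \<subseteq> corners xs" if eq: "?c xs = ?c ys" for xs ys :: "arc list"
    proof -
      have "ys = rotate 0 ys" by simp
      then have "ys \<in> ?c ys" by blast
      then have "ys \<in> ?c xs" unfolding eq .
      then obtain n where "ys = rotate n xs" by blast
      then show ?thesis using corners_rotate by simp
    qed
    show ?thesis using sub[OF that] sub[OF that[symmetric]] by blast
  qed
  have "inj_on ?c T"
  proof (rule inj_onI)
    fix x y assume "x \<in> T" "y \<in> T" "?c x = ?c y"
    then show "x = y" using c[of x y] inj by (simp add: inj_on_def)
  qed
  then have "card T = card (?c ` T)" by (simp add: card_image)
  also have "\<dots> \<le> card (?c ` {xs. is_swirl D xs})"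
    using finite_swirls[OF assms(1)] T by (intro card_mono finite_imageI image_mono) auto
  finally show ?thesis by (simp add: num_swirls_def)
qed

context cap begin

lemma swirl_in_half:
  assumes "w \<noteq> 0" "w \<bullet> N = 0"
  obtains xs where "is_swirl D xs" "\<And>x. x \<in> corners xs \<Longrightarrow> 0 < x \<bullet> w \<and> 0 < x \<bullet> e"
proof -
  interpret quarter D N e w by unfold_locales (use assms in auto)
  show thesis using swirl_in_quarter that by blast
qed

text \<open>Two swirls never suffice: some half-plane bounded by the axis misses a corner of each.\<close>
lemma three_swirls:
  obtains T where "card T = 3" "inj_on corners T" "finite T" "\<And>xs. xs \<in> T \<Longrightarrow> is_swirl D xs"
    "\<And>xs x. \<lbrakk>xs \<in> T; x \<in> corners xs\<rbrakk> \<Longrightarrow> 0 < x \<bullet> e"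
proof -
  obtain w1 where w1: "w1 \<noteq> 0" "w1 \<bullet> N = 0" using avoid_two[of N 0 0] by blast
  obtain a where a: "is_swirl D a" "\<And>x. x \<in> corners a \<Longrightarrow> 0 < x \<bullet> w1 \<and> 0 < x \<bullet> e" by (rule swirl_in_half[OF w1]) blast
  obtain x1 where x1: "x1 \<in> corners a" using swirl_corners[OF a(1)] by blast
  obtain w2 where w2: "w2 \<noteq> 0" "w2 \<bullet> N = 0" "x1 \<bullet> w2 \<le> 0" using avoid_two[of N x1 x1] by blast
  obtain b where b: "is_swirl D b" "\<And>x. x \<in> corners b \<Longrightarrow> 0 < x \<bullet> w2 \<and> 0 < x \<bullet> e" by (rule swirl_in_half[OF w2(1,2)]) blast
  obtain x2 where x2: "x2 \<in> corners b" using swirl_corners[OF b(1)] by blast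
  obtain w3 where w3: "w3 \<noteq> 0" "w3 \<bullet> N = 0" "x1 \<bullet> w3 \<le> 0" "x2 \<bullet> w3 \<le> 0" using avoid_two[of N x1 x2] by blast
  obtain c where c: "is_swirl D c" "\<And>x. x \<in> corners c \<Longrightarrow> 0 < x \<bullet> w3 \<and> 0 < x \<bullet> e" by (rule swirl_in_half[OF w3(1,2)]) blast
  have "x1 \<notin> corners b" "x1 \<notin> corners c" "x2 \<notin> corners c" using b(2) c(2) w2(3) w3(3,4) by (meson not_less)+
  then have ne: "corners a \<noteq> corners b" "corners a \<noteq> corners c" "corners b \<noteq> corners c" using x1 x2 by auto
  then have "a \<noteq> b" "a \<noteq> c" "b \<noteq> c" by metis+
  then have "card {a, b, c} = 3" by simp
  moreover have "inj_on corners {a, b, c}" using ne by (auto simp: inj_on_def)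
  ultimately show thesis using that[of "{a, b, c}"] a b c by blast
qed

text \<open>The corners of the two triples lie on opposite sides of the equator.\<close>

lemma six_swirls: "6 \<le> num_swirls D"
proof -
  interpret o: cap D "- N" "- e" by (rule cap_opposite)
  obtain T where T: "card T = 3" "inj_on corners T" "finite T" "\<And>xs. xs \<in> T \<Longrightarrow> is_swirl D xs"
    "\<And>xs x. \<lbrakk>xs \<in> T; x \<in> corners xs\<rbrakk> \<Longrightarrow> 0 < x \<bullet> e" using three_swirls by blast
  obtain T' where T': "card T' = 3" "inj_on corners T'" "finite T'" "\<And>xs. xs \<in> T' \<Longrightarrow> is_swirl D xs"
    "\<And>xs x. \<lbrakk>xs \<in> T'; x \<in> corners xs\<rbrakk> \<Longrightarrow> 0 < x \<bullet> - e" using o.three_swirls by blast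
  have ne: "corners xs \<noteq> corners ys" if xs: "xs \<in> T" and ys: "ys \<in> T'" for xs ys
  proof
    assume eq: "corners xs = corners ys"
    obtain x where "x \<in> corners xs" using swirl_corners[OF T(4)[OF xs]] by blast
    then show False using T(5)[OF xs, of x] T'(5)[OF ys, of x] eq by simp
  qed
  then have "T \<inter> T' = {}" by blast
  then have "card (T \<union> T') = 6" using card_Un_disjoint[OF T(3) T'(3)] T(1) T'(1) by simp
  moreover have "inj_on corners (T \<union> T')"
    using T(2) T'(2) ne unfolding inj_on_def by (metis Un_iff)
  moreover have "is_swirl D xs" if "xs \<in> T \<union> T'" for xs using that T(4) T'(4) by blast
  ultimately show ?thesis using num_swirls_ge[OF finD, of "T \<union> T'"] by simp
qed

lemma card_parts: "card {a. upper a} + card {a. cap.upper D (- e) a} + card {a. mixed a} \<le> card D"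
proof -
  interpret o: cap D "- N" "- e" by (rule cap_opposite)
  have d: "{a. upper a} \<inter> {a. o.upper a} = {}" "({a. upper a} \<union> {a. o.upper a}) \<inter> {a. mixed a} = {}"
    by (auto simp: upper_def o.upper_def mixed_def)
  have "card ({a. upper a} \<union> {a. o.upper a} \<union> {a. mixed a}) = card {a. upper a} + card {a. o.upper a} + card {a. mixed a}"
    using card_Un_disjoint[OF finite_upper o.finite_upper d(1)]
      card_Un_disjoint[OF finite_UnI[OF finite_upper o.finite_upper] finite_mixed d(2)] by simp
  moreover have "{a. upper a} \<union> {a. o.upper a} \<union> {a. mixed a} \<subseteq> D"
    by (auto simp: upper_def o.upper_def mixed_def)
  ultimately show ?thesis using card_mono[OF finD] by metis
qed

lemma nine_arcs: "9 \<le> card D"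
proof -
  interpret o: cap D "- N" "- e" by (rule cap_opposite)
  show ?thesis using card_parts card_upper o.card_upper card_mixed by linarith
qed

lemma eleven_arcs:
  assumes "spherical_occlusion_diagram D" shows "11 \<le> card D"
proof -
  interpret o: cap D "- N" "- e" by (rule cap_opposite)
  have "s = t" if "a \<in> D" "b \<in> D" "c \<in> D" "hits_from_side b a s" "hits_from_side c a t" for a b c s t
    using assms that unfolding spherical_occlusion_diagram_def by blast
  then show ?thesis using card_parts card_upper_one_sided o.card_upper_one_sided card_mixed by fastforce
qed

end

section \<open>From the alignment to the axis\<close>

lemma in_span_pair: "(x::point) \<in> span {p, q} \<longleftrightarrow> (\<exists>\<alpha> \<beta>. x = \<alpha> *\<^sub>R p + \<beta> *\<^sub>R q)"
proof -
  have "x \<in> span {p, q} \<longleftrightarrow> (\<exists>\<alpha> \<beta>. x - \<alpha> *\<^sub>R p = \<beta> *\<^sub>R q)"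
    by (auto simp: span_breakdown_eq)
  also have "\<dots> \<longleftrightarrow> (\<exists>\<alpha> \<beta>. x = \<alpha> *\<^sub>R p + \<beta> *\<^sub>R q)" by (simp add: algebra_simps)
  finally show ?thesis .
qed

lemma span_pair_eq:
  assumes "q = \<alpha> *\<^sub>R p + \<beta> *\<^sub>R N" "\<alpha> \<noteq> 0" shows "span {N, q} = span {N, p::point}"
proof -
  have "q = \<beta> *\<^sub>R N + \<alpha> *\<^sub>R p" using assms by simp
  then have "q \<in> span {N, p}" unfolding in_span_pair by blast
  moreover have "p = (- \<beta> / \<alpha>) *\<^sub>R N + (1 / \<alpha>) *\<^sub>R q" using assms by (simp add: scaleR_add_right)
  then have "p \<in> span {N, q}" unfolding in_span_pair by blast
  ultimately show ?thesis by (simp add: span_eq span_base)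
qed

lemma unit_multiple:
  assumes "norm (p::point) = 1" "norm q = 1" "p = c *\<^sub>R q" shows "p = q \<or> p = - q"
proof -
  have "\<bar>c\<bar> = 1" using assms by (metis mult.right_neutral norm_scaleR)
  then show ?thesis using assms by (auto simp: abs_if split: if_splits)
qed

text \<open>The only configuration with this alignment: one pole off the great circle of all the others.\<close>
lemma alignment_axis:
  assumes k: "4 \<le> k" and P: "finite P" "card P = k" and al: "has_alignment P (replicate (k - 1) 2 @ [k - 1])"
    and unit: "\<forall>p\<in>P. on_sphere p" and anti: "\<forall>p\<in>P. \<forall>q\<in>P. p \<noteq> - q"
  obtains N e where "N \<in> P" "0 < N \<bullet> e" "\<And>p. p \<in> P \<Longrightarrow> p \<noteq> N \<Longrightarrow> p \<bullet> e = 0"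
proof -
  have ms: "image_mset (circles_through P) (mset_set P) = replicate_mset (k - 1) 2 + {#k - 1#}"
    using al by (simp add: has_alignment_def)
  have "k - 1 \<in># image_mset (circles_through P) (mset_set P)" unfolding ms by simp
  then obtain N where N: "N \<in> P" "circles_through P N = k - 1" using P by auto
  let ?Q = "P - {N}"
  have "mset_set P = add_mset N (mset_set ?Q)" using P N by (simp add: mset_set.remove)
  then have rest: "image_mset (circles_through P) (mset_set ?Q) = replicate_mset (k - 1) 2" using ms N by simp
  have two: "circles_through P p = 2" if "p \<in> ?Q" for p
  proof -
    have "circles_through P p \<in># image_mset (circles_through P) (mset_set ?Q)" using that P by auto
    then show ?thesis unfolding rest by (simp split: if_splits)
  qed
  have cQ: "card ?Q = k - 1" using P N by simp
  \<comment> \<open>There are as many circles through \<open>N\<close> as other poles, so no two of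
    these poles share one.\<close>
  have inj: "inj_on (\<lambda>q. span {N, q}) ?Q"
    by (rule eq_card_imp_inj_on) (use P N cQ in \<open>simp_all add: circles_through_def\<close>)
  have nrm: "norm p = 1" if "p \<in> P" for p using unit that by (simp add: on_sphere_def)
  have indep: "\<alpha> \<noteq> 0" if "p \<in> P" "q \<in> P" "p \<noteq> q" "p = \<alpha> *\<^sub>R r + \<beta> *\<^sub>R q" for p q r \<alpha> \<beta>
  proof
    assume "\<alpha> = 0"
    then have "p = \<beta> *\<^sub>R q" using that by simp
    then have "p = q \<or> p = - q" using unit_multiple[OF nrm[OF that(1)] nrm[OF that(2)]] by blast
    then show False using anti that(1-3) by blast
  qed
  have off: "q \<notin> span {p, N}" if pq: "p \<in> ?Q" "q \<in> ?Q" "p \<noteq> q" for p q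
  proof
    assume "q \<in> span {p, N}"
    then obtain \<alpha> \<beta> where ab: "q = \<alpha> *\<^sub>R p + \<beta> *\<^sub>R N" unfolding in_span_pair by blast
    have "\<alpha> \<noteq> 0" using indep[of q N \<alpha> p \<beta>] ab pq N by auto
    then have "span {N, q} = span {N, p}" by (rule span_pair_eq[OF ab])
    then show False using inj pq unfolding inj_on_def by metis
  qed
  have "2 \<le> card ?Q" using cQ k by simp
  then obtain p q where pq: "p \<in> ?Q" "q \<in> ?Q" "p \<noteq> q"
    by (metis card_le_Suc0_iff_eq P(1) finite_Diff not_less_eq_eq numeral_2_eq_2)
  \<comment> \<open>Only two circles pass through \<open>p\<close>: one contains \<open>N\<close>,
    the other \<open>q\<close>. By \<open>off\<close> the circle of \<open>p\<close> and
    \<open>r\<close> is not the first.\<close>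
  have all: "r \<in> span {p, q}" if r: "r \<in> ?Q" for r
  proof (cases "r = p")
    case True then show ?thesis by (simp add: span_base)
  next
    case False
    let ?C = "(\<lambda>q. span {p, q}) ` (P - {p})"
    have card2: "card ?C = 2" using two[OF pq(1)] by (simp add: circles_through_def)
    then obtain X Y where XY: "?C = {X, Y}" by (auto simp: card_2_iff)
    have "span {p, N} \<in> ?C" "span {p, q} \<in> ?C" "span {p, r} \<in> ?C" using N pq r False by auto
    moreover have "span {p, q} \<noteq> span {p, N}" using off[OF pq] by (metis insertI1 insertI2 span_base)
    moreover have "span {p, r} \<noteq> span {p, N}" using off[OF pq(1) r] False by (metis insertI1 insertI2 span_base)
    ultimately have "span {p, r} = span {p, q}" unfolding XY by auto
    then show ?thesis by (metis insertI1 insertI2 span_base)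
  qed
  let ?e = "cross3 p q"
  have "N \<bullet> ?e \<noteq> 0"
  proof
    assume "N \<bullet> ?e = 0"
    moreover have "valid_arc (p, q)" using pq unit anti by (auto simp: valid_arc_def)
    then have "cross3 p q \<noteq> 0" by (rule valid_cross) (simp add: ends_def)
    ultimately obtain \<alpha> \<beta> where ab: "N = \<alpha> *\<^sub>R p + \<beta> *\<^sub>R q" using plane_comb[of N p q] by (auto simp: triple_def)
    have "\<beta> \<noteq> 0" using indep[of N p \<beta> q \<alpha>] ab pq N by (auto simp: add.commute)
    then have "q = (- \<alpha> / \<beta>) *\<^sub>R p + (1 / \<beta>) *\<^sub>R N" unfolding ab by (simp add: scaleR_add_right)
    then have "q \<in> span {p, N}" unfolding in_span_pair by blast
    then show False using off[OF pq] by blast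
  qed
  moreover have zero: "r \<bullet> ?e = 0" if r: "r \<in> ?Q" for r
  proof -
    obtain \<alpha> \<beta> where "r = \<alpha> *\<^sub>R p + \<beta> *\<^sub>R q" using all[OF r] unfolding in_span_pair by blast
    then show ?thesis by (simp add: inner_add_left dot_cross_self)
  qed
  ultimately show thesis
    using that[of N ?e] that[of N "- ?e"] N by (cases "0 < N \<bullet> ?e") auto
qed

text \<open>A pole on the equator that directs an arc is a combination of its ends with coefficients
  of opposite signs. Since this combination has height 0, the heights of the ends have equal
  signs.\<close>

lemma cap_of_alignment:
  assumes k: "4 \<le> k" and D: "spherical_diagram D"
    and ko: "k_oriented_with_alignment k (replicate (k - 1) 2 @ [k - 1]) D"
  obtains N e where "cap D N e"
proof -
  obtain P f where P: "finite P" "card P = k" and or: "oriented_by D P f"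
    and al: "has_alignment P (replicate (k - 1) 2 @ [k - 1])"
    using ko unfolding k_oriented_with_alignment_def by blast
  have unit: "\<forall>p\<in>P. on_sphere p" and anti: "\<forall>p\<in>P. \<forall>q\<in>P. p \<noteq> - q"
    and f: "\<And>a. a \<in> D \<Longrightarrow> f a \<in> P \<and> triple (f a) (fst a) (snd a) = 0 \<and> f a \<notin> arc_points a \<and> - f a \<notin> arc_points a"
    using or unfolding oriented_by_def triple_def by blast+
  obtain N e where N: "N \<in> P" "0 < N \<bullet> e" "\<And>p. p \<in> P \<Longrightarrow> p \<noteq> N \<Longrightarrow> p \<bullet> e = 0"
    using alignment_axis[OF k P al unit anti] by blast
  interpret diagram D by unfold_locales (rule D)
  have "cap D N e"
  proof
    show "norm N = 1" "0 < N \<bullet> e" using unit N by (auto simp: on_sphere_def)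
    fix a assume a: "a \<in> D"
    let ?r = "fst a" and ?s = "snd a"
    show "(0 < ?r \<bullet> e \<and> 0 < ?s \<bullet> e) \<or> (?r \<bullet> e < 0 \<and> ?s \<bullet> e < 0) \<or> (?r \<bullet> e = 0 \<and> ?s \<bullet> e = 0) \<or> meridian N a"
    proof (cases "f a = N")
      case True then show ?thesis using f[OF a] by (simp add: meridian_def radial_def)
    next
      case False
      let ?p = "f a"
      have pe: "?p \<bullet> e = 0" and np: "norm ?p = 1" "norm (- ?p) = 1" using N(3) f[OF a] False unit by (auto simp: on_sphere_def)
      obtain \<alpha> \<beta> where ab: "?p = \<alpha> *\<^sub>R ?r + \<beta> *\<^sub>R ?s"
        using plane_comb[of ?p ?r ?s] f[OF a] valid_cross[OF valid[OF a] ends_self] by metis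
      have mab: "- ?p = (- \<alpha>) *\<^sub>R ?r + (- \<beta>) *\<^sub>R ?s" unfolding ab by simp
      have no: "\<not> (0 \<le> \<alpha> \<and> 0 \<le> \<beta>)" "\<not> (\<alpha> \<le> 0 \<and> \<beta> \<le> 0)"
        using arc_points_comb[OF valid[OF a] ends_self np(1) ab] arc_points_comb[OF valid[OF a] ends_self np(2) mab] f[OF a] by auto
      have "\<alpha> * (?r \<bullet> e) + \<beta> * (?s \<bullet> e) = ?p \<bullet> e" by (subst ab) (simp add: inner_add_left)
      then have z: "\<alpha> * (?r \<bullet> e) + \<beta> * (?s \<bullet> e) = 0" using pe by simp
      have sgn: "(0 < \<alpha> \<and> \<beta> < 0) \<or> (\<alpha> < 0 \<and> 0 < \<beta>)" using no by linarith
      have "0 < ?r \<bullet> e \<longleftrightarrow> 0 < ?s \<bullet> e" "?r \<bullet> e < 0 \<longleftrightarrow> ?s \<bullet> e < 0"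
        using sgn z by (smt (verit) mult_pos_pos mult_neg_neg mult_pos_neg mult_neg_pos mult_nonneg_nonneg mult_nonpos_nonpos mult_nonneg_nonpos mult_nonpos_nonneg)+
      then show ?thesis by linarith
    qed
  qed
  then show thesis by (rule that)
qed

theorem lower_bounds:
  assumes "4 \<le> k" "spherical_diagram D" "k_oriented_with_alignment k (replicate (k - 1) 2 @ [k - 1]) D"
  shows "6 \<le> num_swirls D" "9 \<le> card D" "spherical_occlusion_diagram D \<Longrightarrow> 11 \<le> card D"
proof -
  obtain N e where "cap D N e" using cap_of_alignment[OF assms] .
  then interpret cap D N e .
  show "6 \<le> num_swirls D" "9 \<le> card D" "spherical_occlusion_diagram D \<Longrightarrow> 11 \<le> card D"
    using six_swirls nine_arcs eleven_arcs by blast+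
qed

section \<open>Diagrams with integer coordinates\<close>

type_synonym ivec = "int \<times> int \<times> int"

fun dot :: "ivec \<Rightarrow> ivec \<Rightarrow> int" where
  "dot (a, b, c) (x, y, z) = a * x + b * y + c * z"

fun crs :: "ivec \<Rightarrow> ivec \<Rightarrow> ivec" where
  "crs (a, b, c) (x, y, z) = (b * z - c * y, c * x - a * z, a * y - b * x)"

fun minus_ivec :: "ivec \<Rightarrow> ivec" where
  "minus_ivec (x, y, z) = (- x, - y, - z)"

fun vec_of :: "ivec \<Rightarrow> point" where
  "vec_of (x, y, z) = vector [of_int x, of_int y, of_int z]"

definition det3 :: "ivec \<Rightarrow> ivec \<Rightarrow> ivec \<Rightarrow> int" where
  "det3 x y z = dot x (crs y z)"

text \<open>For \<open>p\<close> in the plane of the arc, the two products are the coefficients of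
  \<open>p\<close> multiplied by a positive number; see \<open>inner_cross_pos\<close>. The
  conditional spares evaluation the products when \<open>p\<close> is off the plane.\<close>

definition inside :: "ivec \<times> ivec \<Rightarrow> ivec \<Rightarrow> bool" where
  "inside a p \<longleftrightarrow> (if det3 p (fst a) (snd a) = 0
     then 0 < dot (crs (fst a) (snd a)) (crs (fst a) p) \<and> 0 < dot (crs (fst a) (snd a)) (crs p (snd a)) else False)"

definition sph :: "ivec \<Rightarrow> point" where "sph p = sgn (vec_of p)"
definition arc_of :: "ivec \<times> ivec \<Rightarrow> arc" where "arc_of a = (sph (fst a), sph (snd a))"

lemma inner_vec_of [simp]: "vec_of p \<bullet> vec_of q = of_int (dot p q)"
  by (cases p; cases q) (simp add: inner_vec_def sum_3)

lemma cross_vec_of [simp]: "cross3 (vec_of p) (vec_of q) = vec_of (crs p q)"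
  by (cases p; cases q) (simp add: cross3_def)

lemma vec_of_eq_0: "vec_of p = 0 \<longleftrightarrow> p = (0, 0, 0)"
  by (cases p) (simp add: vec_eq_iff forall_3)

lemma vec_of_minus [simp]: "vec_of (minus_ivec p) = - vec_of p"
  by (cases p) (simp add: vec_eq_iff forall_3)

lemma triple_vec_of [simp]: "triple (vec_of p) (vec_of q) (vec_of r) = of_int (det3 p q r)"
  by (simp add: triple_def det3_def)

lemma sphE:
  assumes "p \<noteq> (0, 0, 0)" obtains c where "0 < c" "sph p = c *\<^sub>R vec_of p" "norm (sph p) = 1"
proof (rule that)
  show "0 < inverse (norm (vec_of p))" "sph p = inverse (norm (vec_of p)) *\<^sub>R vec_of p" "norm (sph p) = 1"
    using assms by (simp_all add: sph_def sgn_div_norm vec_of_eq_0)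
qed

lemma sgn_triple_sph:
  assumes "p \<noteq> (0, 0, 0)" "q \<noteq> (0, 0, 0)" "r \<noteq> (0, 0, 0)"
  shows "sgn (triple (sph p) (sph q) (sph r)) = of_int (sgn (det3 p q r))"
proof -
  obtain a where a: "0 < a" "sph p = a *\<^sub>R vec_of p" using sphE[OF assms(1)] by blast
  obtain b where b: "0 < b" "sph q = b *\<^sub>R vec_of q" using sphE[OF assms(2)] by blast
  obtain c where c: "0 < c" "sph r = c *\<^sub>R vec_of r" using sphE[OF assms(3)] by blast
  show ?thesis unfolding a(2) b(2) c(2) using a(1) b(1) c(1) by (simp add: sgn_mult) (simp add: sgn_if)
qed

lemma crs_zero [simp]: "crs (0, 0, 0) v = (0, 0, 0)" "crs u (0, 0, 0) = (0, 0, 0)"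
  by (cases v; simp) (cases u; simp)

lemma valid_arc_of:
  assumes "crs (fst a) (snd a) \<noteq> (0, 0, 0)" shows "valid_arc (arc_of a)"
proof -
  have nz: "fst a \<noteq> (0, 0, 0)" "snd a \<noteq> (0, 0, 0)" using assms by (metis crs_zero)+
  obtain c where c: "0 < c" "sph (fst a) = c *\<^sub>R vec_of (fst a)" "norm (sph (fst a)) = 1" using sphE[OF nz(1)] by blast
  obtain d where d: "0 < d" "sph (snd a) = d *\<^sub>R vec_of (snd a)" "norm (sph (snd a)) = 1" using sphE[OF nz(2)] by blast
  have "cross3 (sph (fst a)) (sph (snd a)) = (c * d) *\<^sub>R vec_of (crs (fst a) (snd a))"
    unfolding c(2) d(2) by (simp add: cross_mult_left cross_mult_right mult.commute)
  then have "cross3 (sph (fst a)) (sph (snd a)) \<noteq> 0" using assms c d by (simp add: vec_of_eq_0)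
  then have "sph (fst a) \<noteq> sph (snd a)" "sph (fst a) \<noteq> - sph (snd a)" by (auto simp: cross_minus_left)
  then show ?thesis using c d by (simp add: valid_arc_def arc_of_def on_sphere_def)
qed

lemma ends_arc_of: "ends (arc_of a) (sph (fst a)) (sph (snd a))"
  by (simp add: ends_def arc_of_def)

lemma inner_cross_pos:
  "x = \<alpha> *\<^sub>R u + \<beta> *\<^sub>R (v::point) \<Longrightarrow> cross3 u v \<bullet> cross3 u x = \<beta> * (cross3 u v \<bullet> cross3 u v)
    \<and> cross3 u v \<bullet> cross3 x v = \<alpha> * (cross3 u v \<bullet> cross3 u v)"
  by (simp add: cross_add_left cross_add_right cross_mult_left cross_mult_right inner_add_right)

lemma relint_arc_of:
  assumes v: "crs (fst a) (snd a) \<noteq> (0, 0, 0)" and x: "norm x = 1"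
    and det: "x = c *\<^sub>R vec_of p" "0 < c"
  shows "x \<in> arc_relint (arc_of a) \<longleftrightarrow> inside a p"
proof -
  have nz: "fst a \<noteq> (0, 0, 0)" "snd a \<noteq> (0, 0, 0)" using v by (metis crs_zero)+
  let ?u = "vec_of (fst a)" and ?v = "vec_of (snd a)" and ?p = "vec_of p"
  let ?n = "cross3 ?u ?v"
  obtain d where d: "0 < d" "sph (fst a) = d *\<^sub>R ?u" using sphE[OF nz(1)] by blast
  obtain e where e: "0 < e" "sph (snd a) = e *\<^sub>R ?v" using sphE[OF nz(2)] by blast
  have nn: "0 < ?n \<bullet> ?n" using v by (simp del: inner_vec_of add: vec_of_eq_0)
  have "inside a p \<longleftrightarrow> triple ?p ?u ?v = 0 \<and> 0 < ?n \<bullet> cross3 ?u ?p \<and> 0 < ?n \<bullet> cross3 ?p ?v"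
    by (simp add: inside_def)
  also have "\<dots> \<longleftrightarrow> (\<exists>\<alpha>>0. \<exists>\<beta>>0. ?p = \<alpha> *\<^sub>R ?u + \<beta> *\<^sub>R ?v)"
  proof
    assume h: "triple ?p ?u ?v = 0 \<and> 0 < ?n \<bullet> cross3 ?u ?p \<and> 0 < ?n \<bullet> cross3 ?p ?v"
    have "?n \<noteq> 0" using v by (simp add: vec_of_eq_0)
    then obtain \<alpha> \<beta> where ab: "?p = \<alpha> *\<^sub>R ?u + \<beta> *\<^sub>R ?v" using plane_comb h by blast
    have "0 < \<beta> * (?n \<bullet> ?n)" "0 < \<alpha> * (?n \<bullet> ?n)" using inner_cross_pos[OF ab] h by metis+
    then show "\<exists>\<alpha>>0. \<exists>\<beta>>0. ?p = \<alpha> *\<^sub>R ?u + \<beta> *\<^sub>R ?v" using ab nn by (metis zero_less_mult_pos2)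
  next
    assume "\<exists>\<alpha>>0. \<exists>\<beta>>0. ?p = \<alpha> *\<^sub>R ?u + \<beta> *\<^sub>R ?v"
    then obtain \<alpha> \<beta> where ab: "0 < \<alpha>" "0 < \<beta>" "?p = \<alpha> *\<^sub>R ?u + \<beta> *\<^sub>R ?v" by blast
    have "triple ?p ?u ?v = 0" unfolding ab(3) by (simp del: triple_vec_of)
    moreover have "0 < \<beta> * (?n \<bullet> ?n)" "0 < \<alpha> * (?n \<bullet> ?n)" using ab nn by simp_all
    ultimately show "triple ?p ?u ?v = 0 \<and> 0 < ?n \<bullet> cross3 ?u ?p \<and> 0 < ?n \<bullet> cross3 ?p ?v"
      using inner_cross_pos[OF ab(3)] by metis
  qed
  also have "\<dots> \<longleftrightarrow> (\<exists>\<alpha>>0. \<exists>\<beta>>0. x = \<alpha> *\<^sub>R sph (fst a) + \<beta> *\<^sub>R sph (snd a))"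
  proof
    assume "\<exists>\<alpha>>0. \<exists>\<beta>>0. ?p = \<alpha> *\<^sub>R ?u + \<beta> *\<^sub>R ?v"
    then obtain \<alpha> \<beta> where ab: "0 < \<alpha>" "0 < \<beta>" "?p = \<alpha> *\<^sub>R ?u + \<beta> *\<^sub>R ?v" by blast
    have "x = (c * \<alpha> / d) *\<^sub>R sph (fst a) + (c * \<beta> / e) *\<^sub>R sph (snd a)"
      unfolding det(1) ab(3) d(2) e(2) using d e by (simp add: scaleR_add_right)
    moreover have "0 < c * \<alpha> / d" "0 < c * \<beta> / e" using ab d e det by simp_all
    ultimately show "\<exists>\<alpha>>0. \<exists>\<beta>>0. x = \<alpha> *\<^sub>R sph (fst a) + \<beta> *\<^sub>R sph (snd a)" by blast
  next
    assume "\<exists>\<alpha>>0. \<exists>\<beta>>0. x = \<alpha> *\<^sub>R sph (fst a) + \<beta> *\<^sub>R sph (snd a)"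
    then obtain \<alpha> \<beta> where ab: "0 < \<alpha>" "0 < \<beta>" "x = \<alpha> *\<^sub>R sph (fst a) + \<beta> *\<^sub>R sph (snd a)" by blast
    have "?p = (1 / c) *\<^sub>R x" using det by simp
    then have "?p = (\<alpha> * d / c) *\<^sub>R ?u + (\<beta> * e / c) *\<^sub>R ?v"
      unfolding ab(3) d(2) e(2) by (simp add: scaleR_add_right)
    moreover have "0 < \<alpha> * d / c" "0 < \<beta> * e / c" using ab d e det by simp_all
    ultimately show "\<exists>\<alpha>>0. \<exists>\<beta>>0. ?p = \<alpha> *\<^sub>R ?u + \<beta> *\<^sub>R ?v" by blast
  qed
  also have "\<dots> \<longleftrightarrow> x \<in> arc_relint (arc_of a)"
    using relint_iff[OF valid_arc_of[OF v] ends_arc_of] x by simp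
  finally show ?thesis by blast
qed

lemma sph_in_relint:
  assumes "crs (fst a) (snd a) \<noteq> (0, 0, 0)" "p \<noteq> (0, 0, 0)"
  shows "sph p \<in> arc_relint (arc_of a) \<longleftrightarrow> inside a p"
proof -
  obtain c where "0 < c" "sph p = c *\<^sub>R vec_of p" "norm (sph p) = 1" using sphE[OF assms(2)] by blast
  then show ?thesis using relint_arc_of[OF assms(1)] by blast
qed

lemma relint_arc_of_plane:
  assumes v: "crs (fst a) (snd a) \<noteq> (0, 0, 0)" and x: "x \<in> arc_relint (arc_of a)"
  shows "x \<bullet> vec_of (crs (fst a) (snd a)) = 0" "norm x = 1"
proof -
  have nz: "fst a \<noteq> (0, 0, 0)" "snd a \<noteq> (0, 0, 0)" using v by (metis crs_zero)+
  obtain d where d: "sph (fst a) = d *\<^sub>R vec_of (fst a)" using sphE[OF nz(1)] by blast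
  obtain e where e: "sph (snd a) = e *\<^sub>R vec_of (snd a)" using sphE[OF nz(2)] by blast
  obtain \<alpha> \<beta> where "norm x = 1" "x = \<alpha> *\<^sub>R sph (fst a) + \<beta> *\<^sub>R sph (snd a)"
    using relint_iff[OF valid_arc_of[OF v] ends_arc_of] x by blast
  then show "norm x = 1" "x \<bullet> vec_of (crs (fst a) (snd a)) = 0"
    by (simp_all add: d e cross_vec_of[symmetric] inner_add_left dot_cross_self del: cross_vec_of)
qed

definition apart :: "ivec \<times> ivec \<Rightarrow> ivec \<times> ivec \<Rightarrow> bool" where
  "apart a b \<longleftrightarrow> (let m = crs (crs (fst a) (snd a)) (crs (fst b) (snd b)) in
     m \<noteq> (0, 0, 0) \<and> \<not> (inside a m \<and> inside b m) \<and> \<not> (inside a (minus_ivec m) \<and> inside b (minus_ivec m)))"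

text \<open>Two great circles meet in two antipodal points only.\<close>
lemma apart_disjoint:
  assumes "apart a b" shows "arc_relint (arc_of a) \<inter> arc_relint (arc_of b) = {}"
proof (rule ccontr)
  let ?m = "crs (crs (fst a) (snd a)) (crs (fst b) (snd b))"
  have m: "?m \<noteq> (0, 0, 0)" "\<not> (inside a ?m \<and> inside b ?m)" "\<not> (inside a (minus_ivec ?m) \<and> inside b (minus_ivec ?m))"
    using assms by (simp_all add: apart_def Let_def)
  have v: "crs (fst a) (snd a) \<noteq> (0, 0, 0)" "crs (fst b) (snd b) \<noteq> (0, 0, 0)" using m(1) by (metis crs_zero)+
  assume "arc_relint (arc_of a) \<inter> arc_relint (arc_of b) \<noteq> {}"
  then obtain x where x: "x \<in> arc_relint (arc_of a)" "x \<in> arc_relint (arc_of b)" by blast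
  let ?r = "vec_of (crs (fst a) (snd a))" and ?s = "vec_of (crs (fst b) (snd b))" and ?v = "vec_of ?m"
  have z: "x \<bullet> ?r = 0" "x \<bullet> ?s = 0" "norm x = 1"
    using relint_arc_of_plane[OF v(1) x(1)] relint_arc_of_plane[OF v(2) x(2)] by simp_all
  have "cross3 x (cross3 ?r ?s) = 0" using z Lagrange[of x ?r ?s] by (simp del: cross_vec_of)
  then have "cross3 x ?v = 0" by simp
  then have "collinear {0, x, ?v}" by (simp add: cross_eq_0)
  then obtain c where "x = 0 \<or> ?v = 0 \<or> ?v = c *\<^sub>R x" by (auto simp: collinear_lemma)
  moreover have "x \<noteq> 0" "?v \<noteq> 0" using z m by (auto simp: vec_of_eq_0)
  ultimately have c: "?v = c *\<^sub>R x" "c \<noteq> 0" by auto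
  then have xe: "x = (1 / c) *\<^sub>R ?v" "x = (- 1 / c) *\<^sub>R vec_of (minus_ivec ?m)" by simp_all
  show False
  proof (cases "0 < c")
    case True
    then show False using relint_arc_of[OF v(1) z(3) xe(1)] relint_arc_of[OF v(2) z(3) xe(1)] x m by simp
  next
    case False
    then have "0 < - 1 / c" using c by (simp add: zero_less_divide_iff)
    then show False using relint_arc_of[OF v(1) z(3) xe(2)] relint_arc_of[OF v(2) z(3) xe(2)] x m by simp
  qed
qed

definition grid_diagram :: "(ivec \<times> ivec) list \<Rightarrow> bool" where
  "grid_diagram L \<longleftrightarrow> L \<noteq> [] \<and> (\<forall>a\<in>set L. crs (fst a) (snd a) \<noteq> (0, 0, 0)) \<and>
     (\<forall>a\<in>set L. \<forall>b\<in>set L. a = b \<or> apart a b) \<and>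
     (\<forall>a\<in>set L. (\<exists>b\<in>set L. inside b (fst a)) \<and> (\<exists>b\<in>set L. inside b (snd a)))"

lemma grid_spherical:
  assumes "grid_diagram L"
  shows "spherical_diagram (arc_of ` set L)" "inj_on arc_of (set L)"
proof -
  have v: "crs (fst a) (snd a) \<noteq> (0, 0, 0)" and nz: "fst a \<noteq> (0, 0, 0)" "snd a \<noteq> (0, 0, 0)" if "a \<in> set L" for a
    using assms that unfolding grid_diagram_def by (metis crs_zero)+
  have disj: "arc_relint (arc_of a) \<inter> arc_relint (arc_of b) = {}" if "a \<in> set L" "b \<in> set L" "a \<noteq> b" for a b
    using assms that apart_disjoint unfolding grid_diagram_def by blast
  have bl: "\<exists>b\<in>set L. sph (fst a) \<in> arc_relint (arc_of b)" "\<exists>b\<in>set L. sph (snd a) \<in> arc_relint (arc_of b)"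
    if "a \<in> set L" for a
    using assms that sph_in_relint[OF v] nz[OF that] unfolding grid_diagram_def by blast+
  show "spherical_diagram (arc_of ` set L)"
    unfolding spherical_diagram_def
  proof (intro conjI ballI impI)
    show "finite (arc_of ` set L)" "arc_of ` set L \<noteq> {}" using assms by (simp_all add: grid_diagram_def)
    fix x assume "x \<in> arc_of ` set L"
    then obtain a where a: "a \<in> set L" "x = arc_of a" by blast
    show "valid_arc x" using valid_arc_of v a by blast
    show "\<exists>b\<in>arc_of ` set L. fst x \<in> arc_relint b" "\<exists>b\<in>arc_of ` set L. snd x \<in> arc_relint b"
      using bl[OF a(1)] a(2) by (simp_all add: arc_of_def)
    fix y assume "y \<in> arc_of ` set L" "x \<noteq> y"
    then show "arc_relint x \<inter> arc_relint y = {}" using disj a by blast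
  qed
  show "inj_on arc_of (set L)"
  proof (rule inj_onI, rule ccontr)
    fix a b assume h: "a \<in> set L" "b \<in> set L" "arc_of a = arc_of b" "a \<noteq> b"
    \<comment> \<open>Equal images would share their midpoint.\<close>
    have "sgn ((1 - 1/2) *\<^sub>R fst (arc_of a) + (1/2) *\<^sub>R snd (arc_of a)) \<in> arc_relint (arc_of a)"
      unfolding arc_relint_def by (rule CollectI, rule exI[of _ "1/2"]) simp
    then show False using disj[OF h(1,2,4)] h(3) by auto
  qed
qed

definition one_sided :: "(ivec \<times> ivec) list \<Rightarrow> bool" where
  "one_sided L \<longleftrightarrow> (\<forall>a\<in>set L. \<exists>s\<in>set [1, - 1]. \<forall>b\<in>set L.
     (inside a (fst b) \<longrightarrow> sgn (det3 (snd b) (fst a) (snd a)) = s) \<and>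
     (inside a (snd b) \<longrightarrow> sgn (det3 (fst b) (fst a) (snd a)) = s))"

lemma grid_occlusion:
  assumes L: "grid_diagram L" and one: "one_sided L"
  shows "spherical_occlusion_diagram (arc_of ` set L)"
proof -
  have v: "crs (fst a) (snd a) \<noteq> (0, 0, 0)" and nz: "fst a \<noteq> (0, 0, 0)" "snd a \<noteq> (0, 0, 0)" if "a \<in> set L" for a
    using L that unfolding grid_diagram_def by (metis crs_zero)+
  have side: "\<exists>s. \<forall>b t. b \<in> set L \<longrightarrow> hits_from_side (arc_of b) (arc_of a) t \<longrightarrow> t = s" if a: "a \<in> set L" for a
  proof -
    obtain s where s: "\<forall>b\<in>set L. (inside a (fst b) \<longrightarrow> sgn (det3 (snd b) (fst a) (snd a)) = s) \<and>
        (inside a (snd b) \<longrightarrow> sgn (det3 (fst b) (fst a) (snd a)) = s)"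
      using one a unfolding one_sided_def by blast
    have "t = of_int s" if b: "b \<in> set L" and h: "hits_from_side (arc_of b) (arc_of a) t" for b t
    proof -
      obtain x y where xy: "arc_of b = (x, y) \<or> arc_of b = (y, x)" "x \<in> arc_relint (arc_of a)"
        "t = sgn (triple y (sph (fst a)) (sph (snd a)))"
        using h unfolding hits_from_side_def triple_def arc_of_def fst_conv snd_conv by blast
      from xy(1) consider "x = sph (fst b)" "y = sph (snd b)" | "x = sph (snd b)" "y = sph (fst b)"
        by (auto simp: arc_of_def)
      then show ?thesis
      proof cases
        case 1
        then have "inside a (fst b)" using xy(2) sph_in_relint[OF v[OF a] nz(1)[OF b]] by simp
        then show ?thesis using s b 1 xy(3) sgn_triple_sph[OF nz(2)[OF b] nz[OF a]] by simp
      next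
        case 2
        then have "inside a (snd b)" using xy(2) sph_in_relint[OF v[OF a] nz(2)[OF b]] by simp
        then show ?thesis using s b 2 xy(3) sgn_triple_sph[OF nz(1)[OF b] nz[OF a]] by simp
      qed
    qed
    then show ?thesis by blast
  qed
  have "s = t" if xyz: "x \<in> arc_of ` set L" "y \<in> arc_of ` set L" "z \<in> arc_of ` set L"
    and h: "hits_from_side y x s" "hits_from_side z x t" for x y z s t
  proof -
    obtain a b c where "a \<in> set L" "x = arc_of a" "b \<in> set L" "y = arc_of b" "c \<in> set L" "z = arc_of c"
      using xyz by blast
    then show ?thesis using side h by metis
  qed
  then show ?thesis using grid_spherical(1)[OF L] unfolding spherical_occlusion_diagram_def by blast
qed

text \<open>Here a pair means an arc traversed from its first to its second component; the swapped
  copies provide the other direction, and \<open>s\<close> is the sense of rotation.\<close>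

definition follows :: "(ivec \<times> ivec) list \<Rightarrow> int \<Rightarrow> ivec \<times> ivec \<Rightarrow> (ivec \<times> ivec) list" where
  "follows L s x = filter (\<lambda>y. if inside y (snd x) then 0 < s * det3 (fst x) (snd x) (snd y) else False) (L @ map prod.swap L)"

text \<open>Forgets the direction of traversal.\<close>

definition listed :: "(ivec \<times> ivec) list \<Rightarrow> ivec \<times> ivec \<Rightarrow> ivec \<times> ivec" where
  "listed L x = (if x \<in> set L then x else prod.swap x)"

text \<open>An arc traversed towards one of its ends determines its successor in a swirl of given sense;
  after two steps every such walk runs around a triangle in \<open>W\<close>.\<close>
definition only_swirls :: "(ivec \<times> ivec) list \<Rightarrow> (ivec \<times> ivec) list list \<Rightarrow> bool" where
  "only_swirls L W \<longleftrightarrow> (\<forall>s\<in>set [1, - 1]. \<forall>a\<in>set (L @ map prod.swap L). \<forall>b\<in>set (follows L s a).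
     \<forall>x\<in>set (follows L s b). \<forall>y\<in>set (follows L s x). \<forall>z\<in>set (follows L s y). \<forall>t\<in>set (follows L s z).
       t = x \<and> listed L x \<noteq> listed L y \<and>
       (\<exists>w\<in>set W. [listed L x, listed L y, listed L z] \<in> set [w, rotate 1 w, rotate 2 w]))"

lemma inside_swap: "inside (prod.swap a) p \<longleftrightarrow> inside a p"
proof -
  obtain u v where a: "a = (u, v)" by (cases a)
  have "det3 p v u = - det3 p u v" "dot (crs v u) (crs v p) = dot (crs u v) (crs p v)"
    "dot (crs v u) (crs p u) = dot (crs u v) (crs u p)"
    by (cases p; cases u; cases v; simp add: det3_def algebra_simps)+
  then show ?thesis unfolding inside_def a by (auto split: if_splits)
qed

lemma rotation_class: "{rotate m (rotate n xs) |m. True} = {rotate m xs |m. True}"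
proof
  show "{rotate m (rotate n xs) |m. True} \<subseteq> {rotate m xs |m. True}" by (auto simp: rotate_rotate)
  have "\<exists>l. rotate m xs = rotate l (rotate n xs)" for m
  proof (cases xs)
    case Nil then show ?thesis by simp
  next
    case (Cons x ys)
    \<comment> \<open>Full turns are added until at least \<open>n\<close> single rotations can be
      split off.\<close>
    have "rotate m xs = rotate (m + length xs * n) xs" by (metis rotate_conv_mod mod_mult_self2)
    also have "m + length xs * n = (m + length ys * n) + n" unfolding Cons by simp
    finally show ?thesis by (metis rotate_rotate)
  qed
  then show "{rotate m xs |m. True} \<subseteq> {rotate m (rotate n xs) |m. True}" by blast
qed

text \<open>Repeated periodically, a swirl is an infinite walk along \<open>follows\<close>. By
  \<open>only_swirls\<close> it has period three after two steps, so its length divides 3; it is not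
  1, and the three arcs form a listed triangle.\<close>

lemma num_swirls_le:
  assumes L: "grid_diagram L" and W: "only_swirls L W"
  shows "num_swirls (arc_of ` set L) \<le> length W"
proof -
  let ?c = "\<lambda>xs. {rotate n xs |n. True}"
  let ?S = "set (L @ map prod.swap L)"
  have v: "crs (fst a) (snd a) \<noteq> (0, 0, 0)" and nz: "fst a \<noteq> (0, 0, 0)" "snd a \<noteq> (0, 0, 0)" if "a \<in> set L" for a
    using L that unfolding grid_diagram_def by (metis crs_zero)+
  have "?c xs \<in> (\<lambda>w. ?c (map arc_of w)) ` set W" if sw: "is_swirl (arc_of ` set L) xs" for xs
  proof -
    let ?m = "length xs"
    obtain p q where xs: "xs \<noteq> []" "distinct xs" "set xs \<subseteq> arc_of ` set L"
      and hit: "\<And>i. i < ?m \<Longrightarrow> (xs ! i = (q i, p i) \<or> xs ! i = (p i, q i)) \<and> p i \<in> arc_relint (xs ! ((i + 1) mod ?m))"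
      and tr: "(\<forall>i<?m. triple (q i) (p i) (p ((i + 1) mod ?m)) > 0) \<or> (\<forall>i<?m. triple (q i) (p i) (p ((i + 1) mod ?m)) < 0)"
      using sw unfolding is_swirl_def by blast
    obtain s :: int where s: "s \<in> set [1, - 1]" and sg: "\<And>i. i < ?m \<Longrightarrow> sgn (triple (q i) (p i) (p ((i + 1) mod ?m))) = of_int s"
    proof (cases "\<forall>i<?m. triple (q i) (p i) (p ((i + 1) mod ?m)) > 0")
      case True then show thesis using that[of 1] by simp
    next
      case False
      then have "\<forall>i<?m. triple (q i) (p i) (p ((i + 1) mod ?m)) < 0" using tr by blast
      then have neg: "sgn (triple (q i) (p i) (p ((i + 1) mod ?m))) = of_int (- 1)" if "i < ?m" for i using that by simp
      show thesis by (rule that[OF _ neg]) simp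
    qed
    have "\<exists>x. x \<in> ?S \<and> listed L x \<in> set L \<and> sph (fst x) = q i \<and> sph (snd x) = p i \<and> arc_of (listed L x) = xs ! i" if i: "i < ?m" for i
    proof -
      obtain a where a: "a \<in> set L" "xs ! i = arc_of a" using xs(3) nth_mem[OF i] by blast
      \<comment> \<open>No arc is listed in both orders, so \<open>listed\<close> recovers the arc
        from either traversal.\<close>
      have sa: "prod.swap a \<notin> set L"
      proof
        assume "prod.swap a \<in> set L"
        moreover have "\<forall>a\<in>set L. \<forall>b\<in>set L. a = b \<or> apart a b" using L by (simp add: grid_diagram_def)
        moreover have "crs x x = (0, 0, 0)" for x by (cases x; simp)
        then have "prod.swap a \<noteq> a" using v[OF a(1)] by (cases a) auto
        moreover have "crs (crs x y) (crs y x) = (0, 0, 0)" for x y by (cases x; cases y; simp add: algebra_simps)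
        then have "\<not> apart a (prod.swap a)" by (simp add: apart_def Let_def)
        ultimately show False using a(1) by metis
      qed
      consider "xs ! i = (q i, p i)" | "xs ! i = (p i, q i)" using hit[OF i] by blast
      then show ?thesis
      proof cases
        case 1
        then have "a \<in> ?S \<and> listed L a \<in> set L \<and> sph (fst a) = q i \<and> sph (snd a) = p i \<and> arc_of (listed L a) = xs ! i"
          using a by (simp add: listed_def arc_of_def)
        then show ?thesis by blast
      next
        case 2
        then have "prod.swap a \<in> ?S \<and> listed L (prod.swap a) \<in> set L \<and> sph (fst (prod.swap a)) = q i
          \<and> sph (snd (prod.swap a)) = p i \<and> arc_of (listed L (prod.swap a)) = xs ! i"
          using a sa by (auto simp: listed_def arc_of_def)
        then show ?thesis by blast
      qed
    qed
    then obtain \<sigma> where \<sigma>: "\<And>i. i < ?m \<Longrightarrow> \<sigma> i \<in> ?S \<and> listed L (\<sigma> i) \<in> set L \<and> sph (fst (\<sigma> i)) = q i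
        \<and> sph (snd (\<sigma> i)) = p i \<and> arc_of (listed L (\<sigma> i)) = xs ! i" by metis
    define X where "X j = \<sigma> (j mod ?m)" for j
    have lt: "j mod ?m < ?m" for j using xs(1) by simp
    have XS: "X j \<in> ?S" "listed L (X j) \<in> set L" "arc_of (listed L (X j)) = xs ! (j mod ?m)"
      and Xpq: "sph (fst (X j)) = q (j mod ?m)" "sph (snd (X j)) = p (j mod ?m)" for j
      using \<sigma>[OF lt[of j]] by (simp_all add: X_def)
    have Xnz: "fst (X j) \<noteq> (0, 0, 0)" "snd (X j) \<noteq> (0, 0, 0)" for j
      using nz[OF XS(2)[of j]] by (cases "X j \<in> set L"; simp add: listed_def)+
    have step: "X (Suc j) \<in> set (follows L s (X j))" for j
    proof -
      have sm: "(j mod ?m + 1) mod ?m = Suc j mod ?m" by (simp add: mod_simps)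
      have "sph (snd (X j)) \<in> arc_relint (arc_of (listed L (X (Suc j))))"
        using hit[OF lt[of j]] unfolding sm XS(3) Xpq(2) by blast
      then have "inside (listed L (X (Suc j))) (snd (X j))"
        using sph_in_relint[OF v[OF XS(2)] Xnz(2)] by blast
      then have "inside (X (Suc j)) (snd (X j))" unfolding listed_def by (metis inside_swap)
      moreover have "(of_int (sgn (det3 (fst (X j)) (snd (X j)) (snd (X (Suc j))))) :: real) = of_int s"
        using sg[OF lt[of j]] unfolding sm
        by (simp only: Xpq[symmetric] sgn_triple_sph[OF Xnz(1) Xnz(2) Xnz(2)])
      then have "0 < s * det3 (fst (X j)) (snd (X j)) (snd (X (Suc j)))"
        using s by (auto simp: sgn_if split: if_splits)
      ultimately show ?thesis unfolding follows_def using XS(1)[of "Suc j"] by simp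
    qed
    \<comment> \<open>The triangle is certified only from index 2 on, hence the rotation by 2
      below.\<close>
    have "X 5 = X 2 \<and> listed L (X 2) \<noteq> listed L (X 3) \<and>
       (\<exists>w\<in>set W. [listed L (X 2), listed L (X 3), listed L (X 4)] \<in> set [w, rotate 1 w, rotate 2 w])"
      using W[unfolded only_swirls_def, rule_format, OF s XS(1)[of 0] step[of 0]] step[of 1] step[of 2] step[of 3] step[of 4]
      by (simp add: eval_nat_numeral)
    then obtain w n where X5: "X 5 = X 2" and ne: "listed L (X 2) \<noteq> listed L (X 3)" and w: "w \<in> set W"
      and rot: "[listed L (X 2), listed L (X 3), listed L (X 4)] = rotate n w"
      by (metis (no_types, lifting) empty_iff empty_set insert_iff list.simps(15) rotate0 id_apply)
    have "xs ! (5 mod ?m) = xs ! (2 mod ?m)" using XS(3)[of 5] XS(3)[of 2] X5 by simp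
    then have "5 mod ?m = 2 mod ?m" using xs(2) lt nth_eq_iff_index_eq by blast
    then have dvd: "?m dvd 3" by (simp add: mod_eq_dvd_iff_nat)
    have "?m \<noteq> 1" using ne by (auto simp: X_def)
    moreover have "?m = 0 \<or> ?m = 1 \<or> ?m = 2 \<or> ?m = 3" using dvd_imp_le[OF dvd] by linarith
    moreover have "\<not> 2 dvd (3::nat)" by simp
    ultimately have m3: "?m = 3" using dvd xs(1) by auto
    obtain a b c where "xs = [a, b, c]" using m3 by (auto simp: length_Suc_conv numeral_3_eq_3)
    then have "rotate 2 xs = [xs ! 2, xs ! 0, xs ! 1]" by (simp add: numeral_2_eq_2)
    also have "\<dots> = map arc_of [listed L (X 2), listed L (X 3), listed L (X 4)]" using XS(3)[of 2] XS(3)[of 3] XS(3)[of 4] m3 by simp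
    also have "\<dots> = rotate n (map arc_of w)" unfolding rot by (simp add: rotate_map)
    finally have "?c xs = ?c (map arc_of w)" using rotation_class[of 2 xs] rotation_class[of n "map arc_of w"] by simp
    then show ?thesis using w by blast
  qed
  then have "?c ` {xs. is_swirl (arc_of ` set L) xs} \<subseteq> (\<lambda>w. ?c (map arc_of w)) ` set W" by blast
  then have "num_swirls (arc_of ` set L) \<le> card ((\<lambda>w. ?c (map arc_of w)) ` set W)"
    unfolding num_swirls_def by (intro card_mono) simp_all
  also have "\<dots> \<le> length W" using card_image_le[of "set W" "\<lambda>w. ?c (map arc_of w)"] card_length[of W] by simp
  finally show ?thesis .
qed

text \<open>The product is negative exactly when the coefficients of \<open>f\<close> in terms of
  the ends have opposite signs, which keeps \<open>f\<close> and its antipode off the arc. The four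
  candidates belong to \<open>poles k\<close> for all \<open>k\<close> from 4 on.\<close>

definition grid_oriented :: "(ivec \<times> ivec) list \<Rightarrow> bool" where
  "grid_oriented L \<longleftrightarrow> (\<forall>a\<in>set L. \<exists>f\<in>set [(0, 0, 1), (0, 1, 0), (1, 0, 0), (1, 1, 0)].
     det3 f (fst a) (snd a) = 0 \<and>
     dot (crs (fst a) (snd a)) (crs (fst a) f) * dot (crs (fst a) (snd a)) (crs f (snd a)) < 0)"

text \<open>The factor \<open>c\<close> may have either sign, so pole and antipode are handled
  together.\<close>

lemma not_on_arc:
  assumes v: "crs (fst a) (snd a) \<noteq> (0, 0, 0)"
    and f: "dot (crs (fst a) (snd a)) (crs (fst a) f) * dot (crs (fst a) (snd a)) (crs f (snd a)) < 0"
  shows "c *\<^sub>R vec_of f \<notin> arc_points (arc_of a)"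
proof
  assume "c *\<^sub>R vec_of f \<in> arc_points (arc_of a)"
  then obtain t where t: "0 \<le> t" "t \<le> 1"
    "c *\<^sub>R vec_of f = sgn ((1 - t) *\<^sub>R sph (fst a) + t *\<^sub>R sph (snd a))" by (auto simp: arc_points_def arc_of_def)
  have nz: "fst a \<noteq> (0, 0, 0)" "snd a \<noteq> (0, 0, 0)" using v by (metis crs_zero)+
  obtain d where d: "0 < d" "sph (fst a) = d *\<^sub>R vec_of (fst a)" using sphE[OF nz(1)] by blast
  obtain e where e: "0 < e" "sph (snd a) = e *\<^sub>R vec_of (snd a)" using sphE[OF nz(2)] by blast
  let ?k = "inverse (norm ((1 - t) *\<^sub>R sph (fst a) + t *\<^sub>R sph (snd a)))"
  let ?n = "crs (fst a) (snd a)" and ?\<alpha> = "?k * ((1 - t) * d)" and ?\<beta> = "?k * (t * e)"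
  have x: "c *\<^sub>R vec_of f = ?\<alpha> *\<^sub>R vec_of (fst a) + ?\<beta> *\<^sub>R vec_of (snd a)"
    unfolding t(3) sgn_div_norm by (simp add: scaleR_add_right d e)
  have pos: "0 \<le> ?\<alpha>" "0 \<le> ?\<beta>" using t d e by simp_all
  have cp: "cross3 u (c *\<^sub>R x) = c *\<^sub>R cross3 u x" "cross3 (c *\<^sub>R x) u = c *\<^sub>R cross3 x u" for u x
    by (simp_all add: cross_mult_left cross_mult_right)
  have "c * of_int (dot ?n (crs (fst a) f)) = ?\<beta> * of_int (dot ?n ?n)"
    "c * of_int (dot ?n (crs f (snd a))) = ?\<alpha> * of_int (dot ?n ?n)"
    using inner_cross_pos[OF x] unfolding cp by simp_all
  moreover have "0 \<le> (of_int (dot ?n ?n) :: real)" using inner_ge_zero[of "vec_of ?n"] by simp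
  ultimately have "0 \<le> c * of_int (dot ?n (crs (fst a) f)) * (c * of_int (dot ?n (crs f (snd a))))"
    using pos by simp
  then have "0 \<le> (c * c) * of_int (dot ?n (crs (fst a) f) * dot ?n (crs f (snd a)))" by (simp add: ac_simps)
  moreover have "c \<noteq> 0"
  proof
    assume "c = 0"
    then have "(1 - t) *\<^sub>R sph (fst a) + t *\<^sub>R sph (snd a) = 0" using t(3) by (simp add: sgn_zero_iff)
    then show False using chord_nonzero[OF valid_arc_of[OF v] ends_arc_of, of "1 - t" t] t by simp
  qed
  then have "0 < c * c" by (metis not_real_square_gt_zero)
  ultimately have "0 \<le> dot ?n (crs (fst a) f) * dot ?n (crs f (snd a))"
    by (simp add: zero_le_mult_iff)
  then show False using f by simp
qed

section \<open>Poles and examples\<close>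

text \<open>\<open>k - 1\<close> pairwise non-parallel directions; from \<open>k = 4\<close> on they
  include \<open>(1, 0, 0)\<close> and \<open>(1, 1, 0)\<close>, which the examples use.\<close>

definition equatorial :: "nat \<Rightarrow> ivec set" where
  "equatorial k = insert (0, 1, 0) ((\<lambda>j. (1, int j, 0)) ` {..<k - 2})"

definition poles :: "nat \<Rightarrow> point set" where
  "poles k = sph ` insert (0, 0, 1) (equatorial k)"

lemma finite_equatorial [simp]: "finite (equatorial k)" by (simp add: equatorial_def)

lemma card_equatorial: "2 \<le> k \<Longrightarrow> card (equatorial k) = k - 1"
proof -
  assume "2 \<le> k"
  have "inj_on (\<lambda>j. (1::int, int j, 0::int)) {..<k - 2}" by (auto simp: inj_on_def)
  then have "card ((\<lambda>j. (1::int, int j, 0::int)) ` {..<k - 2}) = k - 2" by (simp add: card_image)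
  moreover have "(0, 1, 0) \<notin> (\<lambda>j. (1::int, int j, 0::int)) ` {..<k - 2}" by auto
  ultimately show ?thesis using \<open>2 \<le> k\<close> unfolding equatorial_def by simp
qed

lemma pole_distinct:
  assumes "a \<in> insert (0, 0, 1) (equatorial k)" "b \<in> insert (0, 0, 1) (equatorial k)" "a \<noteq> b"
  shows "sph a \<noteq> sph b" "sph a \<noteq> - sph b"
proof -
  have "crs a b \<noteq> (0, 0, 0)" using assms by (auto simp: equatorial_def)
  then have "valid_arc (arc_of (a, b))" by (intro valid_arc_of) simp
  then show "sph a \<noteq> sph b" "sph a \<noteq> - sph b" by (auto simp: valid_arc_def arc_of_def)
qed

lemma norm_pole: "a \<in> insert (0, 0, 1) (equatorial k) \<Longrightarrow> norm (sph a) = 1"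
  by (rule sphE[of a]) (auto simp: equatorial_def)

text \<open>Through a pole on the equator pass the equator and one meridian; through the remaining
  pole, one meridian for each of the others.\<close>

lemma poles_alignment:
  assumes k: "4 \<le> k"
  shows "finite (poles k)" "card (poles k) = k" "has_alignment (poles k) (replicate (k - 1) 2 @ [k - 1])"
proof -
  let ?R = "equatorial k" and ?N = "sph (0, 0, 1)"
  have inj: "inj_on sph (insert (0, 0, 1) ?R)" using pole_distinct(1)[of _ k] by (meson inj_onI)
  have NR: "(0, 0, 1) \<notin> ?R" by (auto simp: equatorial_def)
  have cR: "card ?R = k - 1" using card_equatorial k by simp
  show fin: "finite (poles k)" by (simp add: poles_def)
  show "card (poles k) = k" unfolding poles_def card_image[OF inj] using NR cR k by simp
  have NQ: "?N \<notin> sph ` ?R" using inj NR by auto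
  have cQ: "card (sph ` ?R) = k - 1" using card_image[OF inj_on_subset[OF inj subset_insertI]] cR by simp
  have perp: "sph r \<bullet> ?N = 0" if "r \<in> ?R" for r
  proof -
    have "r \<noteq> (0, 0, 0)" "dot r (0, 0, 1) = 0" using that by (auto simp: equatorial_def)
    moreover obtain c where "sph r = c *\<^sub>R vec_of r" using sphE[OF calculation(1)] by blast
    moreover obtain d where "?N = d *\<^sub>R vec_of (0, 0, 1)" using sphE[of "(0, 0, 1)"] by auto
    ultimately show ?thesis by (simp del: vec_of.simps)
  qed
  have NN: "?N \<bullet> ?N = 1" using norm_pole[of "(0, 0, 1)" k] by (simp add: dot_square_norm)
  have flat: "triple (sph r) (sph s) (sph t) = 0" if r: "r \<in> ?R" "s \<in> ?R" "t \<in> ?R" for r s t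
  proof -
    have nz: "r \<noteq> (0, 0, 0)" "s \<noteq> (0, 0, 0)" "t \<noteq> (0, 0, 0)" and "det3 r s t = 0"
      using r by (auto simp: equatorial_def det3_def)
    then show ?thesis using sgn_triple_sph[OF nz] by (simp add: sgn_zero_iff)
  qed
  have not_multiple: "sph a \<noteq> c *\<^sub>R sph b" if "a \<in> insert (0, 0, 1) ?R" "b \<in> insert (0, 0, 1) ?R" "a \<noteq> b" for a b c
    using unit_multiple[OF norm_pole norm_pole] pole_distinct that by metis
  have equator: "span {sph r, sph s} = span {sph r, sph t}" if r: "r \<in> ?R" "s \<in> ?R" "t \<in> ?R" and ne: "r \<noteq> s" "r \<noteq> t" for r s t
  proof -
    have "crs t r \<noteq> (0, 0, 0)" using r ne by (auto simp: equatorial_def)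
    then have "cross3 (sph t) (sph r) \<noteq> 0" using valid_cross[OF valid_arc_of[of "(t, r)"] ends_arc_of] by simp
    then obtain \<alpha> \<beta> where ab: "sph s = \<alpha> *\<^sub>R sph t + \<beta> *\<^sub>R sph r" using plane_comb flat[OF r(2,3,1)] by metis
    have "\<alpha> \<noteq> 0" using ab not_multiple[of s r \<beta>] r ne by auto
    from span_pair_eq[OF ab this] show ?thesis .
  qed
  have two: "circles_through (poles k) p = 2" if p: "p \<in> sph ` ?R" for p
  proof -
    obtain r where r: "r \<in> ?R" "p = sph r" using p by blast
    have "\<not> ?R \<subseteq> {r}" using card_mono[of "{r}" ?R] cR k by auto
    then obtain s where s: "s \<in> ?R" "s \<noteq> r" by blast
    have "sph ` (insert (0, 0, 1) ?R - {r}) = poles k - sph ` {r}"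
      unfolding poles_def by (rule inj_on_image_set_diff[OF inj]) (use r in auto)
    moreover have "insert (0, 0, 1) ?R - {r} = insert (0, 0, 1) (?R - {r})" using NR r by blast
    ultimately have "poles k - {p} = insert ?N (sph ` (?R - {r}))" using r by simp
    then have "(\<lambda>q. span {p, q}) ` (poles k - {p}) = insert (span {p, ?N}) ((\<lambda>t. span {p, sph t}) ` (?R - {r}))"
      by (simp add: image_image)
    also have "(\<lambda>t. span {p, sph t}) ` (?R - {r}) = (\<lambda>_. span {p, sph s}) ` (?R - {r})"
    proof (rule image_cong[OF refl])
      fix t assume "t \<in> ?R - {r}"
      then show "span {p, sph t} = span {p, sph s}" unfolding r(2) using s r(1) by (intro equator) blast+
    qed
    also have "\<dots> = {span {p, sph s}}" using s by (intro image_constant[of s]) simp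
    finally have eq: "(\<lambda>q. span {p, q}) ` (poles k - {p}) = {span {p, ?N}, span {p, sph s}}" .
    have "?N \<notin> span {p, sph s}"
    proof
      assume "?N \<in> span {p, sph s}"
      then obtain \<alpha> \<beta> where "?N = \<alpha> *\<^sub>R sph r + \<beta> *\<^sub>R sph s" unfolding in_span_pair r by blast
      then have "?N \<bullet> ?N = \<alpha> * (sph r \<bullet> ?N) + \<beta> * (sph s \<bullet> ?N)" by (metis inner_add_left inner_scaleR_left)
      then show False using NN perp r s by simp
    qed
    then have "span {p, ?N} \<noteq> span {p, sph s}" by (metis insertI1 insertI2 span_base)
    then show ?thesis unfolding circles_through_def eq by simp
  qed
  have pole: "circles_through (poles k) ?N = k - 1"
  proof -
    have "poles k - {?N} = sph ` ?R" using NQ by (auto simp: poles_def)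
    moreover have "inj_on (\<lambda>q. span {?N, q}) (sph ` ?R)"
    proof (rule inj_onI, rule ccontr)
      fix x y assume xy: "x \<in> sph ` ?R" "y \<in> sph ` ?R" "span {?N, x} = span {?N, y}" "x \<noteq> y"
      then obtain r s where rs: "r \<in> ?R" "s \<in> ?R" "x = sph r" "y = sph s" "r \<noteq> s" by blast
      have "x \<in> span {?N, y}" using xy(3) by (metis insertI1 insertI2 span_base)
      then obtain \<alpha> \<beta> where ab: "x = \<alpha> *\<^sub>R ?N + \<beta> *\<^sub>R y" unfolding in_span_pair by blast
      then have "x \<bullet> ?N = \<alpha> * (?N \<bullet> ?N) + \<beta> * (y \<bullet> ?N)" by (metis inner_add_left inner_scaleR_left)
      then have "\<alpha> = 0" using NN perp rs by simp
      then show False using ab not_multiple[of r s \<beta>] rs by auto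
    qed
    ultimately show ?thesis unfolding circles_through_def by (simp add: card_image cQ)
  qed
  have "mset_set (poles k) = add_mset ?N (mset_set (sph ` ?R))" using NQ by (simp add: poles_def)
  moreover have "image_mset (circles_through (poles k)) (mset_set (sph ` ?R)) = image_mset (\<lambda>_. 2) (mset_set (sph ` ?R))"
    using two by (intro image_mset_cong) simp
  ultimately show "has_alignment (poles k) (replicate (k - 1) 2 @ [k - 1])"
    using k pole cQ by (simp add: has_alignment_def sorted_append image_mset_const_eq)
qed

lemma grid_aligned:
  assumes k: "4 \<le> k" and L: "grid_diagram L" and O: "grid_oriented L"
  shows "k_oriented_with_alignment k (replicate (k - 1) 2 @ [k - 1]) (arc_of ` set L)"
proof -
  have v: "crs (fst a) (snd a) \<noteq> (0, 0, 0)" and nz: "fst a \<noteq> (0, 0, 0)" "snd a \<noteq> (0, 0, 0)" if "a \<in> set L" for a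
    using L that unfolding grid_diagram_def by (metis crs_zero)+
  have sub: "set [(0, 0, 1), (0, 1, 0), (1, 0, 0), (1, 1, 0)] \<subseteq> insert (0, 0, 1) (equatorial k)"
    using k by (auto simp: equatorial_def image_iff intro: bexI[of _ 0] bexI[of _ 1])
  have "\<exists>p. p \<in> poles k \<and> p \<bullet> cross3 (fst x) (snd x) = 0 \<and> p \<notin> arc_points x \<and> - p \<notin> arc_points x" if x: "x \<in> arc_of ` set L" for x
  proof -
    obtain a where a: "a \<in> set L" "x = arc_of a" using x by blast
    obtain f where f: "f \<in> set [(0, 0, 1), (0, 1, 0), (1, 0, 0), (1, 1, 0)]" "det3 f (fst a) (snd a) = 0"
      "dot (crs (fst a) (snd a)) (crs (fst a) f) * dot (crs (fst a) (snd a)) (crs f (snd a)) < 0"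
      using O a unfolding grid_oriented_def by blast
    have fz: "f \<noteq> (0, 0, 0)" using f(1) by auto
    obtain c where c: "sph f = c *\<^sub>R vec_of f" using sphE[OF fz] by blast
    have "sph f \<notin> arc_points x" "- sph f \<notin> arc_points x"
      using not_on_arc[OF v[OF a(1)] f(3), of c] not_on_arc[OF v[OF a(1)] f(3), of "- c"] unfolding a(2) c by simp_all
    moreover have "sph f \<in> poles k" using f(1) sub unfolding poles_def by blast
    moreover have "triple (sph f) (sph (fst a)) (sph (snd a)) = 0"
      using sgn_triple_sph[OF fz nz[OF a(1)]] f(2) by (simp add: sgn_zero_iff)
    ultimately show ?thesis by (auto simp: triple_def a(2) arc_of_def)
  qed
  then obtain f where f: "\<And>x. x \<in> arc_of ` set L \<Longrightarrow>
    f x \<in> poles k \<and> f x \<bullet> cross3 (fst x) (snd x) = 0 \<and> f x \<notin> arc_points x \<and> - f x \<notin> arc_points x" by metis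
  have "on_sphere p" if "p \<in> poles k" for p using that norm_pole by (auto simp: poles_def on_sphere_def)
  moreover have "p \<noteq> - q" if pq: "p \<in> poles k" "q \<in> poles k" for p q
  proof
    assume eq: "p = - q"
    obtain a b where ab: "a \<in> insert (0, 0, 1) (equatorial k)" "b \<in> insert (0, 0, 1) (equatorial k)" "p = sph a" "q = sph b"
      using pq unfolding poles_def by blast
    then have "p = q" using pole_distinct(2)[OF ab(1,2)] eq by auto
    then have "2 *\<^sub>R p = 0" using eq by (metis scaleR_2 add.right_inverse)
    then have "p = 0" by simp
    then show False using norm_pole[OF ab(1)] ab(3) by simp
  qed
  ultimately have "oriented_by (arc_of ` set L) (poles k) f" unfolding oriented_by_def using f by blast
  then show ?thesis unfolding k_oriented_with_alignment_def using poles_alignment[OF k] by blast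
qed

text \<open>Both examples are symmetric under reflection in the equator: segments in the plane of height 1,
  their mirror images, and meridian arcs joining the two halves.\<close>
definition nine :: "(ivec \<times> ivec) list" where
  "nine = [((-3, 1, 1), (2, 1, 1)), ((-3, 1, -1), (2, 1, -1)), ((-1, -2, 1), (-1, 1, 1)), ((-1, -2, -1), (-1, 1, -1)),
     ((-2, -3, 1), (3, 2, 1)), ((-2, -3, -1), (3, 2, -1)), ((3, 2, 2), (3, 2, -2)), ((-3, 1, 3), (-3, 1, -3)), ((-2, -3, 2), (-2, -3, -2))]"

text \<open>Each half has two parallel segments of direction \<open>(1, 1)\<close>. The inner one
  stops the segment on the line \<open>x = 1\<close> before it reaches the outer one, which a
  meridian arc already hits from the other side.\<close>

definition eleven :: "(ivec \<times> ivec) list" where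
  "eleven = [((-8, -2, 1), (2, -2, 1)), ((-8, -2, -1), (2, -2, -1)), ((1, -2, 1), (1, 2, 1)), ((1, -2, -1), (1, 2, -1)),
     ((-4, -2, 1), (4, 6, 1)), ((-4, -2, -1), (4, 6, -1)), ((-3, -2, 1), (2, 3, 1)), ((-3, -2, -1), (2, 3, -1)),
     ((-8, -2, 3), (-8, -2, -3)), ((1, -1, 1), (1, -1, -1)), ((2, 3, 2), (2, 3, -2))]"

lemma nine_diagram: "grid_diagram nine" by code_simp
lemma nine_oriented: "grid_oriented nine" "distinct nine" "length nine = 9" by code_simp+
text \<open>Indices into the list: three triangles in each half, each containing one meridian
  arc.\<close>

lemma nine_swirls: "only_swirls nine (map (map ((!) nine)) [[1, 7, 3], [1, 5, 6], [2, 4, 8], [0, 7, 2], [0, 4, 6], [3, 5, 8]])"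
  by code_simp
lemma eleven_diagram: "grid_diagram eleven" by code_simp
lemma eleven_oriented: "grid_oriented eleven" "one_sided eleven" "distinct eleven" "length eleven = 11" by code_simp+
lemma eleven_swirls: "only_swirls eleven (map (map ((!) eleven)) [[0, 8, 4], [1, 9, 3], [2, 6, 10], [0, 9, 2], [1, 8, 5], [3, 7, 10]])"
  by code_simp

theorem mainTheorem4:
  fixes k :: nat
  assumes "k \<ge> 4"
  shows "(\<forall>D. spherical_diagram D \<and>
              k_oriented_with_alignment k (replicate (k - 1) 2 @ [k - 1]) D \<longrightarrow>
              num_swirls D \<ge> 6 \<and> card D \<ge> 9 \<and>
              (spherical_occlusion_diagram D \<longrightarrow> card D \<ge> 11))
       \<and> (\<exists>D. spherical_diagram D \<and>
              k_oriented_with_alignment k (replicate (k - 1) 2 @ [k - 1]) D \<and>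
              num_swirls D = 6 \<and> card D = 9)
       \<and> (\<exists>D. spherical_occlusion_diagram D \<and>
              k_oriented_with_alignment k (replicate (k - 1) 2 @ [k - 1]) D \<and>
              num_swirls D = 6 \<and> card D = 11)"
proof (intro conjI)
  show "\<forall>D. spherical_diagram D \<and> k_oriented_with_alignment k (replicate (k - 1) 2 @ [k - 1]) D \<longrightarrow>
      num_swirls D \<ge> 6 \<and> card D \<ge> 9 \<and> (spherical_occlusion_diagram D \<longrightarrow> card D \<ge> 11)"
    using lower_bounds[OF assms] by blast
  have grid: "spherical_diagram (arc_of ` set L)"
      "k_oriented_with_alignment k (replicate (k - 1) 2 @ [k - 1]) (arc_of ` set L)"
      "num_swirls (arc_of ` set L) = 6" "card (arc_of ` set L) = length L"
    if L: "grid_diagram L" "grid_oriented L" "distinct L" and W: "only_swirls L W" "length W = 6" for L W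
  proof -
    show sd: "spherical_diagram (arc_of ` set L)" by (rule grid_spherical(1)[OF L(1)])
    show al: "k_oriented_with_alignment k (replicate (k - 1) 2 @ [k - 1]) (arc_of ` set L)"
      by (rule grid_aligned[OF assms L(1,2)])
    \<comment> \<open>The enumeration bounds the number from above, the general theorem from
      below.\<close>
    show "num_swirls (arc_of ` set L) = 6"
      using num_swirls_le[OF L(1) W(1)] lower_bounds(1)[OF assms sd al] W(2) by simp
    show "card (arc_of ` set L) = length L"
      using card_image[OF grid_spherical(2)[OF L(1)]] distinct_card[OF L(3)] by simp
  qed
  show "\<exists>D. spherical_diagram D \<and> k_oriented_with_alignment k (replicate (k - 1) 2 @ [k - 1]) D \<and>
      num_swirls D = 6 \<and> card D = 9"
    using grid[OF nine_diagram nine_oriented(1,2) nine_swirls] nine_oriented(3)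
    by (intro exI[of _ "arc_of ` set nine"]) simp
  show "\<exists>D. spherical_occlusion_diagram D \<and> k_oriented_with_alignment k (replicate (k - 1) 2 @ [k - 1]) D \<and>
      num_swirls D = 6 \<and> card D = 11"
    using grid[OF eleven_diagram eleven_oriented(1,3) eleven_swirls] eleven_oriented(4)
      grid_occlusion[OF eleven_diagram eleven_oriented(2)]
    by (intro exI[of _ "arc_of ` set eleven"]) simp
qed

end
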